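(* Let $n\ge 1$, $h=2n+1$, and let $A=\Pi_{T_n}$ be the preprojective algebra of the quiver $T_n$ over $\mathbb{C}$, with its natural grading. Define the graded vector spaces $$U=\Big(\bigoplus_{d<h-2}HH^0(A)(d)\Big)[2],\qquad K=HH^2(A)[2].$$ Then: (a) $U$ has Hilbert series $h_U(t)=\sum_{i=1}^{n}t^{2i}$ (equivalently, $U[-2]$ has Hilbert series $\sum_{i=0}^{n-1}t^{2i}$); (b) $K$ is $n$-dimensional and is concentrated in degree zero.
   Context: The quiver $Q=T_n$ has vertex set $I=\{1,\dots,n\}$, arrows $a_i:i\to i+1$ for $1\le i\le n-1$, and one loop $b$ at the vertex $n$. Let $\bar Q$ be obtained from $Q$ by adding a reverse arrow $a_i^*:i+1\to i$ for each $i$ (no reverse is added for $b$). The preprojective algebra $A=\Pi_{T_n}$ is the path algebra $\mathbb{C}\bar Q$ modulo the relation $\sum_{i=1}^{n-1}[a_i,a_i^*]=b^2$. Paths are composed from right to left, and all arrows have degree $1$. $A$ is finite dimensional. $HH^\bullet(A)$ is Hochschild cohomology of $A$ over $\mathbb{C}$ with coefficients in $A$, with the internal grading induced by that of $A$ (a cochain raising degree by $d$ has degree $d$); $HH^0(A)$ is the center of $A$. For a graded space $W=\bigoplus_d W(d)$, $W[m]$ denotes $W$ with all degrees shifted up by $m$, i.e. $W[m](d)=W(d-m)$, and $h_W(t)=\sum_d \dim W(d)\,t^d$. *)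

theory Defs
  imports
    Complex_Main
    "HOL-Algebra.QuotRing"
    "HOL-Computational_Algebra.Formal_Laurent_Series"
    "Graph_Theory.Arc_Walk"
    "Jordan_Normal_Form.VS_Connect"
begin

section \<open>Graded complex vector spaces and algebras\<close>

text \<open>
  Vector spaces and (associative, not necessarily commutative) algebras are modules over the ring
  \<open>CC\<close>; the fields \<^const>\<open>monoid.mult\<close> and \<^const>\<open>one\<close> are meaningful for algebras only. The additional
  field \<open>gr\<close> lists the homogeneous components, as subspaces of the whole space.
\<close>

abbreviation CC :: "complex ring" where
  "CC \<equiv> class_ring"

record ('k, 'v) graded_module = "('k, 'v) module" +
  gr :: "int \<Rightarrow> 'v set"

definition quotient_module ::
    "('k, 'v, 'm) graded_module_scheme \<Rightarrow> 'v set \<Rightarrow> ('k, 'v set) graded_module" where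
  "quotient_module M N = \<lparr>
     carrier = a_rcosets\<^bsub>M\<^esub> N,
     monoid.mult = rcoset_mult M N,
     one = N +>\<^bsub>M\<^esub> \<one>\<^bsub>M\<^esub>,
     zero = N,
     add = set_add M,
     smult = (\<lambda>c X. \<Union>x\<in>X. N +>\<^bsub>M\<^esub> (c \<odot>\<^bsub>M\<^esub> x)),
     gr = (\<lambda>d. (\<lambda>x. N +>\<^bsub>M\<^esub> x) ` gr M d)\<rparr>"

text \<open>\<open>gshift m W\<close> is \<open>W[m]\<close>, and \<open>grestrict D W\<close> is the direct sum of the \<open>W(d)\<close> with \<open>d \<in> D\<close>.\<close>

definition gshift :: "int \<Rightarrow> ('k, 'v) graded_module \<Rightarrow> ('k, 'v) graded_module" where
  "gshift m W = W\<lparr>gr := (\<lambda>d. gr W (d - m))\<rparr>"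

definition grestrict :: "int set \<Rightarrow> (complex, 'v) graded_module \<Rightarrow> (complex, 'v) graded_module" where
  "grestrict D W = W\<lparr>
     carrier := module.span CC W (\<Union>d\<in>D. gr W d),
     gr := (\<lambda>d. if d \<in> D then gr W d else {\<zero>\<^bsub>W\<^esub>})\<rparr>"

abbreviation gcomp :: "(complex, 'v) graded_module \<Rightarrow> int \<Rightarrow> (complex, 'v) graded_module" where
  "gcomp W d \<equiv> W\<lparr>carrier := gr W d\<rparr>"

text \<open>
  \<^const>\<open>vectorspace.dim\<close> and \<^const>\<open>Abs_fls\<close> are total, so \<open>hilbert_series W\<close> is meaningful only if
  \<open>has_hilbert_series W\<close> holds: all components are finite dimensional and they vanish in
  sufficiently negative degrees.
\<close>

definition has_hilbert_series :: "(complex, 'v) graded_module \<Rightarrow> bool" where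
  "has_hilbert_series W \<longleftrightarrow>
     (\<forall>d. vectorspace.fin_dim CC (gcomp W d)) \<and> (\<exists>m. \<forall>d<m. gr W d = {\<zero>\<^bsub>W\<^esub>})"

definition hilbert_series :: "(complex, 'v) graded_module \<Rightarrow> int fls" where
  "hilbert_series W = Abs_fls (\<lambda>d. int (vectorspace.dim CC (gcomp W d)))"

definition concentrated_in_degree :: "int \<Rightarrow> (complex, 'v) graded_module \<Rightarrow> bool" where
  "concentrated_in_degree m W \<longleftrightarrow>
     gr W m = carrier W \<and> (\<forall>d. d \<noteq> m \<longrightarrow> gr W d = {\<zero>\<^bsub>W\<^esub>})"


section \<open>Hochschild cohomology with coefficients in the algebra\<close>

text \<open>
  A \<open>k\<close>-cochain is a multilinear map over \<open>CC\<close>; its \<open>k\<close> arguments form a list.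
\<close>

definition arguments :: "(complex, 'a) graded_module \<Rightarrow> nat \<Rightarrow> 'a list set" where
  "arguments A k = {xs. length xs = k \<and> set xs \<subseteq> carrier A}"

definition multilinear_maps :: "(complex, 'a) graded_module \<Rightarrow> nat \<Rightarrow> ('a list \<Rightarrow> 'a) set" where
  "multilinear_maps A k = {f \<in> arguments A k \<rightarrow>\<^sub>E carrier A.
     \<forall>xs\<in>arguments A k. \<forall>i<k. (\<lambda>x. f (xs[i := x])) \<in> module_hom CC A A}"

definition homogeneous_maps ::
    "(complex, 'a) graded_module \<Rightarrow> nat \<Rightarrow> int \<Rightarrow> ('a list \<Rightarrow> 'a) set" where
  "homogeneous_maps A k d = {f \<in> multilinear_maps A k.
     \<forall>ds xs. list_all2 (\<lambda>x e. x \<in> gr A e) xs ds \<and> xs \<in> arguments A k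
       \<longrightarrow> f xs \<in> gr A (sum_list ds + d)}"

definition cochains ::
    "(complex, 'a) graded_module \<Rightarrow> nat \<Rightarrow> (complex, 'a list \<Rightarrow> 'a) graded_module" where
  "cochains A k = \<lparr>
     carrier = multilinear_maps A k,
     monoid.mult = undefined,
     one = undefined,
     zero = (\<lambda>xs\<in>arguments A k. \<zero>\<^bsub>A\<^esub>),
     add = (\<lambda>f g. \<lambda>xs\<in>arguments A k. f xs \<oplus>\<^bsub>A\<^esub> g xs),
     smult = (\<lambda>c f. \<lambda>xs\<in>arguments A k. c \<odot>\<^bsub>A\<^esub> f xs),
     gr = homogeneous_maps A k\<rparr>"

text \<open>
  The Hochschild differential sends \<open>f\<close> to the map
  \<open>x\<^sub>0, \<dots>, x\<^sub>k \<mapsto> x\<^sub>0 f(x\<^sub>1, \<dots>, x\<^sub>k) + (\<Sum>i<k. (-1)^(i+1) f(\<dots>, x\<^sub>i x\<^bsub>i+1\<^esub>, \<dots>)) + (-1)^(k+1) f(x\<^sub>0, \<dots>, x\<^bsub>k-1\<^esub>) x\<^sub>k\<close>.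
\<close>

definition hochschild_diff ::
    "(complex, 'a) graded_module \<Rightarrow> nat \<Rightarrow> ('a list \<Rightarrow> 'a) \<Rightarrow> 'a list \<Rightarrow> 'a" where
  "hochschild_diff A k f = (\<lambda>xs\<in>arguments A (Suc k).
     hd xs \<otimes>\<^bsub>A\<^esub> f (tl xs)
     \<oplus>\<^bsub>A\<^esub> (\<Oplus>\<^bsub>A\<^esub>i\<in>{..<k}.
           (- 1) ^ Suc i \<odot>\<^bsub>A\<^esub> f (take i xs @ [xs ! i \<otimes>\<^bsub>A\<^esub> xs ! Suc i] @ drop (i + 2) xs))
     \<oplus>\<^bsub>A\<^esub> (- 1) ^ Suc k \<odot>\<^bsub>A\<^esub> (f (butlast xs) \<otimes>\<^bsub>A\<^esub> last xs))"

definition cocycles :: "(complex, 'a) graded_module \<Rightarrow> nat \<Rightarrow> ('a list \<Rightarrow> 'a) set" where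
  "cocycles A k = {f \<in> carrier (cochains A k). hochschild_diff A k f = \<zero>\<^bsub>cochains A (Suc k)\<^esub>}"

fun coboundaries :: "(complex, 'a) graded_module \<Rightarrow> nat \<Rightarrow> ('a list \<Rightarrow> 'a) set" where
  "coboundaries A 0 = {\<zero>\<^bsub>cochains A 0\<^esub>}"
| "coboundaries A (Suc k) = hochschild_diff A k ` carrier (cochains A k)"

definition HH ::
    "nat \<Rightarrow> (complex, 'a) graded_module \<Rightarrow> (complex, ('a list \<Rightarrow> 'a) set) graded_module" where
  "HH k A = quotient_module
     ((cochains A k)\<lparr>carrier := cocycles A k, gr := (\<lambda>d. cocycles A k \<inter> homogeneous_maps A k d)\<rparr>)
     (coboundaries A k)"


section \<open>Path algebras\<close>

text \<open>
  A quiver is a \<^typ>\<open>('v, 'a) pre_digraph\<close>. A path from \<open>u\<close> to \<open>v\<close> is a triple \<open>(u, p, v)\<close> where the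
  list \<open>p\<close> contains the arrows in the order in which they are traversed. The product \<open>f g\<close> in the
  path algebra goes along \<open>g\<close> first: the product of \<open>(v, p, w)\<close> and \<open>(u, q, v)\<close> is \<open>(u, q @ p, w)\<close>.
\<close>

type_synonym ('v, 'a) path = "'v \<times> 'a list \<times> 'v"

definition paths :: "('v, 'a) pre_digraph \<Rightarrow> ('v, 'a) path set" where
  "paths Q = {(u, p, v). pre_digraph.awalk Q u p v}"

definition path_algebra ::
    "('v, 'a) pre_digraph \<Rightarrow> (complex, ('v, 'a) path \<Rightarrow> complex) graded_module" where
  "path_algebra Q = \<lparr>
     carrier = {f. finite {x. f x \<noteq> 0} \<and> {x. f x \<noteq> 0} \<subseteq> paths Q},
     monoid.mult = (\<lambda>f g (u, r, w).
       \<Sum>(p, v, q) \<in> {(p, v, q). (v, p, w) \<in> paths Q \<and> (u, q, v) \<in> paths Q \<and> r = q @ p}.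
         f (v, p, w) * g (u, q, v)),
     one = (\<lambda>(u, p, v). if u \<in> verts Q \<and> p = [] \<and> v = u then 1 else 0),
     zero = (\<lambda>x. 0),
     add = (\<lambda>f g x. f x + g x),
     smult = (\<lambda>c f x. c * f x),
     gr = (\<lambda>d. {f. finite {x. f x \<noteq> 0} \<and>
       {x. f x \<noteq> 0} \<subseteq> {(u, p, v) \<in> paths Q. int (length p) = d}})\<rparr>"

definition arrow :: "('v, 'a) pre_digraph \<Rightarrow> 'a \<Rightarrow> ('v, 'a) path \<Rightarrow> complex" where
  "arrow Q a = (\<lambda>x. if x = (tail Q a, [a], head Q a) then 1 else 0)"


section \<open>The preprojective algebra of type T\<close>

text \<open>\<open>Fwd i\<close>, \<open>Bwd i\<close> and \<open>Loop\<close> stand for the arrows \<open>a\<^sub>i\<close>, \<open>a\<^sub>i\<^sup>*\<close> and \<open>b\<close>.\<close>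

datatype T_arrow = Fwd nat | Bwd nat | Loop

definition T_quiver_double :: "nat \<Rightarrow> (nat, T_arrow) pre_digraph" where
  "T_quiver_double n = \<lparr>
     verts = {1..n},
     arcs = Fwd ` {1..<n} \<union> Bwd ` {1..<n} \<union> {Loop},
     tail = (\<lambda>e. case e of Fwd i \<Rightarrow> i | Bwd i \<Rightarrow> i + 1 | Loop \<Rightarrow> n),
     head = (\<lambda>e. case e of Fwd i \<Rightarrow> i + 1 | Bwd i \<Rightarrow> i | Loop \<Rightarrow> n)\<rparr>"

abbreviation commutator :: "('a, 'm) ring_scheme \<Rightarrow> 'a \<Rightarrow> 'a \<Rightarrow> 'a" where
  "commutator R x y \<equiv> x \<otimes>\<^bsub>R\<^esub> y \<ominus>\<^bsub>R\<^esub> y \<otimes>\<^bsub>R\<^esub> x"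

definition T_relation :: "nat \<Rightarrow> (nat, T_arrow) path \<Rightarrow> complex" where
  "T_relation n = (let Q = T_quiver_double n; R = path_algebra Q in
     (\<Oplus>\<^bsub>R\<^esub>i\<in>{1..<n}. commutator R (arrow Q (Fwd i)) (arrow Q (Bwd i)))
     \<ominus>\<^bsub>R\<^esub> arrow Q Loop \<otimes>\<^bsub>R\<^esub> arrow Q Loop)"

definition preprojective_T ::
    "nat \<Rightarrow> (complex, ((nat, T_arrow) path \<Rightarrow> complex) set) graded_module" where
  "preprojective_T n = (let R = path_algebra (T_quiver_double n) in
     quotient_module R (Idl\<^bsub>R\<^esub> {T_relation n}))"

end

theory Submission
  imports Defs "HOL-Library.Function_Algebras"
begin

text \<open>
  The relations say that, at a vertex \<open>v\<close>, the two ways to leave \<open>v\<close> and to come back at once agree; at the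
  vertex 1 there is only one such way and it is zero, and at \<open>n\<close> one of the two is the square of the
  loop. Going back and forth therefore commutes with all arrows. Every walk becomes a shortest walk,
  either direct or through the loop, followed by some steps back and forth; and it is zero if there are
  too many of them, because \<open>k\<close> steps back and forth at the vertex \<open>k\<close> can be moved to the vertex 1
  (\<open>walk_classification\<close>). So a walk matters only through its source, its target and its length. A
  product with structure constants 0 and 1 on the admissible triples satisfies the relations, hence the
  algebra is this model (\<open>J_eq_kernel\<close>, \<open>preprojective_coordinates\<close>), and everything else is a computation
  with triples.

  Degree 0. A homogeneous central element has no coefficient off the diagonal, and commuting with the
  arrows \<open>a\<^sub>i\<close> makes the coefficients at neighbouring vertices agree. In even degree all of them can be
  equal to 1, as far as the closed walk is admissible. In odd degree below \<open>2 n - 1 = h - 2\<close> the one at the vertex 1 does not exist, so all of them vanish.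
  What remains is one dimension in each of the degrees \<open>0, 2, \<dots>, 2 n - 2\<close>.

  Degree 2. A 2-cocycle \<open>c\<close> is a deformation of first order. In the deformed algebra the relator
  \<open>\<Sum>i. [a\<^sub>i, a\<^sub>i\<^sup>*] - b\<^sup>2\<close> has some value, and the obstruction of \<open>c\<close> at the vertex \<open>j\<close> is the coefficient of
  the idempotent \<open>e\<^sub>j\<close> in it. The relator of a coboundary lies in positive degree, so the \<open>n\<close>
  obstructions are functions on cohomology. They can be prescribed by cocycles of degree \<open>-2\<close>
  (\<open>deformation_cocycle\<close>, \<open>obstruction_deformation\<close>), and they are a complete invariant: if they all vanish, a
  primitive of \<open>c\<close> is obtained by choosing its values on arrows and extending along walks, where the choice
  amounts to a linear equation at each vertex that can be solved from the vertex 1 to the vertex \<open>n\<close>,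
  the loop absorbing the last one (\<open>coboundary_criterion\<close>). Hence the second cohomology is \<open>n\<close>-dimensional
  and lives in degree \<open>-2\<close>.
\<close>

section \<open>Products with structure constants and the model\<close>

definition scl :: "complex \<Rightarrow> ('i \<Rightarrow> complex) \<Rightarrow> 'i \<Rightarrow> complex" where
  "scl k x = (\<lambda>r. k * x r)"

lemma scl_apply [simp]: "scl k x r = k * x r"
  by (simp add: scl_def)

definition structure_product ::
    "'i set \<Rightarrow> ('i \<Rightarrow> 'i \<Rightarrow> 'i \<Rightarrow> complex) \<Rightarrow> ('i \<Rightarrow> complex) \<Rightarrow> ('i \<Rightarrow> complex) \<Rightarrow> 'i \<Rightarrow> complex" where
  "structure_product S k x y = (\<lambda>r. \<Sum>a\<in>S. \<Sum>b\<in>S. x a * y b * k a b r)"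

lemma structure_product_nested_right:
  "structure_product S k x (structure_product S l y z) r =
     (\<Sum>a\<in>S. \<Sum>b\<in>S. \<Sum>c\<in>S. x a * y b * z c * (\<Sum>s\<in>S. l b c s * k a s r))"
proof -
  have "structure_product S k x (structure_product S l y z) r =
     (\<Sum>a\<in>S. \<Sum>s\<in>S. \<Sum>b\<in>S. \<Sum>c\<in>S. x a * y b * z c * (l b c s * k a s r))"
    by (simp add: structure_product_def sum_distrib_left sum_distrib_right mult_ac)
  also have "\<dots> = (\<Sum>a\<in>S. \<Sum>b\<in>S. \<Sum>s\<in>S. \<Sum>c\<in>S. x a * y b * z c * (l b c s * k a s r))"
    by (rule sum.cong[OF refl], rule sum.swap)
  also have "\<dots> = (\<Sum>a\<in>S. \<Sum>b\<in>S. \<Sum>c\<in>S. \<Sum>s\<in>S. x a * y b * z c * (l b c s * k a s r))"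
    by (rule sum.cong[OF refl], rule sum.cong[OF refl], rule sum.swap)
  finally show ?thesis by (simp add: sum_distrib_left)
qed

lemma structure_product_nested_left:
  "structure_product S k (structure_product S l x y) z r =
     (\<Sum>a\<in>S. \<Sum>b\<in>S. \<Sum>c\<in>S. x a * y b * z c * (\<Sum>s\<in>S. l a b s * k s c r))"
proof -
  have "structure_product S k (structure_product S l x y) z r =
     (\<Sum>s\<in>S. \<Sum>c\<in>S. \<Sum>a\<in>S. \<Sum>b\<in>S. x a * y b * z c * (l a b s * k s c r))"
    by (simp add: structure_product_def sum_distrib_left sum_distrib_right mult_ac)
  also have "\<dots> = (\<Sum>s\<in>S. \<Sum>a\<in>S. \<Sum>c\<in>S. \<Sum>b\<in>S. x a * y b * z c * (l a b s * k s c r))"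
    by (rule sum.cong[OF refl], rule sum.swap)
  also have "\<dots> = (\<Sum>a\<in>S. \<Sum>s\<in>S. \<Sum>c\<in>S. \<Sum>b\<in>S. x a * y b * z c * (l a b s * k s c r))"
    by (rule sum.swap)
  also have "\<dots> = (\<Sum>a\<in>S. \<Sum>s\<in>S. \<Sum>b\<in>S. \<Sum>c\<in>S. x a * y b * z c * (l a b s * k s c r))"
    by (rule sum.cong[OF refl], rule sum.cong[OF refl], rule sum.swap)
  also have "\<dots> = (\<Sum>a\<in>S. \<Sum>b\<in>S. \<Sum>s\<in>S. \<Sum>c\<in>S. x a * y b * z c * (l a b s * k s c r))"
    by (rule sum.cong[OF refl], rule sum.swap)
  also have "\<dots> = (\<Sum>a\<in>S. \<Sum>b\<in>S. \<Sum>c\<in>S. \<Sum>s\<in>S. x a * y b * z c * (l a b s * k s c r))"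
    by (rule sum.cong[OF refl], rule sum.cong[OF refl], rule sum.swap)
  finally show ?thesis by (simp add: sum_distrib_left)
qed

lemma sum_fun_apply: "sum f S r = (\<Sum>i\<in>S. f i r)" for f :: "'x \<Rightarrow> 'y \<Rightarrow> complex"
  by (induction S rule: infinite_finite_induct) auto

text \<open>
  Source, target and length of a walk.
\<close>
type_synonym walk_type = "nat \<times> nat \<times> nat"

definition join_type :: "walk_type \<Rightarrow> walk_type \<Rightarrow> walk_type" where
  "join_type a b = (fst b, fst (snd a), snd (snd b) + snd (snd a))"

lemma join_type_simps [simp]: "join_type (v, w, d) (u, v', e) = (u, w, e + d)"
  by (simp add: join_type_def)

locale type_T =
  fixes n :: nat
  assumes n_pos: "1 \<le> n"
begin

text \<open>
  The triples that belong to some walk. A step along \<open>a\<^sub>i\<close> or \<open>a\<^sub>i\<^sup>*\<close> changes the parity of the vertex and a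
  step along the loop does not, so \<open>d + u + v\<close> is odd if and only if the loop is used an odd number of
  times, and then the walk has to visit \<open>n\<close>.
\<close>
definition low :: "walk_type \<Rightarrow> bool" where
  "low = (\<lambda>(u, v, d). u \<in> {1..n} \<and> v \<in> {1..n} \<and>
     (if even (d + u + v) then u \<le> v + d \<and> v \<le> u + d else 2 * n + 1 \<le> d + u + v))"

text \<open>
  The walks that are not yet too long to be nonzero: going back and forth \<open>k\<close> times kills the vertices
  up to \<open>k\<close>, so the number of steps back and forth has to stay below both \<open>u\<close> and \<open>v\<close>.
\<close>
definition high :: "walk_type \<Rightarrow> bool" where
  "high = (\<lambda>(u, v, d). if even (d + u + v) then d + 2 \<le> u + v
     else d + u + 1 \<le> 2 * n + v \<and> d + v + 1 \<le> 2 * n + u)"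

definition I :: "walk_type set" where
  "I = {t. low t \<and> high t}"

lemma finite_I: "finite I"
proof -
  have "I \<subseteq> {1..n} \<times> {1..n} \<times> {0..3 * n}"
    by (auto simp: I_def low_def high_def split: if_splits)
  thus ?thesis by (rule finite_subset) auto
qed

lemma parity_join: "even ((d + e) + u + w) \<longleftrightarrow> (even (d + u + v) \<longleftrightarrow> even (e + v + w))" for u v w d e :: nat
  by (auto simp: even_add)

lemma low_join:
  assumes "low (u, v, d)" "low (v, w, e)"
  shows "low (u, w, d + e)"
  using assms parity_join[of d e u w v] by (auto simp: low_def split: if_splits)

text \<open>
  A zero factor makes a product zero, in terms of lengths. This is what makes the multiplication below
  associative.
\<close>
lemma high_factors:
  assumes "low (u, v, d)" "low (v, w, e)" "high (u, w, d + e)"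
  shows "high (u, v, d)" "high (v, w, e)"
  using assms parity_join[of d e u w v] by (auto simp: low_def high_def split: if_splits)

lemma I_factors:
  assumes "low (u, v, d)" "low (v, w, e)" "(u, w, d + e) \<in> I"
  shows "(u, v, d) \<in> I" "(v, w, e) \<in> I"
  using assms high_factors[of u v d w e] by (auto simp: I_def)

definition mult_const :: "walk_type \<Rightarrow> walk_type \<Rightarrow> walk_type \<Rightarrow> complex" where
  "mult_const a b r = of_bool (fst a = fst (snd b) \<and> r = join_type a b \<and> r \<in> I)"

definition star :: "(walk_type \<Rightarrow> complex) \<Rightarrow> (walk_type \<Rightarrow> complex) \<Rightarrow> walk_type \<Rightarrow> complex"
    (infixl "\<star>" 70) where
  "star = structure_product I mult_const"

definition ev :: "walk_type \<Rightarrow> walk_type \<Rightarrow> complex" where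
  "ev a = (\<lambda>r. of_bool (r = a \<and> a \<in> I))"

definition M :: "(walk_type \<Rightarrow> complex) set" where
  "M = {x. \<forall>r. r \<notin> I \<longrightarrow> x r = 0}"

text \<open>
  The model consists of the functions supported on \<open>I\<close>; truncation makes statements available for all
  functions.
\<close>
definition restr :: "(walk_type \<Rightarrow> complex) \<Rightarrow> walk_type \<Rightarrow> complex" where
  "restr x = (\<lambda>r. of_bool (r \<in> I) * x r)"

lemma restr_in_M [simp]: "restr x \<in> M" by (simp add: restr_def M_def)
lemma restr_id: "x \<in> M \<Longrightarrow> restr x = x" by (rule ext) (auto simp: restr_def M_def)
lemma ev_in_M [simp]: "ev a \<in> M" by (auto simp: ev_def M_def)
lemma ev_eq_0: "a \<notin> I \<Longrightarrow> ev a = 0" by (rule ext) (auto simp: ev_def)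
lemma star_in_M [simp]: "x \<star> y \<in> M"
  by (auto simp: star_def structure_product_def mult_const_def M_def intro!: sum.neutral)

lemma M_zero [simp]: "0 \<in> M" by (simp add: M_def)
lemma M_add [simp]: "x \<in> M \<Longrightarrow> y \<in> M \<Longrightarrow> x + y \<in> M" by (simp add: M_def)
lemma M_diff [simp]: "x \<in> M \<Longrightarrow> y \<in> M \<Longrightarrow> x - y \<in> M" by (simp add: M_def)
lemma M_scl [simp]: "x \<in> M \<Longrightarrow> scl k x \<in> M" by (simp add: M_def)
lemma M_sum [simp]: "(\<And>i. i \<in> S \<Longrightarrow> f i \<in> M) \<Longrightarrow> sum f S \<in> M"
  by (induction S rule: infinite_finite_induct) auto

lemma star_add_left: "(x + y) \<star> z = x \<star> z + y \<star> z"
  by (rule ext) (simp add: star_def structure_product_def algebra_simps sum.distrib)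
lemma star_add_right: "z \<star> (x + y) = z \<star> x + z \<star> y"
  by (rule ext) (simp add: star_def structure_product_def algebra_simps sum.distrib)
lemma star_diff_left: "(x - y) \<star> z = x \<star> z - y \<star> z"
  by (rule ext) (simp add: star_def structure_product_def algebra_simps sum_subtractf)
lemma star_diff_right: "z \<star> (x - y) = z \<star> x - z \<star> y"
  by (rule ext) (simp add: star_def structure_product_def algebra_simps sum_subtractf)
lemma star_zero [simp]: "0 \<star> z = 0" "z \<star> 0 = 0"
  by (rule ext, simp add: star_def structure_product_def)+
lemma star_scl: "scl k x \<star> z = scl k (x \<star> z)" "z \<star> scl k x = scl k (z \<star> x)"
  by (rule ext, simp add: star_def structure_product_def sum_distrib_left mult_ac)+
lemma star_sum_left:
  fixes f :: "'x \<Rightarrow> walk_type \<Rightarrow> complex"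
  shows "sum f S \<star> z = (\<Sum>i\<in>S. f i \<star> z)"
  using sum_comp_morphism[of "\<lambda>x. x \<star> z" f S] by (simp add: star_add_left o_def)
lemma star_sum_right:
  fixes f :: "'x \<Rightarrow> walk_type \<Rightarrow> complex"
  shows "z \<star> sum f S = (\<Sum>i\<in>S. z \<star> f i)"
  using sum_comp_morphism[of "\<lambda>x. z \<star> x" f S] by (simp add: star_add_right o_def)

lemmas star_simps = star_add_left star_add_right star_diff_left star_diff_right

lemma star_restr [simp]: "restr x \<star> y = x \<star> y" "x \<star> restr y = x \<star> y"
  by (rule ext, simp add: star_def structure_product_def restr_def)+

lemma I_low: "a \<in> I \<Longrightarrow> low a" by (simp add: I_def)

lemma sum_mult_const_left:
  assumes "a \<in> I" "b \<in> I"
  shows "(\<Sum>s\<in>I. mult_const a b s * f s) =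
     of_bool (fst a = fst (snd b) \<and> join_type a b \<in> I) * f (join_type a b)"
proof -
  have "(\<Sum>s\<in>I. mult_const a b s * f s) =
      (\<Sum>s\<in>I. if s = join_type a b then of_bool (fst a = fst (snd b)) * f s else 0)"
    by (rule sum.cong) (auto simp: mult_const_def)
  thus ?thesis by (simp add: sum.delta finite_I)
qed

text \<open>
  Both bracketings give the concatenated type if it is admissible and zero otherwise; by \<open>I_factors\<close>
  an admissible composite has admissible partial composites, so no bracketing loses a term.
\<close>
lemma star_assoc: "x \<star> y \<star> z = x \<star> (y \<star> z)"
proof (rule ext)
  fix r
  have "(\<Sum>s\<in>I. mult_const a b s * mult_const s c r) = (\<Sum>s\<in>I. mult_const b c s * mult_const a s r)"
    if abc: "a \<in> I" "b \<in> I" "c \<in> I" for a b c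
  proof -
    obtain u v d where a: "a = (u, v, d)" by (cases a)
    obtain u' v' d' where b: "b = (u', v', d')" by (cases b)
    obtain u'' v'' d'' where c: "c = (u'', v'', d'')" by (cases c)
    have l: "low a" "low b" "low c" using abc by (simp_all add: I_def)
    show ?thesis using l abc I_factors[of u' u d' v d] I_factors[of u'' v'' d'' v' d']
       I_factors[of u'' v'' d'' v "d'+d"] I_factors[of u'' v' "d''+d'" v d] low_join[of u' u d' v d] low_join[of u'' v'' d'' v' d']
      by (subst (1 2) sum_mult_const_left)
        (auto simp: mult_const_def a b c ac_simps)
  qed
  thus "(x \<star> y \<star> z) r = (x \<star> (y \<star> z)) r"
    unfolding star_def structure_product_nested_left structure_product_nested_right
    by (auto intro!: sum.cong)
qed

lemma ev_star_apply:
  assumes "a \<in> I"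
  shows "(ev a \<star> y) r = (\<Sum>b\<in>I. y b * mult_const a b r)"
proof -
  have "(ev a \<star> y) r = (\<Sum>a'\<in>I. if a' = a then (\<Sum>b\<in>I. y b * mult_const a b r) else 0)"
    unfolding star_def structure_product_def using assms
    by (intro sum.cong) (auto simp: ev_def)
  thus ?thesis using assms by (simp add: finite_I)
qed

lemma star_ev_apply:
  assumes "b \<in> I"
  shows "(x \<star> ev b) r = (\<Sum>a\<in>I. x a * mult_const a b r)"
proof -
  have "(x \<star> ev b) r = (\<Sum>b'\<in>I. \<Sum>a\<in>I. x a * ev b b' * mult_const a b' r)"
    unfolding star_def structure_product_def by (rule sum.swap)
  also have "\<dots> = (\<Sum>b'\<in>I. if b' = b then (\<Sum>a\<in>I. x a * mult_const a b r) else 0)"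
    using assms by (intro sum.cong) (auto simp: ev_def)
  finally show ?thesis using assms by (simp add: finite_I)
qed

lemma ev_star:
  assumes "(v, w, e) \<in> I" "y \<in> M"
  shows "(ev (v, w, e) \<star> y) (u, w', d) =
     of_bool (w' = w \<and> e \<le> d \<and> (u, w', d) \<in> I) * y (u, v, d - e)"
proof -
  have "(ev (v, w, e) \<star> y) (u, w', d) = (\<Sum>b\<in>I. if b = (u, v, d - e) then
      of_bool (w' = w \<and> e \<le> d \<and> (u, w', d) \<in> I) * y (u, v, d - e) else 0)"
    unfolding ev_star_apply[OF assms(1)]
    by (intro sum.cong) (auto simp: mult_const_def)
  also have "\<dots> = of_bool (w' = w \<and> e \<le> d \<and> (u, w', d) \<in> I) * y (u, v, d - e)"
    using assms(2) by (auto simp: finite_I M_def)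
  finally show ?thesis .
qed

lemma star_ev:
  assumes "(u, v, e) \<in> I" "y \<in> M"
  shows "(y \<star> ev (u, v, e)) (u', w, d) =
     of_bool (u' = u \<and> e \<le> d \<and> (u', w, d) \<in> I) * y (v, w, d - e)"
proof -
  have "(y \<star> ev (u, v, e)) (u', w, d) = (\<Sum>b\<in>I. if b = (v, w, d - e) then
      of_bool (u' = u \<and> e \<le> d \<and> (u', w, d) \<in> I) * y (v, w, d - e) else 0)"
    unfolding star_ev_apply[OF assms(1)]
    by (intro sum.cong) (auto simp: mult_const_def)
  also have "\<dots> = of_bool (u' = u \<and> e \<le> d \<and> (u', w, d) \<in> I) * y (v, w, d - e)"
    using assms(2) by (auto simp: finite_I M_def)
  finally show ?thesis .
qed

lemma ev_star_ev_distinct: "v \<noteq> v' \<Longrightarrow> ev (v, w, e) \<star> ev (u, v', d) = 0"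
  by (rule ext) (auto simp: star_def structure_product_def ev_def mult_const_def intro!: sum.neutral)

lemma ev_star_ev:
  assumes "low (v, w, e)" "low (u, v, d)"
  shows "ev (v, w, e) \<star> ev (u, v, d) = ev (u, w, d + e)"
proof (cases "(v, w, e) \<in> I")
  case True
  show ?thesis
  proof (rule ext)
    fix r :: walk_type
    obtain u' w' d' where r: "r = (u', w', d')" by (cases r)
    show "(ev (v, w, e) \<star> ev (u, v, d)) r = ev (u, w, d + e) r"
      using I_factors[OF assms(2,1)] by (auto simp: r ev_star[OF True ev_in_M]) (auto simp: ev_def)
  qed
next
  case False
  thus ?thesis using I_factors[OF assms(2,1)] by (cases "(u, w, d + e) \<in> I") (auto simp: ev_eq_0)
qed

definition idem :: "nat \<Rightarrow> walk_type \<Rightarrow> complex" where "idem j = ev (j, j, 0)"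

lemma idem_I: "j \<in> {1..n} \<Longrightarrow> (j, j, 0) \<in> I"
  by (auto simp: I_def low_def high_def)

lemma idem_star: "j \<in> {1..n} \<Longrightarrow> y \<in> M \<Longrightarrow> (idem j \<star> y) (u, w, d) = of_bool (w = j) * y (u, w, d)"
  unfolding idem_def by (auto simp: ev_star idem_I M_def)

lemma star_idem: "j \<in> {1..n} \<Longrightarrow> y \<in> M \<Longrightarrow> (y \<star> idem j) (u, w, d) = of_bool (u = j) * y (u, w, d)"
  unfolding idem_def by (auto simp: star_ev idem_I M_def)

lemma I_vertices: "(u, v, d) \<in> I \<Longrightarrow> u \<in> {1..n} \<and> v \<in> {1..n}"
  by (auto simp: I_def low_def)

lemma sum_idem_star: "(\<Sum>j\<in>{1..n}. idem j \<star> y) = restr y"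
proof (rule ext)
  fix r :: walk_type
  obtain u w d where r: "r = (u, w, d)" by (cases r)
  have "(\<Sum>j\<in>{1..n}. idem j \<star> y) r = (\<Sum>j\<in>{1..n}. idem j \<star> restr y) r"
    by simp
  also have "\<dots> = (\<Sum>j\<in>{1..n}. if j = w then restr y r else 0)"
    unfolding sum_fun_apply by (intro sum.cong) (auto simp: idem_star r simp del: star_restr)
  finally show "(\<Sum>j\<in>{1..n}. idem j \<star> y) r = restr y r"
    using I_vertices[of u w d] by (auto simp: r restr_def sum.delta)
qed

lemma sum_star_idem: "(\<Sum>j\<in>{1..n}. y \<star> idem j) = restr y"
proof (rule ext)
  fix r :: walk_type
  obtain u w d where r: "r = (u, w, d)" by (cases r)
  have "(\<Sum>j\<in>{1..n}. y \<star> idem j) r = (\<Sum>j\<in>{1..n}. restr y \<star> idem j) r"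
    by simp
  also have "\<dots> = (\<Sum>j\<in>{1..n}. if j = u then restr y r else 0)"
    unfolding sum_fun_apply by (intro sum.cong) (auto simp: star_idem r simp del: star_restr)
  finally show "(\<Sum>j\<in>{1..n}. y \<star> idem j) r = restr y r"
    using I_vertices[of u w d] by (auto simp: r restr_def sum.delta)
qed

lemma idem_star_idem: "i \<in> {1..n} \<Longrightarrow> j \<in> {1..n} \<Longrightarrow> idem i \<star> idem j = (if i = j then idem j else 0)"
  unfolding idem_def using I_low[OF idem_I[of j]] 
  by (auto simp: ev_star_ev_distinct ev_star_ev)

end

section \<open>Linear maps and Hochschild cochains of the model\<close>

lemmas pointwise = plus_fun_apply minus_apply uminus_apply zero_fun_apply

definition linear_map :: "(('i \<Rightarrow> complex) \<Rightarrow> 'j \<Rightarrow> complex) \<Rightarrow> bool" where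
  "linear_map f \<longleftrightarrow> (\<forall>x y. f (x + y) = f x + f y) \<and> (\<forall>k x. f (scl k x) = scl k (f x))"

lemma scl_0_left [simp]: "scl 0 x = 0" by (rule ext) simp
lemma scl_0_right [simp]: "scl k 0 = 0" by (rule ext) simp
lemma scl_1 [simp]: "scl 1 x = x" by (rule ext) simp
lemma scl_add: "scl k (x + y) = scl k x + scl k y" by (rule ext) (simp add: algebra_simps)
lemma scl_diff: "scl k (x - y) = scl k x - scl k y" by (rule ext) (simp add: algebra_simps)
lemma scl_minus1: "scl (-1) x = - x" by (rule ext) simp
lemma scl_scl: "scl k (scl l x) = scl (k * l) x" by (rule ext) simp

declare pointwise [simp del]

lemma scl_sum: "scl k (sum f S) = (\<Sum>i\<in>S. scl k (f i))" for f :: "'x \<Rightarrow> 'i \<Rightarrow> complex"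
  using sum_comp_morphism[of "scl k" f S] by (simp add: scl_add o_def)

lemma linear_map_add: "linear_map f \<Longrightarrow> f (x + y) = f x + f y" by (simp add: linear_map_def)
lemma linear_map_scl: "linear_map f \<Longrightarrow> f (scl k x) = scl k (f x)" by (simp add: linear_map_def)
lemma linear_map_zero: "linear_map f \<Longrightarrow> f 0 = 0"
  using linear_map_scl[of f 0 0] by simp
lemma linear_map_diff: "linear_map f \<Longrightarrow> f (x - y) = f x - f y"
  using linear_map_add[of f "x - y" y] by simp
lemma linear_map_sum: "linear_map f \<Longrightarrow> f (sum g S) = (\<Sum>i\<in>S. f (g i))" for g :: "'x \<Rightarrow> 'i \<Rightarrow> complex"
  using sum_comp_morphism[of f g S] by (simp add: linear_map_add linear_map_zero o_def)

definition bilinear_map :: "(('i \<Rightarrow> complex) \<Rightarrow> ('j \<Rightarrow> complex) \<Rightarrow> 'k \<Rightarrow> complex) \<Rightarrow> bool" where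
  "bilinear_map c \<longleftrightarrow> (\<forall>x. linear_map (c x)) \<and> (\<forall>y. linear_map (\<lambda>x. c x y))"

lemma bilinear_map_right: "bilinear_map c \<Longrightarrow> linear_map (c x)" by (simp add: bilinear_map_def)
lemma bilinear_map_left: "bilinear_map c \<Longrightarrow> linear_map (\<lambda>x. c x y)" by (simp add: bilinear_map_def)

lemma structure_product_bilinear: "bilinear_map (structure_product S k)"
  unfolding bilinear_map_def linear_map_def
  by (auto simp: fun_eq_iff pointwise structure_product_def algebra_simps sum.distrib sum_distrib_left)

lemma structure_product_ev:
  assumes "finite S" "a \<in> S" "b \<in> S"
  shows "structure_product S k (\<lambda>r. of_bool (r = a)) (\<lambda>r. of_bool (r = b)) r = k a b r"
proof -
  have "structure_product S k (\<lambda>r. of_bool (r = a)) (\<lambda>r. of_bool (r = b)) r =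
     (\<Sum>a'\<in>S. if a' = a then (\<Sum>b'\<in>S. if b' = b then k a b r else 0) else 0)"
    unfolding structure_product_def by (intro sum.cong refl) (auto intro!: sum.cong sum.neutral)
  thus ?thesis using assms by simp
qed

context type_T
begin

definition hochschild2 where
  "hochschild2 c x y z = x \<star> c y z - c (x \<star> y) z + c x (y \<star> z) - c x y \<star> z"

definition coboundary where
  "coboundary f x y = x \<star> f y - f (x \<star> y) + f x \<star> y"

definition up where "up i = ev (i, i + 1, 1)"
definition down where "down i = ev (i + 1, i, 1)"
definition lp where "lp = ev (n, n, 1)"

lemma arrow_I:
  "i \<in> {1..<n} \<Longrightarrow> (i, i + 1, 1) \<in> I" "i \<in> {1..<n} \<Longrightarrow> (i + 1, i, 1) \<in> I" "(n, n, 1) \<in> I"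
  using n_pos by (auto simp: I_def low_def high_def)

lemma up_star_down: "i \<in> {1..<n} \<Longrightarrow> up i \<star> down i = ev (i + 1, i + 1, 2)"
  and down_star_up: "i \<in> {1..<n} \<Longrightarrow> down i \<star> up i = ev (i, i, 2)"
  and lp_star_lp: "lp \<star> lp = ev (n, n, 2)"
  using arrow_I by (auto simp: up_def down_def lp_def ev_star_ev I_low numeral_2_eq_2)

text \<open>
  The products around a vertex depend on the vertex only, so the sum telescopes. What is left is the
  two-step walk at the vertex 1, which is too long.
\<close>
lemma relation_in_model:
  "(\<Sum>i\<in>{1..<n}. up i \<star> down i - down i \<star> up i) - lp \<star> lp = 0"
proof -
  have "(\<Sum>i\<in>{1..<n}. up i \<star> down i - down i \<star> up i) =
      (\<Sum>i\<in>{1..<n}. ev (Suc i, Suc i, 2) - ev (i, i, 2))"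
    by (intro sum.cong) (auto simp: up_star_down down_star_up)
  also have "\<dots> = ev (n, n, 2) - ev (1, 1, 2)"
    using n_pos by (rule sum_Suc_diff')
  also have "ev (1, 1, 2) = 0"
    by (rule ev_eq_0) (auto simp: I_def high_def)
  finally show ?thesis by (simp add: lp_star_lp)
qed

text \<open>
  The relation, with the product replaced by a bilinear map. If \<open>c\<close> is a cocycle, this is the
  first-order value of the relation in the corresponding deformation.
\<close>
definition relator where
  "relator c = (\<Sum>i\<in>{1..<n}. c (up i) (down i) - c (down i) (up i)) - c lp lp"

definition obstruction where
  "obstruction c j = (relator c :: walk_type \<Rightarrow> complex) (j, j, 0)"

lemma degree_one_star:
  assumes "(v, w, 1) \<in> I"
  shows "(ev (v, w, 1) \<star> y) (j, j', 0) = 0" "(y \<star> ev (v, w, 1)) (j, j', 0) = 0"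
  using assms ev_star[of v w 1 "restr y" j j' 0] star_ev[of v w 1 "restr y" j j' 0] by auto

text \<open>
  The relator of a coboundary is \<open>x f(y) + f(x) y\<close> summed over the products of arrows in the relation,
  minus the value of \<open>f\<close> at the relation. The latter is zero and the former has positive degree, so no
  idempotent occurs.
\<close>
lemma obstruction_coboundary:
  assumes f: "linear_map f"
  shows "obstruction (coboundary f) j = 0"
proof -
  have "relator (coboundary f) =
     ((\<Sum>i\<in>{1..<n}. (up i \<star> f (down i) + f (up i) \<star> down i) - (down i \<star> f (up i) + f (down i) \<star> up i))
       - (lp \<star> f lp + f lp \<star> lp))
     - ((\<Sum>i\<in>{1..<n}. f (up i \<star> down i) - f (down i \<star> up i)) - f (lp \<star> lp))"
    unfolding relator_def coboundary_def sum_subtractf[symmetric]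
    by (simp add: algebra_simps sum_subtractf sum.distrib)
  also have "(\<Sum>i\<in>{1..<n}. f (up i \<star> down i) - f (down i \<star> up i)) - f (lp \<star> lp) =
     f ((\<Sum>i\<in>{1..<n}. up i \<star> down i - down i \<star> up i) - lp \<star> lp)"
    by (simp add: linear_map_diff[OF f] linear_map_sum[OF f])
  also have "\<dots> = 0" by (simp only: relation_in_model linear_map_zero[OF f])
  finally have "relator (coboundary f) = 
     (\<Sum>i\<in>{1..<n}. (up i \<star> f (down i) + f (up i) \<star> down i) - (down i \<star> f (up i) + f (down i) \<star> up i))
       - (lp \<star> f lp + f lp \<star> lp)" by simp
  thus ?thesis
    using arrow_I
    by (auto simp: obstruction_def up_def down_def lp_def degree_one_star sum_fun_apply pointwise simp del: One_nat_def intro!: sum.neutral)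
qed

lemma obstruction_diff: "obstruction (\<lambda>x y. c x y - c' x y) j = obstruction c j - obstruction c' j"
  by (simp add: obstruction_def relator_def sum_fun_apply pointwise algebra_simps sum.distrib sum_subtractf)

section \<open>Deformations with prescribed obstruction\<close>

text \<open>
  A deformation at the vertex \<open>j\<close> adds a multiple of \<open>e\<^sub>j\<close> to the relation. Shorten a walk by two
  and multiply by a weight: the product is then corrected by the coboundary of this operation, which
  is \<open>deform_defect\<close> times the shortened composite. The cocycle identity is formal, but shortening is
  not an operation on the model, because the shortened type may be admissible when the original is not,
  and conversely. The weight is therefore defined outside \<open>I\<close> as well, and it is chosen such
  that the defect vanishes whenever a type that the identity needs is missing. The factors alone need not
  have a shortened type, which is why the cocycle is not a coboundary.
\<close>
definition deform_weight :: "nat \<Rightarrow> walk_type \<Rightarrow> int" where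
  "deform_weight j = (\<lambda>(u, v, d). let C = (\<lambda>m. int (min m j)) in
     if even (d + u + v)
     then (if high (u, v, d) then \<bar>C u - C v\<bar> else C u + C v)
     else (if high (u, v, d) then 2 * C n - C u - C v else 2 * C n - \<bar>C u - C v\<bar>))"

definition deform_defect :: "nat \<Rightarrow> walk_type \<Rightarrow> walk_type \<Rightarrow> int" where
  "deform_defect j a b = deform_weight j a + deform_weight j b - deform_weight j (join_type a b)"

definition deform_const :: "nat \<Rightarrow> walk_type \<Rightarrow> walk_type \<Rightarrow> walk_type \<Rightarrow> complex" where
  "deform_const j a b r = of_bool (fst a = fst (snd b) \<and> r \<in> I \<and> 
      join_type a b = (fst r, fst (snd r), snd (snd r) + 2)) * of_int (deform_defect j a b)"

definition deformation where
  "deformation j = structure_product I (deform_const j)"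

lemma low_reverse: "low (v, u, d) \<longleftrightarrow> low (u, v, d)"
  by (auto simp: low_def ac_simps)

lemma high_reverse: "high (v, u, d) \<longleftrightarrow> high (u, v, d)"
  by (auto simp: high_def ac_simps)

lemma deform_defect_reverse: "deform_defect j (v, u, d) (w, v, e) = deform_defect j (v, w, e) (u, v, d)"
proof -
  have "deform_weight j (v, u, d) = deform_weight j (u, v, d)" for u v d
  proof -
    have "even (d + v + u) \<longleftrightarrow> even (d + u + v)" by (simp only: ac_simps)
    thus ?thesis
      by (simp only: deform_weight_def split_conv Let_def high_reverse[of v u d]
          abs_minus_commute[of "int (min v j)" "int (min u j)"] add.commute[of "int (min v j)" "int (min u j)"]
          cancel_ab_semigroup_add_class.diff_right_commute[of _ "int (min v j)" "int (min u j)"])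
  qed
  thus ?thesis by (metis add.commute deform_defect_def join_type_simps)
qed

text \<open>
  What the comparisons of weights need of \<open>min m j\<close> is that it is monotone in \<open>m\<close>.
\<close>
lemma deform_weight_mono:
  "\<exists>C :: nat \<Rightarrow> int. mono C \<and> (\<forall>u v d. deform_weight j (u, v, d) = (if even (d + u + v)
     then (if high (u, v, d) then \<bar>C u - C v\<bar> else C u + C v)
     else (if high (u, v, d) then 2 * C n - C u - C v else 2 * C n - \<bar>C u - C v\<bar>)))"
  by (rule exI[of _ "\<lambda>m. int (min m j)"]) (auto simp: deform_weight_def mono_def Let_def)

text \<open>
  A composite of two walks without loop that cannot be shortened is a monotone walk from \<open>u\<close> to \<open>w\<close>
  through \<open>v\<close>: by parity each defect in a triangle inequality is even, and two units are one too many.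
\<close>
lemma composite_of_minimal_lengths:
  fixes u v w d e :: nat
  assumes "u \<le> v + d" "v \<le> u + d" "v \<le> w + e" "w \<le> v + e"
    and short: "d + e < 2 \<or> w + (d + e) < u + 2 \<or> u + (d + e) < w + 2"
    and even: "even (d + u + v)" "even (e + v + w)"
  shows "d + u = v \<and> e + v = w \<or> d + v = u \<and> e + w = v"
proof -
  obtain k where "d + u + v = 2 * k" using even(1) by (rule evenE)
  moreover obtain l where "e + v + w = 2 * l" using even(2) by (rule evenE)
  moreover from calculation have "u \<le> k" "v \<le> k" "v \<le> l" "w \<le> l"
    using assms(1-4) by linarith+
  then obtain p q r s where "k = u + p" "k = v + q" "l = v + r" "l = w + s"
    by (metis le_Suc_ex)
  ultimately have "v + d = u + 2 * p" "u + d = v + 2 * q" "w + e = v + 2 * r" "v + e = w + 2 * s"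
    by linarith+
  moreover from this have "q = 0 \<and> s = 0 \<or> p = 0 \<and> r = 0"
    using short by linarith
  ultimately show ?thesis by auto
qed

text \<open>
  One factor has at least the length \<open>u + v\<close> (or \<open>v + w\<close>) at which it becomes zero, while the
  whole is bounded by \<open>u + w\<close>. This leaves no slack for the other factor, which is direct.
\<close>
lemma composite_of_overflowing_lengths:
  fixes u v w d e :: nat
  assumes "u \<le> v + d" "v \<le> u + d" "v \<le> w + e" "w \<le> v + e" "d + e \<le> u + w"
    and long: "u + v < d + 2 \<or> v + w < e + 2"
    and even: "even (d + u + v)" "even (e + v + w)"
  shows "d = u + v \<and> e + v = w \<or> e = v + w \<and> d + v = u"
proof -
  have "u + v < d + 2 \<Longrightarrow> u + v \<le> d" using even(1) by presburger
  moreover have "v + w < e + 2 \<Longrightarrow> v + w \<le> e" using even(2) by presburger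
  ultimately have "u + v \<le> d \<or> v + w \<le> e" using long by blast
  thus ?thesis using assms(1-5) by linarith
qed

text \<open>
  If the composite cannot be shortened, the walk without loop leads towards \<open>n\<close> and the other one is a
  shortest walk through the loop, so the absolute values in the weights resolve and the weights add up.
\<close>
lemma deform_defect_minimal_mixed:
  assumes low: "low (u, v, d)" "low (v, w, e)"
    and minimal: "\<not> (2 \<le> d + e \<and> low (u, w, d + e - 2))"
    and high: "high (u, v, d)" "high (v, w, e)"
    and e: "even (d + u + v)" "odd (e + v + w)"
  shows "deform_defect j (v, w, e) (u, v, d) = 0"
proof -
  obtain C where "mono C" and w: "\<And>u v d. deform_weight j (u, v, d) = (if even (d + u + v)
     then (if high (u, v, d) then \<bar>C u - C v\<bar> else C u + C v)
     else (if high (u, v, d) then 2 * C n - C u - C v else 2 * C n - \<bar>C u - C v\<bar>))"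
    using deform_weight_mono[of j] by auto
  have C: "\<And>a b. a \<le> b \<Longrightarrow> C a \<le> C b"
    using \<open>mono C\<close> by (rule monoD)
  have p: "even ((d + e) + u + w) \<longleftrightarrow> (even (d + u + v) \<longleftrightarrow> even (e + v + w))"
    by (rule parity_join)
  have p': "even ((d + e - 2) + u + w) \<longleftrightarrow> even ((d + e) + u + w)" if "2 \<le> d + e"
    using that by auto
  have V: "1 \<le> u" "u \<le> n" "1 \<le> v" "v \<le> n" "1 \<le> w" "w \<le> n"
    using low by (auto simp: low_def)
  note [simp del] = even_add
  have "u \<le> v + d" "v \<le> u + d" "2 * n + 1 \<le> e + v + w" "d + e + u + w < 2 * n + 3"
    using low minimal V e p p' by (auto simp: low_def)
  moreover have "odd (d + e + u + w)" using e p by blast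
  hence "d + e + u + w < 2 * n + 3 \<Longrightarrow> d + e + u + w \<le> 2 * n + 1" by presburger
  ultimately have eq: "d + u = v \<and> e + v + w = 2 * n + 1"
    by linarith
    have "u \<le> v" using eq V by linarith
    note le0 = C[OF this]
    have "d + e + u + 1 \<le> 2 * n + w" "d + e + w + 1 \<le> 2 * n + u"
      using eq V by linarith+
    hence h0: "high (u, w, d + e)"
      by (simp add: high_def e p)
    have "deform_weight j (u, v, d) = \<bar>C u - C v\<bar>" "deform_weight j (v, w, e) = 2 * C n - C v - C w" "deform_weight j (u, w, d + e) = 2 * C n - C u - C w"
      by (simp_all add: w e p high h0)
    thus ?thesis unfolding deform_defect_def join_type_simps
      using le0 by linarith
qed

text \<open>
  If the composite has no shortened type, the term of the cocycle identity that multiplies it by a third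
  factor is missing, so the defect must be zero. The weights are additive along shortest walks. Two factors that both go
  through the loop always leave room for shortening.
\<close>
lemma deform_defect_minimal:
  assumes low: "low (u, v, d)" "low (v, w, e)"
    and minimal: "\<not> (2 \<le> d + e \<and> low (u, w, d + e - 2))"
    and high: "high (u, v, d)" "high (v, w, e)"
  shows "deform_defect j (v, w, e) (u, v, d) = 0"
proof -
  obtain C where "mono C" and w: "\<And>u v d. deform_weight j (u, v, d) = (if even (d + u + v)
     then (if high (u, v, d) then \<bar>C u - C v\<bar> else C u + C v)
     else (if high (u, v, d) then 2 * C n - C u - C v else 2 * C n - \<bar>C u - C v\<bar>))"
    using deform_weight_mono[of j] by auto
  have C: "\<And>a b. a \<le> b \<Longrightarrow> C a \<le> C b"
    using \<open>mono C\<close> by (rule monoD)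
  have p: "even ((d + e) + u + w) \<longleftrightarrow> (even (d + u + v) \<longleftrightarrow> even (e + v + w))"
    by (rule parity_join)
  have p': "even ((d + e - 2) + u + w) \<longleftrightarrow> even ((d + e) + u + w)" if "2 \<le> d + e"
    using that by auto
  have V: "1 \<le> u" "u \<le> n" "1 \<le> v" "v \<le> n" "1 \<le> w" "w \<le> n"
    using low by (auto simp: low_def)
  note [simp del] = even_add
  show ?thesis
  proof (cases "even (d + u + v)"; cases "even (e + v + w)")
    assume e: "even (d + u + v)" "even (e + v + w)"
    have l: "u \<le> v + d" "v \<le> u + d" "v \<le> w + e" "w \<le> v + e"
      "\<not> 2 \<le> d + e \<or> \<not> u \<le> w + (d + e - 2) \<or> \<not> w \<le> u + (d + e - 2)"
      using low minimal V e p p' by (auto simp: low_def)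
    moreover from this have "d + e < 2 \<or> w + (d + e) < u + 2 \<or> u + (d + e) < w + 2"
      by linarith
    ultimately have "d + u = v \<and> e + v = w \<or> d + v = u \<and> e + w = v"
      using e by (intro composite_of_minimal_lengths)
    from this show ?thesis
    proof (elim disjE)
      assume eq: "d + u = v \<and> e + v = w"
      have "u \<le> v" using eq V by linarith
      note le0 = C[OF this]
      have "v \<le> w" using eq V by linarith
      note le1 = C[OF this]
      have "u \<le> w" using eq V by linarith
      note le2 = C[OF this]
      have "d + e + 2 \<le> u + w"
        using eq V by linarith+
      hence h0: "high (u, w, d + e)"
        by (simp add: high_def e p)
      have "deform_weight j (u, v, d) = \<bar>C u - C v\<bar>" "deform_weight j (v, w, e) = \<bar>C v - C w\<bar>" "deform_weight j (u, w, d + e) = \<bar>C u - C w\<bar>"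
        by (simp_all add: w e p high h0)
      thus ?thesis unfolding deform_defect_def join_type_simps
        using le0 le1 le2 by linarith
    next
      assume eq: "d + v = u \<and> e + w = v"
      have "v \<le> u" using eq V by linarith
      note le0 = C[OF this]
      have "w \<le> v" using eq V by linarith
      note le1 = C[OF this]
      have "w \<le> u" using eq V by linarith
      note le2 = C[OF this]
      have "d + e + 2 \<le> u + w"
        using eq V by linarith+
      hence h0: "high (u, w, d + e)"
        by (simp add: high_def e p)
      have "deform_weight j (u, v, d) = \<bar>C u - C v\<bar>" "deform_weight j (v, w, e) = \<bar>C v - C w\<bar>" "deform_weight j (u, w, d + e) = \<bar>C u - C w\<bar>"
        by (simp_all add: w e p high h0)
      thus ?thesis unfolding deform_defect_def join_type_simps
        using le0 le1 le2 by linarith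
    qed
  next
    assume "even (d + u + v)" "odd (e + v + w)"
    thus ?thesis by (rule deform_defect_minimal_mixed[OF low minimal high])
  next
    assume "odd (d + u + v)" "even (e + v + w)"
    hence "deform_defect j (v, u, d) (w, v, e) = 0"
      using assms by (intro deform_defect_minimal_mixed) (simp_all add: low_reverse high_reverse ac_simps)
    thus ?thesis by (simp only: deform_defect_reverse)
  next
    assume e: "odd (d + u + v)" "odd (e + v + w)"
    have "2 * n + 1 \<le> d + u + v" "2 * n + 1 \<le> e + v + w"
      "\<not> 2 \<le> d + e \<or> \<not> u \<le> w + (d + e - 2) \<or> \<not> w \<le> u + (d + e - 2)"
      using low minimal V e p p' by (auto simp: low_def)
    hence False using V by linarith
    thus ?thesis ..
  qed
qed

text \<open>
  The inequalities force three configurations: the walk without loop is too long, or the walk through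
  the loop is, at either end. In each of them all lengths are determined by the vertices.
\<close>
lemma deform_defect_overflow_mixed:
  assumes low: "low (u, v, d)" "low (v, w, e)" and f: "d + e = f + 2" and high: "high (u, w, f)"
    and overflow: "\<not> high (u, v, d) \<or> \<not> high (v, w, e)"
    and e: "even (d + u + v)" "odd (e + v + w)"
  shows "deform_defect j (v, w, e) (u, v, d) = 0"
proof -
  obtain C where "mono C" and w: "\<And>u v d. deform_weight j (u, v, d) = (if even (d + u + v)
     then (if high (u, v, d) then \<bar>C u - C v\<bar> else C u + C v)
     else (if high (u, v, d) then 2 * C n - C u - C v else 2 * C n - \<bar>C u - C v\<bar>))"
    using deform_weight_mono[of j] by auto
  have C: "\<And>a b. a \<le> b \<Longrightarrow> C a \<le> C b"
    using \<open>mono C\<close> by (rule monoD)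
  have p: "even ((d + e) + u + w) \<longleftrightarrow> (even (d + u + v) \<longleftrightarrow> even (e + v + w))"
    by (rule parity_join)
  have p': "even (f + u + w) \<longleftrightarrow> (even (d + u + v) \<longleftrightarrow> even (e + v + w))"
    using p f by auto
  have V: "1 \<le> u" "u \<le> n" "1 \<le> v" "v \<le> n" "1 \<le> w" "w \<le> n"
    using low by (auto simp: low_def)
  note [simp del] = even_add
  have "u \<le> v + d" "v \<le> u + d" "2 * n + 1 \<le> e + v + w"
    using low e by (simp_all add: low_def)
  moreover have "d + e + u \<le> 2 * n + 1 + w" "d + e + w \<le> 2 * n + 1 + u"
    using high[unfolded high_def] e f by (simp_all add: p')
  moreover have "u + v < d + 2 \<or> 2 * n + 1 + w < e + v + 2 \<or> 2 * n + 1 + v < e + w + 2"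
    using overflow e by (auto simp: high_def)
  moreover have "u + v < d + 2 \<Longrightarrow> u + v \<le> d"
    using e(1) by presburger
  moreover have "2 * n + 1 + w < e + v + 2 \<Longrightarrow> 2 * n + 1 + w \<le> e + v"
    using e(2) by presburger
  moreover have "2 * n + 1 + v < e + w + 2 \<Longrightarrow> 2 * n + 1 + v \<le> e + w"
    using e(2) by presburger
  ultimately have "d = u + v \<and> e + v + w = 2 * n + 1 \<and> u \<le> w \<or>
      d + u = v \<and> e + v = 2 * n + 1 + w \<and> w \<le> u \<or> d + v = u \<and> e + w = 2 * n + 1 + v \<and> u \<le> w"
    by linarith
  from this show ?thesis
  proof (elim disjE)
    assume eq: "d = u + v \<and> e + v + w = 2 * n + 1 \<and> u \<le> w"
    have "u \<le> w" using eq V by linarith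
    note le0 = C[OF this]
    have "u + v < d + 2"
      using eq V by linarith+
    hence h0: "\<not> high (u, v, d)"
      by (simp add: high_def e p)
    have "e + v + 1 \<le> 2 * n + w" "e + w + 1 \<le> 2 * n + v"
      using eq V by linarith+
    hence h1: "high (v, w, e)"
      by (simp add: high_def e p)
    have "2 * n + u < d + e + w + 1"
      using eq V by linarith+
    hence h2: "\<not> high (u, w, d + e)"
      by (simp add: high_def e p)
    have "deform_weight j (u, v, d) = C u + C v" "deform_weight j (v, w, e) = 2 * C n - C v - C w" "deform_weight j (u, w, d + e) = 2 * C n - \<bar>C u - C w\<bar>"
      by (simp_all add: w e p high h0 h1 h2)
    thus ?thesis unfolding deform_defect_def join_type_simps
      using le0 by linarith
  next
    assume eq: "d + u = v \<and> e + v = 2 * n + 1 + w \<and> w \<le> u"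
    have "u \<le> v" using eq V by linarith
    note le0 = C[OF this]
    have "w \<le> u" using eq V by linarith
    note le1 = C[OF this]
    have "w \<le> v" using eq V by linarith
    note le2 = C[OF this]
    have "d + 2 \<le> u + v"
      using eq V by linarith+
    hence h0: "high (u, v, d)"
      by (simp add: high_def e p)
    have "2 * n + w < e + v + 1"
      using eq V by linarith+
    hence h1: "\<not> high (v, w, e)"
      by (simp add: high_def e p)
    have "2 * n + w < d + e + u + 1"
      using eq V by linarith+
    hence h2: "\<not> high (u, w, d + e)"
      by (simp add: high_def e p)
    have "deform_weight j (u, v, d) = \<bar>C u - C v\<bar>" "deform_weight j (v, w, e) = 2 * C n - \<bar>C v - C w\<bar>" "deform_weight j (u, w, d + e) = 2 * C n - \<bar>C u - C w\<bar>"
      by (simp_all add: w e p high h0 h1 h2)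
    thus ?thesis unfolding deform_defect_def join_type_simps
      using le0 le1 le2 by linarith
  next
    assume eq: "d + v = u \<and> e + w = 2 * n + 1 + v \<and> u \<le> w"
    have "v \<le> u" using eq V by linarith
    note le0 = C[OF this]
    have "u \<le> w" using eq V by linarith
    note le1 = C[OF this]
    have "v \<le> w" using eq V by linarith
    note le2 = C[OF this]
    have "d + 2 \<le> u + v"
      using eq V by linarith+
    hence h0: "high (u, v, d)"
      by (simp add: high_def e p)
    have "2 * n + v < e + w + 1"
      using eq V by linarith+
    hence h1: "\<not> high (v, w, e)"
      by (simp add: high_def e p)
    have "2 * n + u < d + e + w + 1"
      using eq V by linarith+
    hence h2: "\<not> high (u, w, d + e)"
      by (simp add: high_def e p)
    have "deform_weight j (u, v, d) = \<bar>C u - C v\<bar>" "deform_weight j (v, w, e) = 2 * C n - \<bar>C v - C w\<bar>" "deform_weight j (u, w, d + e) = 2 * C n - \<bar>C u - C w\<bar>"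
      by (simp_all add: w e p high h0 h1 h2)
    thus ?thesis unfolding deform_defect_def join_type_simps
      using le0 le1 le2 by linarith
  qed
qed

text \<open>
  Here a factor is zero in the model although the shortened composite is not. The two branches
  of the weight beyond the bound \<open>high\<close> are made for this case.
\<close>
lemma deform_defect_overflow:
  assumes low: "low (u, v, d)" "low (v, w, e)" and f: "d + e = f + 2" and high: "high (u, w, f)"
    and overflow: "\<not> high (u, v, d) \<or> \<not> high (v, w, e)"
  shows "deform_defect j (v, w, e) (u, v, d) = 0"
proof -
  obtain C where "mono C" and w: "\<And>u v d. deform_weight j (u, v, d) = (if even (d + u + v)
     then (if high (u, v, d) then \<bar>C u - C v\<bar> else C u + C v)
     else (if high (u, v, d) then 2 * C n - C u - C v else 2 * C n - \<bar>C u - C v\<bar>))"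
    using deform_weight_mono[of j] by auto
  have C: "\<And>a b. a \<le> b \<Longrightarrow> C a \<le> C b"
    using \<open>mono C\<close> by (rule monoD)
  have p: "even ((d + e) + u + w) \<longleftrightarrow> (even (d + u + v) \<longleftrightarrow> even (e + v + w))"
    by (rule parity_join)
  have p': "even (f + u + w) \<longleftrightarrow> (even (d + u + v) \<longleftrightarrow> even (e + v + w))"
    using p f by auto
  have V: "1 \<le> u" "u \<le> n" "1 \<le> v" "v \<le> n" "1 \<le> w" "w \<le> n"
    using low by (auto simp: low_def)
  note [simp del] = even_add
  show ?thesis
  proof (cases "even (d + u + v)"; cases "even (e + v + w)")
    assume e: "even (d + u + v)" "even (e + v + w)"
    have "u \<le> v + d" "v \<le> u + d" "v \<le> w + e" "w \<le> v + e"
      using low e by (simp_all add: low_def)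
    moreover have "d + e \<le> u + w"
      using high[unfolded high_def] e f by (simp add: p')
    moreover have "u + v < d + 2 \<or> v + w < e + 2"
      using overflow e by (auto simp: high_def)
    ultimately have "d = u + v \<and> e + v = w \<or> e = v + w \<and> d + v = u"
      using e by (intro composite_of_overflowing_lengths)
    from this show ?thesis
    proof (elim disjE)
      assume eq: "d = u + v \<and> e + v = w"
      have "v \<le> w" using eq V by linarith
      note le0 = C[OF this]
      have "u + v < d + 2"
        using eq V by linarith+
      hence h0: "\<not> high (u, v, d)"
        by (simp add: high_def e p)
      have "e + 2 \<le> v + w"
        using eq V by linarith+
      hence h1: "high (v, w, e)"
        by (simp add: high_def e p)
      have "u + w < d + e + 2"
        using eq V by linarith+
      hence h2: "\<not> high (u, w, d + e)"
        by (simp add: high_def e p)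
      have "deform_weight j (u, v, d) = C u + C v" "deform_weight j (v, w, e) = \<bar>C v - C w\<bar>" "deform_weight j (u, w, d + e) = C u + C w"
        by (simp_all add: w e p high h0 h1 h2)
      thus ?thesis unfolding deform_defect_def join_type_simps
        using le0 by linarith
    next
      assume eq: "e = v + w \<and> d + v = u"
      have "v \<le> u" using eq V by linarith
      note le0 = C[OF this]
      have "d + 2 \<le> u + v"
        using eq V by linarith+
      hence h0: "high (u, v, d)"
        by (simp add: high_def e p)
      have "v + w < e + 2"
        using eq V by linarith+
      hence h1: "\<not> high (v, w, e)"
        by (simp add: high_def e p)
      have "u + w < d + e + 2"
        using eq V by linarith+
      hence h2: "\<not> high (u, w, d + e)"
        by (simp add: high_def e p)
      have "deform_weight j (u, v, d) = \<bar>C u - C v\<bar>" "deform_weight j (v, w, e) = C v + C w" "deform_weight j (u, w, d + e) = C u + C w"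
        by (simp_all add: w e p high h0 h1 h2)
      thus ?thesis unfolding deform_defect_def join_type_simps
        using le0 by linarith
    qed
  next
    assume "even (d + u + v)" "odd (e + v + w)"
    thus ?thesis by (rule deform_defect_overflow_mixed[OF low f high overflow])
  next
    assume "odd (d + u + v)" "even (e + v + w)"
    hence "deform_defect j (v, u, d) (w, v, e) = 0"
      using assms by (intro deform_defect_overflow_mixed[of w v e u d f]) (auto simp: low_reverse high_reverse ac_simps)
    thus ?thesis by (simp only: deform_defect_reverse)
  next
    assume e: "odd (d + u + v)" "odd (e + v + w)"
    have "2 * n + 1 \<le> d + u + v" "2 * n + 1 \<le> e + v + w"
      using low e by (simp_all add: low_def)
    moreover have "d + e \<le> u + w"
      using high[unfolded high_def] e f by (simp add: p')
    moreover have "2 * n + u < d + v + 1 \<or> 2 * n + v < d + u + 1 \<or> 2 * n + w < e + v + 1 \<or> 2 * n + v < e + w + 1"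
      using overflow e by (auto simp: high_def)
    ultimately have False using V by linarith
    thus ?thesis ..
  qed
qed

end

context type_T
begin

lemma deformation_bilinear: "bilinear_map (deformation j)"
  unfolding deformation_def by (rule structure_product_bilinear)

lemma deformation_in_M [simp]: "deformation j x y \<in> M"
  by (auto simp: deformation_def structure_product_def deform_const_def M_def intro!: sum.neutral)

lemma sum_deform_const_left:
  assumes "r \<in> I" "a \<in> I"
  shows "(\<Sum>s\<in>I. mult_const a b s * deform_const j s c r) =
    of_bool (join_type a b \<in> I \<and> fst a = fst (snd b)) * deform_const j (join_type a b) c r"
proof -
  have "(\<Sum>s\<in>I. mult_const a b s * deform_const j s c r) =
      (\<Sum>s\<in>I. if s = join_type a b then of_bool (fst a = fst (snd b)) * deform_const j s c r else 0)"
    by (rule sum.cong) (auto simp: mult_const_def)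
  thus ?thesis by (simp add: sum.delta finite_I)
qed

lemma sum_deform_const_right:
  assumes "r \<in> I" "a \<in> I"
  shows "(\<Sum>s\<in>I. mult_const b c s * deform_const j a s r) =
    of_bool (join_type b c \<in> I \<and> fst b = fst (snd c)) * deform_const j a (join_type b c) r"
proof -
  have "(\<Sum>s\<in>I. mult_const b c s * deform_const j a s r) =
      (\<Sum>s\<in>I. if s = join_type b c then of_bool (fst b = fst (snd c)) * deform_const j a s r else 0)"
    by (rule sum.cong) (auto simp: mult_const_def)
  thus ?thesis by (simp add: sum.delta finite_I)
qed

lemma sum_mult_deform_right:
  "(\<Sum>s\<in>I. deform_const j (v, w, e) (u, v', d) s * mult_const a s r) =
    of_bool (v' = v \<and> 2 \<le> d + e \<and> (u, w, d + e - 2) \<in> I \<and> fst a = w \<and>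
      r = join_type a (u, w, d + e - 2) \<and> r \<in> I) * of_int (deform_defect j (v, w, e) (u, v', d))"
proof -
  have "(\<Sum>s\<in>I. deform_const j (v, w, e) (u, v', d) s * mult_const a s r) =
     (\<Sum>s\<in>I. if s = (u, w, d + e - 2) then of_bool (v' = v \<and> 2 \<le> d + e \<and> fst a = w \<and>
        r = join_type a s \<and> r \<in> I) * of_int (deform_defect j (v, w, e) (u, v', d)) else 0)"
    by (intro sum.cong refl) (auto simp: deform_const_def mult_const_def)
  thus ?thesis by (simp add: finite_I)
qed

lemma sum_mult_deform_left:
  "(\<Sum>s\<in>I. deform_const j (v, w, e) (u, v', d) s * mult_const s (t, u', f) r) =
    of_bool (v' = v \<and> u' = u \<and> 2 \<le> d + e \<and> (u, w, d + e - 2) \<in> I \<and>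
      r = (t, w, f + (d + e - 2)) \<and> r \<in> I) * of_int (deform_defect j (v, w, e) (u, v', d))"
proof -
  have "deform_const j (v, w, e) (u, v', d) s * mult_const s (t, u', f) r =
     (if s = (u, w, d + e - 2) then of_bool (v' = v \<and> u' = u \<and> 2 \<le> d + e \<and>
        r = (t, w, f + (d + e - 2)) \<and> r \<in> I) * of_int (deform_defect j (v, w, e) (u, v', d)) else 0)"
    if "s \<in> I" for s
    using that by (cases s) (auto simp: deform_const_def mult_const_def)
  hence "(\<Sum>s\<in>I. deform_const j (v, w, e) (u, v', d) s * mult_const s (t, u', f) r) =
     (\<Sum>s\<in>I. if s = (u, w, d + e - 2) then of_bool (v' = v \<and> u' = u \<and> 2 \<le> d + e \<and>
        r = (t, w, f + (d + e - 2)) \<and> r \<in> I) * of_int (deform_defect j (v, w, e) (u, v', d)) else 0)"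
    by (rule sum.cong[OF refl])
  thus ?thesis by (simp add: finite_I)
qed

text \<open>
  By the two vanishing lemmas each of the four terms is the full defect, also where the model drops it;
  the alternating sum of the defects is zero because they are differences of weights.
\<close>
lemma deform_const_cocycle:
  assumes I: "a \<in> I" "b \<in> I" "c \<in> I" "r \<in> I"
  shows "(\<Sum>s\<in>I. deform_const j b c s * mult_const a s r) - (\<Sum>s\<in>I. mult_const a b s * deform_const j s c r)
       + (\<Sum>s\<in>I. mult_const b c s * deform_const j a s r) - (\<Sum>s\<in>I. deform_const j a b s * mult_const s c r) = 0"
proof -
  obtain w x f where a: "a = (w, x, f)" by (cases a)
  obtain v w' e where b: "b = (v, w', e)" by (cases b)
  obtain u v' d where c: "c = (u, v', d)" by (cases c)
  obtain u' x' g where r: "r = (u', x', g)" by (cases r)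
  let ?comp = "w' = w \<and> v' = v \<and> u' = u \<and> x' = x \<and> d + e + f = g + 2"
  show ?thesis
  proof (cases ?comp)
    case False
    have "(\<Sum>s\<in>I. deform_const j b c s * mult_const a s r) = 0"
      using False unfolding a b c r sum_mult_deform_right by auto
    moreover have "(\<Sum>s\<in>I. deform_const j a b s * mult_const s c r) = 0"
      using False unfolding a b c r sum_mult_deform_left by auto
    moreover have "(\<Sum>s\<in>I. mult_const a b s * deform_const j s c r) = 0"
      unfolding sum_deform_const_left[OF I(4,1)] using False by (auto simp: a b c r deform_const_def)
    moreover have "(\<Sum>s\<in>I. mult_const b c s * deform_const j a s r) = 0"
      unfolding sum_deform_const_right[OF I(4,1)] using False by (auto simp: a b c r deform_const_def)
    ultimately show ?thesis by simp
  next
    case True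
    hence eq: "w' = w" "v' = v" "u' = u" "x' = x" "d + e + f = g + 2" by auto
    have l: "low (w, x, f)" "low (v, w, e)" "low (u, v, d)" "low (u, x, g)"
     and h: "high (w, x, f)" "high (v, w, e)" "high (u, v, d)" "high (u, x, g)"
      using I by (simp_all add: a b c r eq I_def)
    have l2: "low (u, w, d + e)" "low (v, x, e + f)"
      using low_join l by blast+
    have t1: "(\<Sum>s\<in>I. deform_const j b c s * mult_const a s r) = of_int (deform_defect j b c)"
    proof (cases "2 \<le> d + e \<and> low (u, w, d + e - 2)")
      case True
      hence "(u, w, d + e - 2) \<in> I"
        using I_factors(1)[of u w "d + e - 2" x f] l I(4) eq by (auto simp: r)
      moreover have "g = d + e - 2 + f" using True eq by linarith
      ultimately show ?thesis using True I(4) unfolding a b c r eq sum_mult_deform_right by simp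
    next
      case False
      hence "deform_defect j b c = 0"
        using deform_defect_minimal[of u v d w e j] l h by (auto simp: b c eq)
      thus ?thesis unfolding b c sum_mult_deform_right by simp
    qed
    have t4: "(\<Sum>s\<in>I. deform_const j a b s * mult_const s c r) = of_int (deform_defect j a b)"
    proof (cases "2 \<le> e + f \<and> low (v, x, e + f - 2)")
      case True
      hence "(v, x, e + f - 2) \<in> I"
        using I_factors(2)[of u v d x "e + f - 2"] l I(4) eq by (simp add: r add.assoc[symmetric])
      moreover have "g = d + (e + f - 2)" using True eq by linarith
      ultimately show ?thesis using True I(4) unfolding a b c r eq sum_mult_deform_left by simp
    next
      case False
      hence "deform_defect j a b = 0"
        using deform_defect_minimal[of v w e x f j] l h by (auto simp: a b eq)
      thus ?thesis unfolding a b c sum_mult_deform_left by simp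
    qed
    have t2: "(\<Sum>s\<in>I. mult_const a b s * deform_const j s c r) = of_int (deform_defect j (join_type a b) c)"
    proof (cases "join_type a b \<in> I")
      case True
      thus ?thesis using I eq unfolding sum_deform_const_left[OF I(4,1)]
        by (auto simp: a b c r deform_const_def)
    next
      case False
      hence "deform_defect j (join_type a b) c = 0"
        using deform_defect_overflow[of u v d x "e + f" g j] l l2 h eq by (auto simp: a b c I_def)
      thus ?thesis using False unfolding sum_deform_const_left[OF I(4,1)] by simp
    qed
    have t3: "(\<Sum>s\<in>I. mult_const b c s * deform_const j a s r) = of_int (deform_defect j a (join_type b c))"
    proof (cases "join_type b c \<in> I")
      case True
      thus ?thesis using I eq unfolding sum_deform_const_right[OF I(4,1)]
        by (auto simp: a b c r deform_const_def)
    next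
      case False
      hence "deform_defect j a (join_type b c) = 0"
        using deform_defect_overflow[of u w "d + e" x f g j] l l2 h eq by (auto simp: a b c I_def)
      thus ?thesis using False unfolding sum_deform_const_right[OF I(4,1)] by simp
    qed
    have "deform_defect j b c - deform_defect j (join_type a b) c
        + deform_defect j a (join_type b c) - deform_defect j a b = 0"
      by (simp add: deform_defect_def a b c eq add.assoc)
    hence "(of_int (deform_defect j b c - deform_defect j (join_type a b) c
        + deform_defect j a (join_type b c) - deform_defect j a b) :: complex) = 0"
      by simp
    thus ?thesis by (simp only: t1 t2 t3 t4 of_int_add of_int_diff)
  qed
qed

lemma deformation_cocycle: "hochschild2 (deformation j) x y z = 0"
proof (rule ext)
  fix r
  show "hochschild2 (deformation j) x y z r = 0 r"
  proof (cases "r \<in> I")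
    case True
    have "hochschild2 (deformation j) x y z r =
      (\<Sum>a\<in>I. \<Sum>b\<in>I. \<Sum>c\<in>I. x a * y b * z c * (\<Sum>s\<in>I. deform_const j b c s * mult_const a s r))
    - (\<Sum>a\<in>I. \<Sum>b\<in>I. \<Sum>c\<in>I. x a * y b * z c * (\<Sum>s\<in>I. mult_const a b s * deform_const j s c r))
    + (\<Sum>a\<in>I. \<Sum>b\<in>I. \<Sum>c\<in>I. x a * y b * z c * (\<Sum>s\<in>I. mult_const b c s * deform_const j a s r))
    - (\<Sum>a\<in>I. \<Sum>b\<in>I. \<Sum>c\<in>I. x a * y b * z c * (\<Sum>s\<in>I. deform_const j a b s * mult_const s c r))"
      unfolding hochschild2_def pointwise deformation_def star_def
        structure_product_nested_left structure_product_nested_right ..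
    also have "\<dots> = (\<Sum>a\<in>I. \<Sum>b\<in>I. \<Sum>c\<in>I. x a * y b * z c * (
         (\<Sum>s\<in>I. deform_const j b c s * mult_const a s r) - (\<Sum>s\<in>I. mult_const a b s * deform_const j s c r)
       + (\<Sum>s\<in>I. mult_const b c s * deform_const j a s r) - (\<Sum>s\<in>I. deform_const j a b s * mult_const s c r)))"
      by (simp add: sum_subtractf sum.distrib algebra_simps)
    also have "\<dots> = 0"
      using True by (intro sum.neutral ballI) (simp add: deform_const_cocycle)
    finally show ?thesis by (simp add: pointwise)
  next
    case False
    have "hochschild2 (deformation j) x y z \<in> M"
      by (simp add: hochschild2_def)
    thus ?thesis using False by (cases r) (simp add: M_def pointwise)
  qed
qed

lemma deformation_ev:
  assumes "a \<in> I" "b \<in> I"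
  shows "deformation j (ev a) (ev b) r = deform_const j a b r"
  using structure_product_ev[OF finite_I assms, of "deform_const j"] assms
  by (simp add: deformation_def ev_def)

text \<open>
  At the vertex \<open>k\<close> the weights of the two-step walks differ by the second difference of \<open>m \<mapsto> min m j\<close>,
  which is concentrated at \<open>m = j\<close>; the branch of \<open>deform_weight\<close> beyond the bound supplies the boundary
  value at \<open>k = 1\<close>.
\<close>
lemma obstruction_deformation:
  assumes j: "j \<in> {1..n}" and k: "k \<in> {1..n}"
  shows "obstruction (deformation j) k = 2 * of_bool (k = j)"
proof -
  let ?C = "\<lambda>m. complex_of_int (int (min m j))"
  have 1: "deformation j (up i) (down i) (k, k, 0) = of_bool (i = k - 1) * (2 * (?C k - ?C (k - 1)))"
    if i: "i \<in> {1..<n}" for i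
    unfolding up_def down_def using deformation_ev[OF arrow_I(1,2)[OF i]] i idem_I[OF k]
    by (auto simp: deform_const_def deform_defect_def deform_weight_def high_def)
  have 2: "deformation j (down i) (up i) (k, k, 0) = of_bool (i = k) * (2 * (?C (k + 1) - ?C k) - of_bool (k = 1) * 2 * ?C k)"
    if i: "i \<in> {1..<n}" for i
    unfolding up_def down_def using deformation_ev[OF arrow_I(2,1)[OF i]] i idem_I[OF k]
    by (auto simp: deform_const_def deform_defect_def deform_weight_def high_def)
  have 3: "deformation j lp lp (k, k, 0) = - of_bool (n = k \<and> n = 1) * 2 * ?C k"
    unfolding lp_def using deformation_ev[OF arrow_I(3,3)] idem_I[OF k]
    by (auto simp: deform_const_def deform_defect_def deform_weight_def high_def)
  have "obstruction (deformation j) k =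
     (\<Sum>i\<in>{1..<n}. deformation j (up i) (down i) (k, k, 0)) -
     (\<Sum>i\<in>{1..<n}. deformation j (down i) (up i) (k, k, 0)) - deformation j lp lp (k, k, 0)"
    by (simp add: obstruction_def relator_def sum_fun_apply pointwise sum_subtractf)
  also have "(\<Sum>i\<in>{1..<n}. deformation j (up i) (down i) (k, k, 0)) =
     (\<Sum>i\<in>{1..<n}. if i = k - 1 then 2 * (?C k - ?C (k - 1)) else 0)"
    by (rule sum.cong[OF refl]) (simp only: 1 of_bool_def if_distrib[of "\<lambda>t. t * _"] mult_1 mult_zero_left)
  also have "(\<Sum>i\<in>{1..<n}. deformation j (down i) (up i) (k, k, 0)) =
     (\<Sum>i\<in>{1..<n}. if i = k then 2 * (?C (k + 1) - ?C k) - of_bool (k = 1) * 2 * ?C k else 0)"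
    by (rule sum.cong[OF refl]) (simp only: 2, simp)
  also have "(\<Sum>i\<in>{1..<n}. if i = k - 1 then 2 * (?C k - ?C (k - 1)) else 0) -
     (\<Sum>i\<in>{1..<n}. if i = k then 2 * (?C (k + 1) - ?C k) - of_bool (k = 1) * 2 * ?C k else 0) -
     deformation j lp lp (k, k, 0) = 2 * of_bool (k = j)"
    using j k by (auto simp: 3 min_def of_nat_diff)
  finally show ?thesis .
qed

section \<open>Central elements of the model\<close>

definition central_element :: "nat \<Rightarrow> walk_type \<Rightarrow> complex" where
  "central_element D = (\<Sum>v\<in>{1..n}. ev (v, v, D))"

lemma central_element_in_M [simp]: "central_element D \<in> M"
  by (simp add: central_element_def)

lemma central_element_apply:
  "central_element D (u, v, d) = of_bool (u = v \<and> d = D \<and> (u, v, d) \<in> I)"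
proof -
  have "central_element D (u, v, d) = (\<Sum>w\<in>{1..n}. if w = u then of_bool (u = v \<and> d = D \<and> (u, v, d) \<in> I) else 0)"
    unfolding central_element_def sum_fun_apply by (intro sum.cong) (auto simp: ev_def)
  thus ?thesis using I_vertices[of u v d] by auto
qed

text \<open>
  Multiplication by the sum of all closed walks of an even length \<open>D\<close> lengthens by \<open>D\<close>, on either side.
  If the lengthened type is admissible, so is the closed walk that was used, by \<open>I_factors\<close>.
\<close>
lemma central_element_star:
  assumes D: "even D" and y: "y \<in> M"
  shows "(central_element D \<star> y) (u, w, d) = of_bool (D \<le> d \<and> (u, w, d) \<in> I) * y (u, w, d - D)"
proof -
  have "(central_element D \<star> y) (u, w, d) = (\<Sum>v\<in>{1..n}. (ev (v, v, D) \<star> y) (u, w, d))"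
    by (simp add: central_element_def star_sum_left sum_fun_apply)
  also have "\<dots> = (\<Sum>v\<in>{1..n}. if v = w then of_bool ((w, w, D) \<in> I \<and> D \<le> d \<and> (u, w, d) \<in> I) * y (u, w, d - D) else 0)"
  proof (intro sum.cong refl)
    fix v
    show "(ev (v, v, D) \<star> y) (u, w, d) =
      (if v = w then of_bool ((w, w, D) \<in> I \<and> D \<le> d \<and> (u, w, d) \<in> I) * y (u, w, d - D) else 0)"
      using ev_star[of v v D y u w d] y by (cases "(v, v, D) \<in> I") (auto simp: ev_eq_0 pointwise)
  qed
  also have "\<dots> = of_bool (D \<le> d \<and> (u, w, d) \<in> I) * y (u, w, d - D)"
  proof (cases "D \<le> d \<and> (u, w, d) \<in> I \<and> y (u, w, d - D) \<noteq> 0")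
    case True
    hence "(u, w, d - D) \<in> I" using y by (auto simp: M_def)
    moreover have w: "low (w, w, D)" using D True I_vertices[of u w d] by (auto simp: low_def)
    ultimately have "(w, w, D) \<in> I"
      using True by (intro I_factors(2)[of u w "d - D" w D]) (auto intro: I_low)
    thus ?thesis using I_vertices by auto
  qed auto
  finally show ?thesis .
qed

lemma star_central_element:
  assumes D: "even D" and y: "y \<in> M"
  shows "(y \<star> central_element D) (u, w, d) = of_bool (D \<le> d \<and> (u, w, d) \<in> I) * y (u, w, d - D)"
proof -
  have "(y \<star> central_element D) (u, w, d) = (\<Sum>v\<in>{1..n}. (y \<star> ev (v, v, D)) (u, w, d))"
    by (simp add: central_element_def star_sum_right sum_fun_apply)
  also have "\<dots> = (\<Sum>v\<in>{1..n}. if v = u then of_bool ((u, u, D) \<in> I \<and> D \<le> d \<and> (u, w, d) \<in> I) * y (u, w, d - D) else 0)"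
  proof (intro sum.cong refl)
    fix v
    show "(y \<star> ev (v, v, D)) (u, w, d) =
      (if v = u then of_bool ((u, u, D) \<in> I \<and> D \<le> d \<and> (u, w, d) \<in> I) * y (u, w, d - D) else 0)"
      using star_ev[of v v D y u w d] y by (cases "(v, v, D) \<in> I") (auto simp: ev_eq_0 pointwise)
  qed
  also have "\<dots> = of_bool (D \<le> d \<and> (u, w, d) \<in> I) * y (u, w, d - D)"
  proof (cases "D \<le> d \<and> (u, w, d) \<in> I \<and> y (u, w, d - D) \<noteq> 0")
    case True
    hence "(u, w, d - D) \<in> I" using y by (auto simp: M_def)
    moreover have w: "low (u, u, D)" using D True I_vertices[of u w d] by (auto simp: low_def)
    ultimately have "(u, u, D) \<in> I"
      using True by (intro I_factors(1)[of u u D w "d - D"]) (auto intro: I_low)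
    thus ?thesis using I_vertices by auto
  qed auto
  finally show ?thesis .
qed

lemma central_element_central:
  assumes "even D" "y \<in> M"
  shows "central_element D \<star> y = y \<star> central_element D"
proof (rule ext)
  fix r :: walk_type
  obtain u w d where "r = (u, w, d)" by (cases r)
  thus "(central_element D \<star> y) r = (y \<star> central_element D) r"
    by (simp add: central_element_star star_central_element assms)
qed

lemma central_diagonal:
  assumes "x \<in> M" "\<And>y. y \<in> M \<Longrightarrow> x \<star> y = y \<star> x" "u \<noteq> v"
  shows "x (u, v, d) = 0"
proof (cases "(u, v, d) \<in> I")
  case True
  hence u: "u \<in> {1..n}" using I_vertices by blast
  have "(x \<star> idem u) (u, v, d) = (idem u \<star> x) (u, v, d)"
    using assms(2)[of "idem u"] by (simp add: idem_def)
  thus ?thesis using assms(1,3) u by (simp add: idem_star star_idem)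
qed (use assms(1) in \<open>simp add: M_def\<close>)

text \<open>
  Compare the coefficients of \<open>x a\<^sub>i\<close> and \<open>a\<^sub>i x\<close>.
\<close>
lemma central_neighbours:
  assumes "x \<in> M" "\<And>y. y \<in> M \<Longrightarrow> x \<star> y = y \<star> x" "i \<in> {1..<n}" "(i, i + 1, D + 1) \<in> I"
  shows "x (i + 1, i + 1, D) = x (i, i, D)"
proof -
  have "(x \<star> up i) (i, i + 1, D + 1) = (up i \<star> x) (i, i + 1, D + 1)"
    using assms(2)[of "up i"] by (simp add: up_def)
  thus ?thesis
    using assms(1,4) star_ev[OF arrow_I(1)[OF assms(3)] assms(1)] ev_star[OF arrow_I(1)[OF assms(3)] assms(1)]
    by (simp add: up_def)
qed

text \<open>
  The coefficients agree along the vertices up to \<open>n\<close>: a closed walk of even length that is admissible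
  at a vertex is admissible at all later ones.
\<close>
lemma central_even:
  assumes "x \<in> M" "\<And>y. y \<in> M \<Longrightarrow> x \<star> y = y \<star> x" "even D"
    and homogeneous: "\<And>u v d. x (u, v, d) \<noteq> 0 \<Longrightarrow> d = D"
  shows "x = scl (x (n, n, D)) (central_element D)"
proof (rule ext)
  have step: "(i, i, D) \<in> I \<longrightarrow> x (i, i, D) = x (n, n, D)" if "i \<le> n" for i
    using that
  proof (induction rule: inc_induct)
    case (step i)
    show ?case
    proof
      assume i: "(i, i, D) \<in> I"
      hence "i \<in> {1..<n}" "(i, i + 1, D + 1) \<in> I" "(Suc i, Suc i, D) \<in> I"
        using step(1,2) assms(3) by (auto simp: I_def low_def high_def)
      thus "x (i, i, D) = x (n, n, D)"
        using central_neighbours[OF assms(1,2), of i D] step by simp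
    qed
  qed auto
  fix r :: walk_type
  obtain u v d where r: "r = (u, v, d)" by (cases r)
  show "x r = scl (x (n, n, D)) (central_element D) r"
  proof (cases "(u, v, d) \<in> I \<and> u = v \<and> d = D")
    case True
    thus ?thesis using step[of u] I_vertices[of u v d] by (auto simp: r central_element_apply)
  next
    case False
    hence "x (u, v, d) = 0"
      using central_diagonal[OF assms(1,2), of u v d] homogeneous[of u v d] assms(1) unfolding M_def by blast
    thus ?thesis using False by (auto simp: r central_element_apply)
  qed
qed

text \<open>
  Start from a vertex where no closed walk of this odd length exists, and move towards \<open>n\<close>; the bound on
  the degree keeps the lengthened walks admissible.
\<close>
lemma central_odd:
  assumes "x \<in> M" "\<And>y. y \<in> M \<Longrightarrow> x \<star> y = y \<star> x" "odd D" "D < 2 * n - 1"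
    and homogeneous: "\<And>u v d. x (u, v, d) \<noteq> 0 \<Longrightarrow> d = D"
  shows "x = 0"
proof (rule ext)
  have D: "D + 3 \<le> 2 * n" using assms(3,4) by presburger
  have step: "i \<le> n \<longrightarrow> x (i, i, D) = 0" for i
  proof (induction i)
    case 0
    have "(0, 0, D) \<notin> I" using I_vertices by auto
    thus ?case using assms(1) by (simp add: M_def)
  next
    case (Suc i)
    show ?case
    proof
      assume i: "Suc i \<le> n"
      show "x (Suc i, Suc i, D) = 0"
      proof (cases "(Suc i, Suc i, D) \<in> I")
        case True
        hence "i \<in> {1..<n}" "(i, i + 1, D + 1) \<in> I"
          using i assms(3) D by (auto simp: I_def low_def high_def elim!: oddE)
        thus ?thesis using central_neighbours[OF assms(1,2), of i D] Suc by simp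
      qed (use assms(1) in \<open>simp add: M_def\<close>)
    qed
  qed
  fix r :: walk_type
  obtain u v d where r: "r = (u, v, d)" by (cases r)
  show "x r = 0 r"
  proof (cases "(u, v, d) \<in> I \<and> u = v \<and> d = D")
    case True
    thus ?thesis using step[of u] I_vertices[of u v d] by (auto simp: r pointwise)
  next
    case False
    hence "x (u, v, d) = 0"
      using central_diagonal[OF assms(1,2), of u v d] homogeneous[of u v d] assms(1) unfolding M_def by blast
    thus ?thesis by (simp add: r pointwise)
  qed
qed

lemma central_element_top: "even D \<Longrightarrow> D < 2 * n - 1 \<Longrightarrow> central_element D (n, n, D) = 1"
  using n_pos by (auto simp: central_element_apply I_def low_def high_def elim!: evenE)

end

section \<open>Walks up to the preprojective relations\<close>

context type_T
begin

sublocale Q: wf_digraph "T_quiver_double n"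
  using n_pos by unfold_locales (auto simp: T_quiver_double_def)

declare Q.awalk_append_iff [simp del]

abbreviation arrows where "arrows \<equiv> arcs (T_quiver_double n)"
abbreviation src where "src \<equiv> tail (T_quiver_double n)"
abbreviation tgt where "tgt \<equiv> head (T_quiver_double n)"
abbreviation walk where "walk \<equiv> Q.awalk"

lemma verts_Q: "verts (T_quiver_double n) = {1..n}"
  by (simp add: T_quiver_double_def)

lemma arrows_iff: "e \<in> arrows \<longleftrightarrow> (case e of Fwd i \<Rightarrow> i \<in> {1..<n} | Bwd i \<Rightarrow> i \<in> {1..<n} | Loop \<Rightarrow> True)"
  by (auto simp: T_quiver_double_def split: T_arrow.splits)

lemma src_simps [simp]: "src (Fwd i) = i" "src (Bwd i) = i + 1" "src Loop = n"
  and tgt_simps [simp]: "tgt (Fwd i) = i + 1" "tgt (Bwd i) = i" "tgt Loop = n"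
  by (simp_all add: T_quiver_double_def)

lemma walk_Nil: "walk u [] v \<longleftrightarrow> u = v \<and> u \<in> {1..n}"
  by (simp add: Q.awalk_Nil_iff verts_Q)

lemma walk_Cons: "walk u (e # p) v \<longleftrightarrow> e \<in> arrows \<and> u = src e \<and> walk (tgt e) p v"
  by (rule Q.awalk_Cons_iff)

lemma walk_append: "walk u (p @ q) w \<longleftrightarrow> (\<exists>v. walk u p v \<and> walk v q w)"
proof (induction p arbitrary: u)
  case Nil
  thus ?case using Q.awalk_hd_in_verts[of u q w] by (auto simp: walk_Nil verts_Q)
qed (auto simp: walk_Cons)

lemma walk_ends: "walk u p v \<Longrightarrow> u \<in> {1..n} \<and> v \<in> {1..n}"
  using Q.awalk_hd_in_verts Q.awalk_last_in_verts by (simp add: verts_Q)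

lemma walk_single: "walk u [e] v \<longleftrightarrow> e \<in> arrows \<and> u = src e \<and> v = tgt e"
  using Q.head_in_verts[of e] by (auto simp: walk_Cons walk_Nil verts_Q)

lemma arrow_type_I: "e \<in> arrows \<Longrightarrow> (src e, tgt e, 1) \<in> I"
  using arrow_I by (cases e) (auto simp: arrows_iff)

lemma walk_low: "walk u p v \<Longrightarrow> low (u, v, length p)"
proof (induction p arbitrary: u)
  case Nil
  thus ?case by (simp add: walk_Nil low_def)
next
  case (Cons e p)
  hence e: "e \<in> arrows" "u = src e" "low (tgt e, v, length p)" by (auto simp: walk_Cons)
  from low_join[OF I_low[OF arrow_type_I[OF e(1)]] e(3)] show ?case by (simp add: e)
qed

text \<open>
  One step away from \<open>v\<close> and back, on the side of \<open>n\<close>; at \<open>n\<close> itself, twice around the loop.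
\<close>
definition bounce :: "nat \<Rightarrow> T_arrow list" where
  "bounce v = (if v < n then [Fwd v, Bwd v] else [Loop, Loop])"

text \<open>
  The congruence generated by the vertex components of the relation, for walks instead of linear
  combinations; the component at the vertex 1 has a single term and enters in \<open>walk_null\<close>.
\<close>
inductive walk_eq :: "T_arrow list \<Rightarrow> T_arrow list \<Rightarrow> bool" where
  walk_eq_refl: "walk_eq p p"
| walk_eq_sym: "walk_eq p q \<Longrightarrow> walk_eq q p"
| walk_eq_trans: "walk_eq p q \<Longrightarrow> walk_eq q r \<Longrightarrow> walk_eq p r"
| walk_eq_context: "walk_eq p q \<Longrightarrow> walk_eq (r @ p @ s) (r @ q @ s)"
| walk_eq_bounce: "v \<in> {1..<n} \<Longrightarrow> walk_eq (bounce (Suc v)) [Bwd v, Fwd v]"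

inductive walk_null :: "T_arrow list \<Rightarrow> bool" where
  walk_null_bounce: "walk_null (bounce 1)"
| walk_null_context: "walk_null p \<Longrightarrow> walk_null (r @ p @ s)"
| walk_null_eq: "walk_null p \<Longrightarrow> walk_eq p q \<Longrightarrow> walk_null q"

lemma walk_eq_left: "walk_eq p q \<Longrightarrow> walk_eq (r @ p) (r @ q)"
  using walk_eq_context[of p q r "[]"] by simp
lemma walk_eq_right: "walk_eq p q \<Longrightarrow> walk_eq (p @ s) (q @ s)"
  using walk_eq_context[of p q "[]" s] by simp
lemma walk_null_left: "walk_null q \<Longrightarrow> walk_null (r @ q)"
  using walk_null_context[of q r "[]"] by simp
lemma walk_null_right: "walk_null q \<Longrightarrow> walk_null (q @ r)"
  using walk_null_context[of q "[]" r] by simp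

lemma walk_bounce: "walk u (bounce v) w \<longleftrightarrow> u = v \<and> w = v \<and> v \<in> {1..n}" if "1 \<le> v" "v \<le> n"
  using that by (auto simp: bounce_def walk_Cons walk_Nil arrows_iff)

lemma length_bounce [simp]: "length (bounce v) = 2"
  by (simp add: bounce_def)

lemma walk_eq_preserves:
  "walk_eq p q \<Longrightarrow> length p = length q \<and> (\<forall>u v. walk u p v \<longleftrightarrow> walk u q v)"
proof (induction rule: walk_eq.induct)
  case (walk_eq_bounce v)
  thus ?case by (auto simp: walk_bounce walk_Cons walk_Nil arrows_iff)
next
  case (walk_eq_context p q r s)
  thus ?case by (simp add: walk_append)
qed simp_all

definition bounces :: "nat \<Rightarrow> nat \<Rightarrow> T_arrow list" where
  "bounces v k = concat (replicate k (bounce v))"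

lemma bounces_0 [simp]: "bounces v 0 = []" by (simp add: bounces_def)
lemma bounces_1: "bounces v (Suc 0) = bounce v" by (simp add: bounces_def)
lemma bounces_Suc: "bounces v (Suc k) = bounce v @ bounces v k" by (simp add: bounces_def)
lemma bounces_add: "bounces v (j + k) = bounces v j @ bounces v k"
  by (simp add: bounces_def replicate_add)
lemma length_bounces [simp]: "length (bounces v k) = 2 * k"
  by (induction k) (simp_all add: bounces_Suc)
lemma walk_bounces: "v \<in> {1..n} \<Longrightarrow> walk v (bounces v k) v"
  by (induction k) (auto simp: bounces_Suc walk_Nil walk_append walk_bounce)

text \<open>
  Along \<open>a\<^sub>i\<close> or \<open>a\<^sub>i\<^sup>*\<close>, going back and forth over this same edge can be read at either end of it.
\<close>
lemma bounce_central:
  assumes "e \<in> arrows"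
  shows "walk_eq (bounce (src e) @ [e]) ([e] @ bounce (tgt e))"
proof (cases e)
  case (Fwd v)
  hence v: "v \<in> {1..<n}" using assms by (simp add: arrows_iff)
  have "walk_eq ([Fwd v] @ [Bwd v, Fwd v]) ([Fwd v] @ bounce (Suc v))"
    by (rule walk_eq_left[OF walk_eq_sym[OF walk_eq_bounce[OF v]]])
  thus ?thesis using v by (simp add: Fwd bounce_def)
next
  case (Bwd v)
  hence v: "v \<in> {1..<n}" using assms by (simp add: arrows_iff)
  have "walk_eq (bounce (Suc v) @ [Bwd v]) ([Bwd v, Fwd v] @ [Bwd v])"
    by (intro walk_eq_right walk_eq_bounce v)
  thus ?thesis using v by (simp add: Bwd bounce_def[of v])
next
  case Loop
  thus ?thesis by (simp add: bounce_def walk_eq_refl)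
qed

lemma bounce_walk: "walk u p v \<Longrightarrow> walk_eq (bounce u @ p) (p @ bounce v)"
proof (induction p arbitrary: u)
  case Nil
  thus ?case by (simp add: walk_Nil walk_eq_refl)
next
  case (Cons e p)
  hence e: "e \<in> arrows" "u = src e" "walk (tgt e) p v" by (auto simp: walk_Cons)
  have "walk_eq ((bounce (src e) @ [e]) @ p) (([e] @ bounce (tgt e)) @ p)"
    by (intro walk_eq_right bounce_central e)
  moreover have "walk_eq ([e] @ (bounce (tgt e) @ p)) ([e] @ (p @ bounce v))"
    by (intro walk_eq_left Cons.IH e)
  ultimately have "walk_eq (bounce u @ e # p) ([e] @ bounce (tgt e) @ p)"
      and "walk_eq ([e] @ bounce (tgt e) @ p) ((e # p) @ bounce v)"
    by (simp_all add: e)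
  thus ?case by (rule walk_eq_trans)
qed

lemma bounces_walk: "walk u p v \<Longrightarrow> walk_eq (bounces u k @ p) (p @ bounces v k)"
proof (induction k)
  case 0
  thus ?case by (simp add: walk_eq_refl)
next
  case (Suc k)
  have "walk_eq (bounce u @ (bounces u k @ p)) (bounce u @ (p @ bounces v k))"
    by (intro walk_eq_left Suc)
  moreover have "walk_eq ((bounce u @ p) @ bounces v k) ((p @ bounce v) @ bounces v k)"
    by (intro walk_eq_right bounce_walk Suc.prems)
  ultimately have "walk_eq (bounces u (Suc k) @ p) (bounce u @ p @ bounces v k)"
      and "walk_eq (bounce u @ p @ bounces v k) (p @ bounces v (Suc k))"
    by (simp_all add: bounces_Suc)
  thus ?case by (rule walk_eq_trans)
qed

text \<open>
  By centrality \<open>v + 1\<close> bounces at the vertex \<open>v + 1\<close> contain \<open>v\<close> bounces at the vertex \<open>v\<close>: use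
  one of them to step down to \<open>v\<close> and up again, and move the others in between.
\<close>
lemma bounces_null: "v \<in> {1..n} \<Longrightarrow> v \<le> k \<Longrightarrow> walk_null (bounces v k)"
proof (induction v arbitrary: k)
  case (Suc v)
  then obtain k' where k: "k = Suc k'" "v \<le> k'" by (cases k) auto
  show ?case
  proof (cases "v = 0")
    case True
    thus ?thesis unfolding k bounces_Suc
      using walk_null_right[OF walk_null_bounce] by simp
  next
    case False
    hence v: "v \<in> {1..<n}" using Suc.prems by auto
    have "walk v [Fwd v] (Suc v)" using v by (simp add: walk_single arrows_iff)
    hence "walk_eq (bounces v k' @ [Fwd v]) ([Fwd v] @ bounces (Suc v) k')"
      by (rule bounces_walk)
    moreover have "walk_null (bounces v k' @ [Fwd v])"
      using v k by (intro walk_null_right Suc.IH) auto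
    ultimately have "walk_null ([Bwd v] @ ([Fwd v] @ bounces (Suc v) k'))"
      by (rule walk_null_left[OF walk_null_eq, rotated])
    moreover have "walk_eq ([Bwd v, Fwd v] @ bounces (Suc v) k') (bounces (Suc v) k)"
      unfolding k bounces_Suc by (rule walk_eq_right[OF walk_eq_sym[OF walk_eq_bounce[OF v]]])
    ultimately show ?thesis using walk_null_eq by simp
  qed
qed auto

definition direct :: "nat \<Rightarrow> nat \<Rightarrow> T_arrow list" where
  "direct u v = (if u \<le> v then map Fwd [u..<v] else rev (map Bwd [v..<u]))"

lemma direct_Fwd: "u \<le> v \<Longrightarrow> direct u (Suc v) = direct u v @ [Fwd v]"
  by (simp add: direct_def)
lemma direct_Bwd: "v < u \<Longrightarrow> direct u v = direct u (Suc v) @ [Bwd v]"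
  by (auto simp: direct_def upt_conv_Cons)
lemma direct_self [simp]: "direct u u = []"
  by (simp add: direct_def)
lemma length_direct: "length (direct u v) = (if u \<le> v then v - u else u - v)"
  by (simp add: direct_def)

lemma walk_direct_up:
  assumes "1 \<le> u" "u \<le> v"
  shows "v \<le> n \<Longrightarrow> walk u (direct u v) v"
  using assms(2)
proof (induction v rule: dec_induct)
  case base
  thus ?case using assms by (simp add: walk_Nil)
next
  case (step v)
  thus ?case using assms by (simp add: direct_Fwd walk_append) (auto simp: walk_single arrows_iff)
qed

lemma walk_direct_down:
  assumes "u \<le> n" "v \<le> u"
  shows "1 \<le> v \<Longrightarrow> walk u (direct u v) v"
  using assms(2)
proof (induction v rule: inc_induct)
  case base
  thus ?case using assms by (simp add: walk_Nil)
next
  case (step v)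
  thus ?case using assms by (simp add: direct_Bwd[of v u] walk_append) (auto simp: walk_single arrows_iff)
qed

lemma walk_direct: "u \<in> {1..n} \<Longrightarrow> v \<in> {1..n} \<Longrightarrow> walk u (direct u v) v"
  using walk_direct_up[of u v] walk_direct_down[of u v] by (cases "u \<le> v") auto

text \<open>
  The shortest walk of given parity of the number of loops.
\<close>
definition shortest :: "bool \<Rightarrow> nat \<Rightarrow> nat \<Rightarrow> T_arrow list" where
  "shortest looped u v = (if looped then direct u n @ [Loop] @ direct n v else direct u v)"

lemma walk_shortest: "u \<in> {1..n} \<Longrightarrow> v \<in> {1..n} \<Longrightarrow> walk u (shortest b u v) v"
  using n_pos by (auto simp: shortest_def walk_append walk_Cons arrows_iff intro!: walk_direct exI[of _ n])

lemma length_shortest: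
  assumes "u \<in> {1..n}" "v \<in> {1..n}"
  shows "length (shortest b u v) = (if b then 2 * n + 1 - (u + v) else if u \<le> v then v - u else u - v)"
  using assms by (auto simp: shortest_def length_direct)

lemma parity_shortest:
  assumes "u \<in> {1..n}" "v \<in> {1..n}"
  shows "odd (length (shortest b u v) + u + v) \<longleftrightarrow> b"
proof -
  have "even (v - u + u + v)" if "u \<le> v" using that by simp
  moreover have "even (u - v + u + v)" if "\<not> u \<le> v"
  proof -
    have "u - v + u + v = 2 * u" using that by simp
    thus ?thesis by simp
  qed
  moreover have "odd (2 * n + 1 - (u + v) + u + v)"
    using assms by simp
  ultimately show ?thesis using assms by (auto simp only: length_shortest split: if_splits)
qed

text \<open>
  A further arrow either prolongs the shortest walk or turns its last arrow, or its loop, into a bounce.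
\<close>
lemma shortest_extend:
  assumes u: "u \<in> {1..n}" and e: "e \<in> arrows"
  shows "\<exists>b' k. walk_eq (shortest b u (src e) @ [e]) (shortest b' u (tgt e) @ bounces (tgt e) k)"
proof (cases e)
  case (Fwd v)
  hence v: "v \<in> {1..<n}" using e by (simp add: arrows_iff)
  show ?thesis
  proof (cases "\<not> b \<and> u \<le> v")
    case True
    hence "shortest b u v @ [Fwd v] = shortest False u (Suc v) @ bounces (Suc v) 0"
      by (simp add: shortest_def direct_Fwd)
    thus ?thesis using walk_eq_refl unfolding Fwd by (metis Suc_eq_plus1 src_simps(1) tgt_simps(1))
  next
    case False
    hence "shortest b u v @ [Fwd v] = shortest b u (Suc v) @ [Bwd v, Fwd v]"
      using v by (auto simp: shortest_def direct_Bwd[of v])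
    moreover have "walk_eq (shortest b u (Suc v) @ [Bwd v, Fwd v]) (shortest b u (Suc v) @ bounces (Suc v) 1)"
      using v by (auto simp: bounces_1 intro!: walk_eq_left walk_eq_sym[OF walk_eq_bounce])
    ultimately show ?thesis unfolding Fwd by (metis Suc_eq_plus1 src_simps(1) tgt_simps(1))
  qed
next
  case (Bwd v)
  hence v: "v \<in> {1..<n}" using e by (simp add: arrows_iff)
  show ?thesis
  proof (cases "\<not> b \<and> u \<le> v")
    case True
    hence "shortest b u (Suc v) @ [Bwd v] = shortest b u v @ bounces v 1"
      using v by (simp add: shortest_def direct_Fwd bounces_1 bounce_def)
    thus ?thesis using walk_eq_refl unfolding Bwd by (metis Suc_eq_plus1 src_simps(2) tgt_simps(2))
  next
    case False
    hence "shortest b u (Suc v) @ [Bwd v] = shortest b u v @ bounces v 0"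
      using v by (auto simp: shortest_def direct_Bwd[of v])
    thus ?thesis using walk_eq_refl unfolding Bwd by (metis Suc_eq_plus1 src_simps(2) tgt_simps(2))
  qed
next
  case Loop
  have "shortest b u n @ [Loop] = (if b then shortest False u n @ bounces n 1 else shortest True u n @ bounces n 0)"
    by (simp add: shortest_def bounces_1 bounce_def)
  thus ?thesis using walk_eq_refl unfolding Loop by (metis src_simps(3) tgt_simps(3))
qed

lemma walk_eq_shortest: "walk u p v \<Longrightarrow> \<exists>b k. walk_eq p (shortest b u v @ bounces v k)"
proof (induction p arbitrary: v rule: rev_induct)
  case Nil
  hence "[] = shortest False u v @ bounces v 0" by (simp add: walk_Nil shortest_def)
  thus ?case using walk_eq_refl by metis
next
  case (snoc e p)
  then obtain w where p: "walk u p w" and e: "walk w [e] v" by (auto simp: walk_append)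
  hence e': "e \<in> arrows" "w = src e" "v = tgt e" by (auto simp: walk_single)
  obtain b k where 1: "walk_eq p (shortest b u w @ bounces w k)" using snoc.IH[OF p] by blast
  obtain b' j where 2: "walk_eq (shortest b u w @ [e]) (shortest b' u v @ bounces v j)"
    using shortest_extend[of u e b] e' walk_ends[OF p] by blast
  have "walk_eq (p @ [e]) (shortest b u w @ (bounces w k @ [e]))"
    using walk_eq_right[OF 1, of "[e]"] by simp
  moreover have "walk_eq (shortest b u w @ (bounces w k @ [e])) (shortest b u w @ ([e] @ bounces v k))"
    by (intro walk_eq_left bounces_walk e)
  moreover have "walk_eq ((shortest b u w @ [e]) @ bounces v k) ((shortest b' u v @ bounces v j) @ bounces v k)"
    by (intro walk_eq_right 2)
  ultimately have "walk_eq (p @ [e]) (shortest b' u v @ bounces v (j + k))"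
    unfolding bounces_add append_assoc using walk_eq_trans by blast
  thus ?case by blast
qed

text \<open>
  For a type that is not in \<open>low\<close> the difference truncates and the value is meaningless.
\<close>
definition normal_form :: "walk_type \<Rightarrow> T_arrow list" where
  "normal_form = (\<lambda>(u, v, d). let s = shortest (odd (d + u + v)) u v in s @ bounces v ((d - length s) div 2))"

lemma normal_form_unique:
  assumes "u \<in> {1..n}" "v \<in> {1..n}" and d: "d = length (shortest b u v) + 2 * k"
  shows "normal_form (u, v, d) = shortest b u v @ bounces v k"
proof -
  have "odd (d + u + v) = b" using parity_shortest[OF assms(1,2), of b] by (simp add: d)
  thus ?thesis by (simp add: normal_form_def d)
qed

lemma normal_form_low:
  assumes "low (u, v, d)"
  shows "\<exists>k. d = length (shortest (odd (d + u + v)) u v) + 2 * k"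
proof -
  have uv: "u \<in> {1..n}" "v \<in> {1..n}" using assms by (auto simp: low_def)
  let ?s = "length (shortest (odd (d + u + v)) u v)"
  have "odd (?s + u + v) \<longleftrightarrow> odd (d + u + v)" by (rule parity_shortest[OF uv])
  moreover have "?s \<le> d" using assms uv by (auto simp: length_shortest low_def split: if_splits)
  ultimately have "even (d - ?s)" by auto
  thus ?thesis using \<open>?s \<le> d\<close> by (metis dvdE le_add_diff_inverse)
qed

lemma walk_normal_form:
  assumes "(u, v, d) \<in> I"
  shows "walk u (normal_form (u, v, d)) v" "length (normal_form (u, v, d)) = d"
proof -
  have uv: "u \<in> {1..n}" "v \<in> {1..n}" using I_vertices[OF assms] by auto
  obtain k where k: "d = length (shortest (odd (d + u + v)) u v) + 2 * k"
    using normal_form_low[OF I_low[OF assms]] by blast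
  have nf: "normal_form (u, v, d) = shortest (odd (d + u + v)) u v @ bounces v k"
    by (rule normal_form_unique[OF uv k])
  show "walk u (normal_form (u, v, d)) v"
    unfolding nf using walk_shortest[OF uv] walk_bounces[OF uv(2)] by (auto simp: walk_append)
  show "length (normal_form (u, v, d)) = d" unfolding nf using k by simp
qed

text \<open>
  Rewrite to a shortest walk followed by \<open>k\<close> bounces. The length determines \<open>k\<close>, and the type violates
  \<open>high\<close> if and only if \<open>k\<close> reaches the source or the target; bounces can be moved to that end, where
  they vanish.
\<close>
theorem walk_classification:
  assumes p: "walk u p v"
  shows "if (u, v, length p) \<in> I then walk_eq p (normal_form (u, v, length p)) else walk_null p"
proof -
  have uv: "u \<in> {1..n}" "v \<in> {1..n}" using walk_ends[OF p] by auto
  obtain b k where 1: "walk_eq p (shortest b u v @ bounces v k)" using walk_eq_shortest[OF p] by blast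
  have len: "length p = length (shortest b u v) + 2 * k" using walk_eq_preserves[OF 1] by simp
  show ?thesis
  proof (cases "(u, v, length p) \<in> I")
    case True
    thus ?thesis using 1 normal_form_unique[OF uv len] by simp
  next
    case False
    hence h: "\<not> high (u, v, length p)" using walk_low[OF p] by (simp add: I_def)
    have par: "odd (length p + u + v) \<longleftrightarrow> b" using parity_shortest[OF uv, of b] by (simp add: len)
    have "u \<le> k \<or> v \<le> k"
    proof (cases b)
      case True
      hence "length p + (u + v) = 2 * n + 1 + 2 * k" using len uv by (simp add: length_shortest)
      moreover have "\<not> (length p + u + 1 \<le> 2 * n + v \<and> length p + v + 1 \<le> 2 * n + u)"
        using h par True by (simp add: high_def)
      ultimately show ?thesis by linarith
    next
      case False
      hence "length p = (if u \<le> v then v - u else u - v) + 2 * k" using len uv by (simp add: length_shortest)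
      moreover have "\<not> length p + 2 \<le> u + v"
        using h par False by (simp add: high_def)
      ultimately show ?thesis by (auto split: if_splits)
    qed
    hence "walk_null (shortest b u v @ bounces v k)"
    proof
      assume "u \<le> k"
      hence "walk_null (bounces u k @ shortest b u v)"
        by (intro walk_null_right bounces_null uv)
      thus ?thesis using walk_null_eq bounces_walk[OF walk_shortest[OF uv]] by blast
    next
      assume "v \<le> k"
      thus ?thesis by (intro walk_null_left bounces_null uv)
    qed
    thus ?thesis using False walk_null_eq[OF _ walk_eq_sym[OF 1]] by simp
  qed
qed

text \<open>
  Conversely, the relations never kill an admissible type, because the bounce at the vertex 1
  is not admissible and factors of admissible types are admissible.
\<close>
lemma walk_null_not_I: "walk_null p \<Longrightarrow> walk u p v \<Longrightarrow> (u, v, length p) \<notin> I"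
proof (induction arbitrary: u v rule: walk_null.induct)
  case walk_null_bounce
  thus ?case using n_pos by (auto simp: walk_bounce I_def high_def)
next
  case (walk_null_context p r s)
  then obtain w x where w: "walk u r w" "walk w p x" "walk x s v" by (auto simp: walk_append)
  show ?case
  proof
    assume "(u, v, length (r @ p @ s)) \<in> I"
    hence "(w, v, length p + length s) \<in> I"
      using I_factors(2)[of u w "length r" v "length p + length s"] walk_low[OF w(1)]
         low_join[OF walk_low[OF w(2)] walk_low[OF w(3)]] by simp
    hence "(w, x, length p) \<in> I"
      using I_factors(1) walk_low w by blast
    thus False using walk_null_context.IH[OF w(2)] by simp
  qed
next
  case (walk_null_eq p q)
  thus ?case using walk_eq_preserves by metis
qed

end

section \<open>Extending a cocycle along walks\<close>

context type_T
begin

lemma linear_star: "linear_map f \<Longrightarrow> linear_map (\<lambda>x. y \<star> f x)" "linear_map f \<Longrightarrow> linear_map (\<lambda>x. f x \<star> y)"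
  by (simp_all add: linear_map_def star_simps star_scl)

lemma linear_add: "linear_map f \<Longrightarrow> linear_map g \<Longrightarrow> linear_map (\<lambda>x. f x + g x)"
  by (simp add: linear_map_def scl_add algebra_simps)
lemma linear_diff: "linear_map f \<Longrightarrow> linear_map g \<Longrightarrow> linear_map (\<lambda>x. f x - g x)"
  by (simp add: linear_map_def scl_diff algebra_simps)
lemma linear_sum: "(\<And>i. i \<in> S \<Longrightarrow> linear_map (f i)) \<Longrightarrow> linear_map (\<lambda>x. \<Sum>i\<in>S. f i x)"
  by (simp add: linear_map_def scl_sum sum.distrib)

lemma coboundary_bilinear:
  assumes "linear_map f"
  shows "bilinear_map (coboundary f)"
  unfolding bilinear_map_def linear_map_def coboundary_def
  by (simp add: linear_map_add[OF assms] linear_map_scl[OF assms] star_simps star_scl scl_add scl_diff)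

lemma coboundary_cocycle:
  assumes "linear_map f"
  shows "hochschild2 (coboundary f) x y z = 0"
  by (simp add: hochschild2_def coboundary_def star_simps star_assoc)

lemma coboundary_in_M: "(\<And>x. f x \<in> M) \<Longrightarrow> coboundary f x y \<in> M"
  by (simp add: coboundary_def)

lemma bilinear_diff: "bilinear_map b \<Longrightarrow> bilinear_map c \<Longrightarrow> bilinear_map (\<lambda>x y. b x y - c x y)"
  by (simp add: bilinear_map_def linear_diff)

lemma hochschild2_diff: "hochschild2 (\<lambda>x y. b x y - c x y) x y z = hochschild2 b x y z - hochschild2 c x y z"
  by (simp add: hochschild2_def star_simps)

lemma M_expansion:
  assumes "x \<in> M"
  shows "x = (\<Sum>a\<in>I. scl (x a) (ev a))"
proof (rule ext)
  fix r
  have "(\<Sum>a\<in>I. scl (x a) (ev a)) r = (\<Sum>a\<in>I. if a = r then x r else 0)"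
    unfolding sum_fun_apply by (rule sum.cong) (auto simp: ev_def)
  thus "x r = (\<Sum>a\<in>I. scl (x a) (ev a)) r"
    using assms by (cases r) (auto simp: finite_I M_def)
qed

lemma linear_map_expansion:
  assumes "linear_map f" "x \<in> M"
  shows "f x = (\<Sum>a\<in>I. scl (x a) (f (ev a)))"
  by (subst M_expansion[OF assms(2)]) (simp add: linear_map_sum[OF assms(1)] linear_map_scl[OF assms(1)])

lemma bilinear_map_eqI:
  assumes b: "bilinear_map b" and c: "bilinear_map c"
    and eq: "\<And>x y. x \<in> I \<Longrightarrow> y \<in> I \<Longrightarrow> b (ev x) (ev y) = c (ev x) (ev y)" 
    and x: "x \<in> M" and y: "y \<in> M"
  shows "b x y = c x y"
proof -
  have "b (ev a) y = c (ev a) y" if "a \<in> I" for a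
    using linear_map_expansion[OF bilinear_map_right[OF b] y, of "ev a"]
      linear_map_expansion[OF bilinear_map_right[OF c] y, of "ev a"] eq[OF that]
    by simp
  thus ?thesis
    using linear_map_expansion[OF bilinear_map_left[OF b, of y] x] 
       linear_map_expansion[OF bilinear_map_left[OF c, of y] x] by simp
qed

text \<open>
  The usual averaging over the separable subalgebra spanned by the vertex idempotents: contract the
  cocycle identity with \<open>\<Sum>i. e\<^sub>i \<otimes> e\<^sub>i\<close> on the left.
\<close>
lemma normalize_cocycle_left:
  assumes c: "bilinear_map c" "\<And>x y z. hochschild2 c x y z = 0" "\<And>x y. c x y \<in> M"
  shows "\<exists>h. linear_map h \<and> (\<forall>x. h x \<in> M) \<and> (\<forall>j\<in>{1..n}. \<forall>y. c (idem j) y = coboundary h (idem j) y)"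
proof -
  define h where "h = (\<lambda>y. \<Sum>i\<in>{1..n}. idem i \<star> c (idem i) y)"
  have "linear_map h" unfolding h_def
    by (intro linear_sum linear_star bilinear_map_right c)
  moreover have "h x \<in> M" for x by (simp add: h_def)
  moreover have "c (idem j) y = coboundary h (idem j) y" if j: "j \<in> {1..n}" for j y
  proof -
    have l0: "c 0 y = 0" for y using linear_map_zero[OF bilinear_map_left[OF c(1), of y]] by simp
    have "0 = (\<Sum>i\<in>{1..n}. idem i \<star> hochschild2 c (idem i) (idem j) y)" by (simp add: c)
    also have "\<dots> = (\<Sum>i\<in>{1..n}. idem i \<star> (idem i \<star> c (idem j) y)) - (\<Sum>i\<in>{1..n}. idem i \<star> c (idem i \<star> idem j) y)
        + h (idem j \<star> y) - h (idem j) \<star> y"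
      by (simp add: hochschild2_def star_simps sum_subtractf sum.distrib h_def star_assoc star_sum_left)
    also have "(\<Sum>i\<in>{1..n}. idem i \<star> (idem i \<star> c (idem j) y)) = (\<Sum>i\<in>{1..n}. idem i \<star> c (idem j) y)"
      by (intro sum.cong refl) (simp add: star_assoc[symmetric] idem_star_idem)
    also have "\<dots> = c (idem j) y" by (simp only: sum_idem_star restr_id[OF c(3)])
    also have "(\<Sum>i\<in>{1..n}. idem i \<star> c (idem i \<star> idem j) y) = (\<Sum>i\<in>{1..n}. if i = j then idem j \<star> c (idem j) y else 0)"
      using j by (intro sum.cong refl) (simp add: idem_star_idem l0)
    also have "\<dots> = idem j \<star> c (idem j) y" using j by simp
    also have "idem j \<star> c (idem j) y = idem j \<star> h y"
    proof -
      have "idem j \<star> h y = (\<Sum>i\<in>{1..n}. if i = j then idem j \<star> c (idem j) y else 0)"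
        unfolding h_def star_sum_right using j
        by (intro sum.cong refl) (simp add: star_assoc[symmetric] idem_star_idem)
      thus ?thesis using j by simp
    qed
    finally show ?thesis by (simp add: coboundary_def algebra_simps)
  qed
  ultimately show ?thesis by blast
qed

text \<open>
  The same on the right; the last clause says that the correction keeps the normalization already
  achieved on the left.
\<close>
lemma normalize_cocycle_right:
  assumes c: "bilinear_map c" "\<And>x y z. hochschild2 c x y z = 0" "\<And>x y. c x y \<in> M"
    and left: "\<And>j y. j \<in> {1..n} \<Longrightarrow> c (idem j) y = 0"
  shows "\<exists>h. linear_map h \<and> (\<forall>x. h x \<in> M) \<and> (\<forall>j\<in>{1..n}. \<forall>x. c x (idem j) = coboundary h x (idem j))
    \<and> (\<forall>j\<in>{1..n}. \<forall>x. coboundary h (idem j) x = 0)"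
proof -
  define h where "h = (\<lambda>x. \<Sum>i\<in>{1..n}. c x (idem i) \<star> idem i)"
  have lin: "linear_map h" unfolding h_def
    by (intro linear_sum linear_star bilinear_map_left c)
  moreover have "h x \<in> M" for x by (simp add: h_def)
  moreover have "c x (idem j) = coboundary h x (idem j)" if j: "j \<in> {1..n}" for j x
  proof -
    have r0: "c x 0 = 0" for x using linear_map_zero[OF bilinear_map_right[OF c(1), of x]] by simp
    have "0 = (\<Sum>i\<in>{1..n}. hochschild2 c x (idem j) (idem i) \<star> idem i)" by (simp add: c)
    also have "\<dots> = x \<star> h (idem j) - h (x \<star> idem j) + (\<Sum>i\<in>{1..n}. c x (idem j \<star> idem i) \<star> idem i)
         - (\<Sum>i\<in>{1..n}. c x (idem j) \<star> idem i \<star> idem i)"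
      by (simp add: hochschild2_def star_simps sum_subtractf sum.distrib h_def star_assoc star_sum_right)
    also have "(\<Sum>i\<in>{1..n}. c x (idem j) \<star> idem i \<star> idem i) = (\<Sum>i\<in>{1..n}. c x (idem j) \<star> idem i)"
      by (intro sum.cong refl) (simp add: star_assoc idem_star_idem)
    also have "\<dots> = c x (idem j)" by (simp only: sum_star_idem restr_id[OF c(3)])
    also have "(\<Sum>i\<in>{1..n}. c x (idem j \<star> idem i) \<star> idem i) = (\<Sum>i\<in>{1..n}. if i = j then c x (idem j) \<star> idem j else 0)"
      using j by (intro sum.cong refl) (auto simp: idem_star_idem r0)
    also have "\<dots> = c x (idem j) \<star> idem j" using j by simp
    also have "\<dots> = h x \<star> idem j"
    proof -
      have "h x \<star> idem j = (\<Sum>i\<in>{1..n}. if i = j then c x (idem j) \<star> idem j else 0)"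
        unfolding h_def star_sum_left using j
        by (intro sum.cong refl) (simp add: star_assoc idem_star_idem)
      thus ?thesis using j by simp
    qed
    finally show ?thesis by (simp add: coboundary_def algebra_simps)
  qed
  moreover have "coboundary h (idem j) x = 0" if j: "j \<in> {1..n}" for j x
  proof -
    have "h (idem j \<star> x) = idem j \<star> h x"
    proof -
      have "c (idem j \<star> x) (idem i) = idem j \<star> c x (idem i)" for i
        using c(2)[of "idem j" x "idem i"] left[OF j] by (simp add: hochschild2_def algebra_simps)
      thus ?thesis by (simp add: h_def star_sum_right star_assoc)
    qed
    moreover have "h (idem j) = 0" using left[OF j] by (simp add: h_def)
    ultimately show ?thesis by (simp add: coboundary_def)
  qed
  ultimately show ?thesis by blast
qed

end

text \<open>
  A normalized cocycle \<open>c\<close> and candidate values \<open>g\<close>, on the arrows, of a map whose coboundary is \<open>c\<close>.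
\<close>
locale walk_lift = type_T +
  fixes c :: "(walk_type \<Rightarrow> complex) \<Rightarrow> (walk_type \<Rightarrow> complex) \<Rightarrow> walk_type \<Rightarrow> complex"
    and g :: "T_arrow \<Rightarrow> walk_type \<Rightarrow> complex"
  assumes bilinear: "bilinear_map c"
    and cocycle: "hochschild2 c x y z = 0"
    and in_M: "c x y \<in> M"
    and normal_left: "j \<in> {1..n} \<Longrightarrow> c (idem j) y = 0"
    and normal_right: "j \<in> {1..n} \<Longrightarrow> c x (idem j) = 0"
    and g_left: "e \<in> arcs (T_quiver_double n) \<Longrightarrow> idem (head (T_quiver_double n) e) \<star> g e = g e"
    and g_right: "e \<in> arcs (T_quiver_double n) \<Longrightarrow> g e \<star> idem (tail (T_quiver_double n) e) = g e"
begin

text \<open>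
  The only possible value of such a map on the walk: \<open>f (x y) = x f(y) + f(x) y - c x y\<close>, where \<open>y\<close> is the
  first arrow and \<open>x\<close> is the rest. The first argument is the target of the walk.
\<close>
fun lift :: "nat \<Rightarrow> T_arrow list \<Rightarrow> walk_type \<Rightarrow> complex" where
  "lift v [] = 0"
| "lift v (e # p) = ev (tgt e, v, length p) \<star> g e + lift v p \<star> ev (src e, tgt e, 1)
     - c (ev (tgt e, v, length p)) (ev (src e, tgt e, 1))"

lemma idem_star_left: "j \<in> {1..n} \<Longrightarrow> c (idem j \<star> x) y = idem j \<star> c x y"
  using cocycle[of "idem j" x y] by (simp add: hochschild2_def normal_left algebra_simps)

lemma idem_star_right: "j \<in> {1..n} \<Longrightarrow> c x (y \<star> idem j) = c x y \<star> idem j"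
  using cocycle[of x y "idem j"] by (simp add: hochschild2_def normal_right algebra_simps)

lemma idem_balanced: "j \<in> {1..n} \<Longrightarrow> c (x \<star> idem j) y = c x (idem j \<star> y)"
  using cocycle[of x "idem j" y] by (simp add: hochschild2_def normal_left normal_right algebra_simps)

lemma low_vertices: "low (u, v, d) \<Longrightarrow> u \<in> {1..n} \<and> v \<in> {1..n}"
  by (simp add: low_def)

lemma idem_star_ev: "low (u, v, d) \<Longrightarrow> idem v \<star> ev (u, v, d) = ev (u, v, d)"
  using ev_star_ev[of v v 0 u d] I_low[OF idem_I[of v]] low_vertices[of u v d] by (simp add: idem_def)

lemma ev_star_idem: "low (u, v, d) \<Longrightarrow> ev (u, v, d) \<star> idem u = ev (u, v, d)"
  using ev_star_ev[of u v d u 0] I_low[OF idem_I[of u]] low_vertices[of u v d] by (simp add: idem_def)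

lemma lift_in_M [simp]: "lift v p \<in> M"
  by (cases p) (simp_all add: in_M)

lemma low_step:
  assumes "walk u (e # p) v"
  shows "e \<in> arrows" "u = src e" "walk (tgt e) p v" "low (tgt e, v, length p)" "low (src e, tgt e, 1)"
    "src e \<in> {1..n}" "v \<in> {1..n}"
  using assms walk_low[of "tgt e" p v] walk_ends[OF assms] I_low[OF arrow_type_I[of e]] by (auto simp: walk_Cons)

lemma lift_ends:
  "walk u p v \<Longrightarrow> lift v p \<star> idem u = lift v p \<and> idem v \<star> lift v p = lift v p"
proof (induction p arbitrary: u)
  case (Cons e p)
  note e = low_step[OF Cons.prems]
  have "lift v (e # p) \<star> idem u = lift v (e # p)"
    using idem_star_right[OF e(6), symmetric] ev_star_idem[OF e(5)] g_right[OF e(1)]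
    by (simp add: star_simps star_assoc e(2) del: One_nat_def)
  moreover have "idem v \<star> lift v (e # p) = lift v (e # p)"
    using Cons.IH[OF e(3)] idem_star_left[OF e(7), symmetric] idem_star_ev[OF e(4)]
    by (simp add: star_simps star_assoc[symmetric] del: One_nat_def)
  ultimately show ?case by simp
qed simp

text \<open>
  The rule holds for an arbitrary decomposition, not only after the first arrow: this is the cocycle
  identity for \<open>p\<close>, \<open>q\<close> and the first arrow.
\<close>
lemma lift_append:
  "walk u q v \<Longrightarrow> walk v p w \<Longrightarrow> lift w (q @ p) = ev (v, w, length p) \<star> lift v q
     + lift w p \<star> ev (u, v, length q) - c (ev (v, w, length p)) (ev (u, v, length q))"
proof (induction q arbitrary: u)
  case Nil
  hence "u = v" "u \<in> {1..n}" by (auto simp: walk_Nil)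
  moreover have "ev (v, v, 0) = idem v" by (simp add: idem_def)
  ultimately show ?case using lift_ends[OF Nil(2)] by (simp add: normal_right)
next
  case (Cons e q)
  note e = low_step[OF Cons.prems(1)]
  define P where "P = ev (v, w, length p)"
  define K where "K = ev (tgt e, v, length q)"
  define E where "E = ev (src e, tgt e, 1)"
  have PK: "ev (tgt e, w, length q + length p) = P \<star> K"
    unfolding P_def K_def using walk_low[OF Cons.prems(2)] e by (simp add: ev_star_ev)
  have KE: "ev (src e, v, Suc (length q)) = K \<star> E"
    unfolding E_def K_def using ev_star_ev[OF e(4,5)] by simp
  have IH: "lift w (q @ p) = P \<star> lift v q + lift w p \<star> K - c P K"
    unfolding P_def K_def using Cons.IH[OF e(3) Cons.prems(2)] .
  have "c (P \<star> K) E = P \<star> c K E + c P (K \<star> E) - c P K \<star> E"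
    using cocycle[of P K E] by (simp add: hochschild2_def algebra_simps)
  thus ?case
    unfolding append_Cons lift.simps length_append PK IH length_Cons e(2) KE
    by (simp add: K_def[symmetric] E_def[symmetric] P_def[symmetric] star_simps star_assoc algebra_simps del: One_nat_def)
qed

lemma lift_single: "e \<in> arrows \<Longrightarrow> lift (tgt e) [e] = g e"
  using I_low[OF arrow_type_I[of e]] 
  by (simp add: idem_def[symmetric] g_left normal_left low_def)

lemma lift_pair:
  assumes "e \<in> arrows" "f \<in> arrows" "tgt e = src f"
  shows "lift (tgt f) [e, f] = ev (src f, tgt f, 1) \<star> g e + g f \<star> ev (src e, tgt e, 1)
     - c (ev (src f, tgt f, 1)) (ev (src e, tgt e, 1))"
proof -
  have "walk (src e) [e] (tgt e)" "walk (tgt e) [f] (tgt f)"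
    using assms by (simp_all add: walk_single)
  from lift_append[OF this] show ?thesis
    using assms lift_single[OF assms(1)] lift_single[OF assms(2)] by simp
qed

end

text \<open>
  The candidate is compatible with the relations as soon as it is compatible with those at the
  vertices.
\<close>
locale walk_lift_relations = walk_lift +
  assumes lift_bounce: "v \<in> {1..<n} \<Longrightarrow> lift (Suc v) (bounce (Suc v)) = lift (Suc v) [Bwd v, Fwd v]"
    and lift_bounce_1: "lift 1 (bounce 1) = 0"
begin

lemma lift_walk_eq: "walk_eq p q \<Longrightarrow> walk u p v \<Longrightarrow> lift v p = lift v q"
proof (induction arbitrary: u v rule: walk_eq.induct)
  case (walk_eq_sym p q)
  thus ?case using walk_eq_preserves by metis
next
  case (walk_eq_trans p q r)
  thus ?case using walk_eq_preserves by metis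
next
  case (walk_eq_context p q r s)
  then obtain w x where w: "walk u r w" "walk w p x" "walk x s v" by (auto simp: walk_append)
  have q: "walk w q x" "length q = length p"
    using walk_eq_preserves[OF walk_eq_context.hyps] w by auto
  have "walk w (p @ s) v" "walk w (q @ s) v" using w q by (auto simp: walk_append)
  thus ?case using lift_append[OF w(1)] lift_append[OF w(2,3)] lift_append[OF q(1) w(3)]
      walk_eq_context.IH[OF w(2)] q(2) by simp
next
  case (walk_eq_bounce w)
  hence "v = Suc w" by (auto simp: walk_bounce)
  thus ?case using lift_bounce walk_eq_bounce by simp
qed simp

lemma lift_walk_null: "walk_null p \<Longrightarrow> walk u p v \<Longrightarrow> lift v p = 0"
proof (induction arbitrary: u v rule: walk_null.induct)
  case walk_null_bounce
  hence "v = 1" using n_pos by (auto simp: walk_bounce)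
  thus ?case using lift_bounce_1 by simp
next
  case (walk_null_context p r s)
  then obtain w x where w: "walk u r w" "walk w p x" "walk x s v" by (auto simp: walk_append)
  have z: "c 0 y = 0" "c y 0 = 0" for y
    using linear_map_zero[OF bilinear_map_left[OF bilinear, of y]] linear_map_zero[OF bilinear_map_right[OF bilinear, of y]]
    by simp_all
  have ps: "walk w (p @ s) v" using w by (auto simp: walk_append)
  have np: "ev (w, x, length p) = 0" by (rule ev_eq_0[OF walk_null_not_I[OF walk_null_context.hyps w(2)]])
  have "walk_null (p @ s)" by (rule walk_null_right[OF walk_null_context.hyps])
  hence nps: "ev (w, v, length p + length s) = 0" using ev_eq_0[OF walk_null_not_I[OF _ ps]] by simp
  have "lift v (p @ s) = 0"
    using lift_append[OF w(2,3)] walk_null_context.IH[OF w(2)] np by (simp add: z)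
  thus ?case using lift_append[OF w(1) ps] nps by (simp add: z)
next
  case (walk_null_eq p q)
  thus ?case using walk_eq_preserves lift_walk_eq by metis
qed

text \<open>
  Representatives do not matter by \<open>lift_walk_eq\<close>, and inadmissible types have value 0 by \<open>lift_walk_null\<close>.
\<close>
definition primitive :: "(walk_type \<Rightarrow> complex) \<Rightarrow> walk_type \<Rightarrow> complex" where
  "primitive x = (\<Sum>a\<in>I. scl (x a) (lift (fst (snd a)) (normal_form a)))"

lemma primitive_linear: "linear_map primitive"
  unfolding linear_map_def primitive_def
  by (auto simp: fun_eq_iff sum_fun_apply pointwise algebra_simps sum.distrib sum_distrib_left)

lemma primitive_in_M: "primitive x \<in> M"
  by (simp add: primitive_def)

lemma primitive_walk:
  assumes "walk u p v"
  shows "primitive (ev (u, v, length p)) = lift v p"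
proof (cases "(u, v, length p) \<in> I")
  case True
  have "primitive (ev (u, v, length p)) = (\<Sum>a\<in>I. if a = (u, v, length p) then lift v (normal_form a) else 0)"
    unfolding primitive_def using True by (intro sum.cong refl) (auto simp: ev_def)
  also have "\<dots> = lift v (normal_form (u, v, length p))" using True by (simp add: finite_I)
  also have "\<dots> = lift v p"
    using walk_classification[OF assms] True lift_walk_eq[OF _ assms] by simp
  finally show ?thesis .
next
  case False
  thus ?thesis
    using walk_classification[OF assms] lift_walk_null[OF _ assms]
    by (simp add: ev_eq_0 linear_map_zero[OF primitive_linear])
qed

text \<open>
  For composable basis elements this is \<open>lift_append\<close> for their normal forms. For the others both
  sides vanish, because the cocycle is balanced over the idempotents.
\<close>
lemma primitive_coboundary:
  assumes "x \<in> M" "y \<in> M"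
  shows "c x y = coboundary primitive x y"
proof (rule bilinear_map_eqI[OF bilinear coboundary_bilinear[OF primitive_linear] _ assms])
  fix a b assume ab: "a \<in> I" "b \<in> I"
  obtain v w e where a: "a = (v, w, e)" by (cases a)
  obtain u v' d where b: "b = (u, v', d)" by (cases b)
  note nf = walk_normal_form[OF ab(1)[unfolded a]] walk_normal_form[OF ab(2)[unfolded b]]
  have pa: "primitive (ev a) = lift w (normal_form a)" and pb: "primitive (ev b) = lift v' (normal_form b)"
    using primitive_walk[OF nf(1)] primitive_walk[OF nf(3)] nf by (simp_all add: a b)
  show "c (ev a) (ev b) = coboundary primitive (ev a) (ev b)"
  proof (cases "v' = v")
    case True
    have "ev a \<star> ev b = ev (u, w, d + e)"
      using I_low[OF ab(1)] I_low[OF ab(2)] by (simp add: a b True ev_star_ev)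
    moreover have "walk u (normal_form b @ normal_form a) w"
      using nf by (auto simp: a b True walk_append)
    ultimately have "primitive (ev a \<star> ev b) = lift w (normal_form b @ normal_form a)"
      using primitive_walk[of u "normal_form b @ normal_form a" w] nf by (simp add: a b)
    also have "\<dots> = ev a \<star> lift v' (normal_form b) + lift w (normal_form a) \<star> ev b - c (ev a) (ev b)"
      using lift_append[of u "normal_form b" v "normal_form a" w] nf by (simp add: a b True)
    finally show ?thesis by (simp add: coboundary_def pa pb)
  next
    case False
    have v: "v \<in> {1..n}" "v' \<in> {1..n}" using I_vertices ab by (auto simp: a b)
    have 1: "ev a \<star> idem v = ev a" "idem v' \<star> ev b = ev b"
      using ev_star_idem idem_star_ev I_low ab by (auto simp: a b)
    have 2: "idem v \<star> idem v' = 0" using v False by (simp add: idem_star_idem)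
    have "idem v' \<star> primitive (ev b) = primitive (ev b)" "primitive (ev a) \<star> idem v = primitive (ev a)"
      using lift_ends[OF nf(3)] lift_ends[OF nf(1)] unfolding pa pb unfolding a b by simp_all
    note 5 = this
    have "ev a \<star> primitive (ev b) = (ev a \<star> idem v) \<star> (idem v' \<star> primitive (ev b))"
      by (simp only: 1 5)
    also have "\<dots> = ev a \<star> (idem v \<star> idem v') \<star> primitive (ev b)" by (simp only: star_assoc)
    finally have 3: "ev a \<star> primitive (ev b) = 0" by (simp add: 2)
    have "primitive (ev a) \<star> ev b = (primitive (ev a) \<star> idem v) \<star> (idem v' \<star> ev b)"
      by (simp only: 1 5)
    also have "\<dots> = primitive (ev a) \<star> (idem v \<star> idem v') \<star> ev b" by (simp only: star_assoc)
    finally have 4: "primitive (ev a) \<star> ev b = 0" by (simp add: 2)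
    have 0: "ev a \<star> ev b = 0" using False by (auto simp: a b ev_star_ev_distinct)
    have "c (ev a) (ev b) = c (ev a \<star> idem v) (ev b)" by (simp add: 1)
    also have "\<dots> = c (ev a) (idem v \<star> (idem v' \<star> ev b))" using idem_balanced[OF v(1), of "ev a" "ev b"] 1 by simp
    also have "\<dots> = c (ev a) ((idem v \<star> idem v') \<star> ev b)" by (simp only: star_assoc)
    also have "\<dots> = 0" using linear_map_zero[OF bilinear_map_right[OF bilinear]] by (simp add: 2)
    finally show ?thesis by (simp add: coboundary_def 0 3 4 linear_map_zero[OF primitive_linear])
  qed
qed

end

section \<open>Cocycles without obstruction\<close>

context type_T
begin

text \<open>
  The part of the relator of \<open>c\<close> that belongs to the vertex \<open>v\<close>; at the vertex 1 there is no incoming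
  arrow \<open>a\<^sub>i\<close>, and at \<open>n\<close> the loop replaces the outgoing one.
\<close>
definition vertex_value :: "((walk_type \<Rightarrow> complex) \<Rightarrow> (walk_type \<Rightarrow> complex) \<Rightarrow> walk_type \<Rightarrow> complex)
    \<Rightarrow> nat \<Rightarrow> walk_type \<Rightarrow> complex" where
  "vertex_value c v = (if v = 1 then 0 else c (up (v - 1)) (down (v - 1))) -
     (if v < n then c (down v) (up v) else c lp lp)"

definition partial_sum where
  "partial_sum c i d = (\<Sum>k\<in>{1..i}. vertex_value c k (k, k, d))"

text \<open>
  Compatibility with the relations asks, at each vertex, that \<open>g\<close> of the incoming arrow minus \<open>g\<close> of
  the outgoing one be \<open>vertex_value\<close> after multiplication by an arrow. The reversed arrows can be given
  the value 0, and the values on the \<open>a\<^sub>i\<close> are then partial sums. The loop occurs on both sides of its own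
  square, hence the factor \<open>1/2\<close>. Lengths shift by one because \<open>g\<close> is multiplied by an arrow.
\<close>
fun correction :: "((walk_type \<Rightarrow> complex) \<Rightarrow> (walk_type \<Rightarrow> complex) \<Rightarrow> walk_type \<Rightarrow> complex)
    \<Rightarrow> T_arrow \<Rightarrow> walk_type \<Rightarrow> complex" where
  "correction c (Fwd i) = (\<lambda>(u, v, d). of_bool (u = i \<and> v = i + 1 \<and> (u, v, d) \<in> I) * - partial_sum c i (d + 1))"
| "correction c (Bwd i) = 0"
| "correction c Loop = (\<lambda>(u, v, d). of_bool (u = n \<and> v = n \<and> (u, v, d) \<in> I) * (- partial_sum c n (d + 1) / 2))"

lemma correction_in_M: "correction c e \<in> M"
  by (cases e) (auto simp: M_def pointwise)

lemma correction_ends: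
  assumes "e \<in> arrows"
  shows "idem (tgt e) \<star> correction c e = correction c e" "correction c e \<star> idem (src e) = correction c e"
proof -
  have ends: "src e \<in> {1..n}" "tgt e \<in> {1..n}"
    using assms n_pos by (cases e; auto simp: arrows_iff)+
  have "correction c e (u, v, d) = 0" if "u \<noteq> src e \<or> v \<noteq> tgt e" for u v d
    using that by (cases e) (auto simp: pointwise)
  thus "idem (tgt e) \<star> correction c e = correction c e" "correction c e \<star> idem (src e) = correction c e"
    by (auto simp: fun_eq_iff idem_star[OF ends(2) correction_in_M] star_idem[OF ends(1) correction_in_M])
qed

text \<open>
  The equations for \<open>g\<close> can be solved by \<open>correction\<close> in each positive degree, where all types that occur
  are products of an arrow with an admissible type. In degree 0 a product with an arrow has no coefficient,
  and there the hypothesis on the obstruction is needed.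
\<close>
lemma coboundary_criterion_normalized:
  assumes c: "bilinear_map c" "\<And>x y z. hochschild2 c x y z = 0" "\<And>x y. c x y \<in> M"
    and left: "\<And>j y. j \<in> {1..n} \<Longrightarrow> c (idem j) y = 0"
    and right: "\<And>j x. j \<in> {1..n} \<Longrightarrow> c x (idem j) = 0"
    and obs: "\<And>j. j \<in> {1..n} \<Longrightarrow> obstruction c j = 0"
  shows "\<exists>f. linear_map f \<and> (\<forall>x. f x \<in> M) \<and> (\<forall>x\<in>M. \<forall>y\<in>M. c x y = coboundary f x y)"
proof -
  let ?g = "correction c"
  interpret L: walk_lift n c ?g
    by unfold_locales (use c left right correction_ends in auto)
  let ?y = "vertex_value c"
  have supp: "idem v \<star> (c (ev (u, v, d)) (ev (t, u, e)) \<star> idem t) = c (ev (u, v, d)) (ev (t, u, e))"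
    if "low (u, v, d)" "low (t, u, e)" for u v t d e
    using L.idem_star_left[of v "ev (u, v, d)" "ev (t, u, e) \<star> idem t"] L.idem_star_right[of t "ev (u, v, d)" "ev (t, u, e)"]
       L.idem_star_ev[OF that(1)] L.ev_star_idem[OF that(2)] L.low_vertices[OF that(1)] L.low_vertices[OF that(2)]
    by simp
  have supp0: "c (ev (u, v, d)) (ev (t, u, e)) (t', v', f) = 0"
    if "low (u, v, d)" "low (t, u, e)" "t' \<noteq> t \<or> v' \<noteq> v" for u v t d e t' v' f
  proof -
    have "(idem v \<star> (c (ev (u, v, d)) (ev (t, u, e)) \<star> idem t)) (t', v', f) = 0"
      using that L.low_vertices[OF that(1)] L.low_vertices[OF that(2)] c(3) by (auto simp: idem_star star_idem)
    thus ?thesis using supp[OF that(1,2)] by simp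
  qed
  have low1: "low (i, i + 1, 1)" "low (i + 1, i, 1)" if "i \<in> {1..<n}" for i
    using arrow_I that I_low by blast+
  have lown: "low (n, n, 1)" using arrow_I I_low by blast
  have A0: "c (up i) (down i) (t, v, d) = 0" if "i \<in> {1..<n}" "t \<noteq> i + 1 \<or> v \<noteq> i + 1" for i t v d
    unfolding up_def down_def using supp0[OF low1[OF that(1)]] that(2) by blast
  have B0: "c (down i) (up i) (t, v, d) = 0" if "i \<in> {1..<n}" "t \<noteq> i \<or> v \<noteq> i" for i t v d
    unfolding up_def down_def using supp0[OF low1(2,1)[OF that(1)]] that(2) by blast
  have L0: "c lp lp (t, v, d) = 0" if "t \<noteq> n \<or> v \<noteq> n" for t v d
    unfolding lp_def using supp0[OF lown lown] that by blast
  have y_M: "?y v \<in> M" for v by (simp add: vertex_value_def c)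
  have y_supp: "?y v (t, w, d) = 0" if "v \<in> {1..n}" "t \<noteq> v \<or> w \<noteq> v" for v t w d
  proof -
    have "v \<noteq> 1 \<Longrightarrow> v - 1 \<in> {1..<n}" "v - 1 + 1 = v" using that(1) by auto
    thus ?thesis using that A0[of "v - 1" t w d] B0[of v t w d] L0[of t w d]
      unfolding vertex_value_def
      by (cases "v = 1"; cases "v < n") (auto simp: pointwise simp del: One_nat_def)
  qed
  \<comment> \<open>The obstruction at v collects the terms of the relator that start and end at v.\<close>
  have y_0: "?y v (v, v, 0) = 0" if v: "v \<in> {1..n}" for v
  proof -
    have "obstruction c v = (\<Sum>i\<in>{1..<n}. if i = v - 1 then c (up i) (down i) (v, v, 0) else 0)
       - (\<Sum>i\<in>{1..<n}. if i = v then c (down i) (up i) (v, v, 0) else 0) - c lp lp (v, v, 0)"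
      unfolding obstruction_def relator_def pointwise sum_fun_apply sum_subtractf
      using v by (intro arg_cong2[of _ _ _ _ "(-)"] sum.cong refl) (auto simp: A0 B0)
    also have "\<dots> = ?y v (v, v, 0)"
      using v L0[of v v 0] by (cases "v = 1"; cases "v < n") (auto simp: vertex_value_def pointwise)
    finally show ?thesis using obs[OF v] by simp
  qed
  have step: "partial_sum c v d = partial_sum c (v - 1) d + ?y v (v, v, d)" if "1 \<le> v" for v d
    using that by (cases v) (simp_all add: partial_sum_def)
  \<comment> \<open>If the incoming value is truncated because its type is not admissible, the partial sum is zero anyway.\<close>
  have partial_0: "partial_sum c (v - 1) d = 0"
    if "v \<in> {2..n}" "(v, v, d) \<in> I" "1 \<le> d" "(v - 1, v, d - 1) \<notin> I" for v d
    unfolding partial_sum_def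
  proof (intro sum.neutral ballI)
    fix k assume k: "k \<in> {1..v - 1}"
    have "(k, k, d) \<notin> I"
    proof (cases "even d")
      case True
      have "(v - 1, v, d - 1) \<in> I"
        using that(1-3) True by (auto simp: I_def low_def high_def elim!: evenE)
      thus ?thesis using that(4) by simp
    next
      case False
      thus ?thesis using that k by (auto simp: I_def low_def high_def)
    qed
    thus "?y k (k, k, d) = 0" using y_M[of k] by (simp add: M_def)
  qed
  have next_I: "(v, v + 1, d - 1) \<in> I" if "v \<in> {1..<n}" "(v, v, d) \<in> I" "1 \<le> d" for v d
    using that by (cases "even d") (auto simp: I_def low_def high_def elim!: evenE oddE)
  have pred_n: "(n, n, d - 1) \<in> I" if "(n, n, d) \<in> I" "1 \<le> d" for d
  proof (cases "even d")
    case True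
    hence "odd (d - 1 + n + n)" "2 \<le> d" using that by (auto elim!: evenE)
    thus ?thesis using that True by (auto simp del: even_add odd_add simp: I_def low_def high_def)
  next
    case False
    hence "even (d - 1 + n + n)" "odd (d + n + n)" using that by auto
    thus ?thesis using that by (auto simp del: even_add odd_add simp: I_def low_def high_def)
  qed
  define incoming where "incoming v = (if v = 1 then 0 else ?g (Fwd (v - 1)) \<star> down (v - 1))" for v
  define outgoing where "outgoing v = (if v < n then down v \<star> ?g (Fwd v) else lp \<star> ?g Loop + ?g Loop \<star> lp)" for v
  \<comment> \<open>Both sides are supported on closed walks at v, and the partial sums telescope.\<close>
  have solve: "incoming v - outgoing v = ?y v" if v: "v \<in> {1..n}" for v
  proof (rule ext)
    fix r :: walk_type
    obtain t w d where r: "r = (t, w, d)" by (cases r)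
    have inc: "incoming v r = of_bool (t = v \<and> w = v \<and> 1 \<le> d \<and> (v, v, d) \<in> I) * - partial_sum c (v - 1) d"
    proof (cases "v = 1")
      case True
      thus ?thesis by (simp add: incoming_def partial_sum_def pointwise)
    next
      case False
      hence i: "v - 1 \<in> {1..<n}" "v - 1 + 1 = v" using v by auto
      show ?thesis
        using False v partial_0[of v d] star_ev[OF arrow_I(2)[OF i(1)] correction_in_M, of c "Fwd (v - 1)" t w d]
        unfolding incoming_def down_def i r by (auto simp: i)
    qed
    have out: "outgoing v r = of_bool (t = v \<and> w = v \<and> 1 \<le> d \<and> (v, v, d) \<in> I) * - partial_sum c v d"
    proof (cases "v < n")
      case True
      hence i: "v \<in> {1..<n}" using v by auto
      show ?thesis
        using True next_I[OF i, of d] ev_star[OF arrow_I(2)[OF i] correction_in_M, of c "Fwd v" t w d]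
        unfolding outgoing_def down_def r by auto
    next
      case False
      hence "v = n" using v by auto
      thus ?thesis
        using pred_n[of d] ev_star[OF arrow_I(3) correction_in_M, of c Loop t w d]
          star_ev[OF arrow_I(3) correction_in_M, of c Loop t w d]
        unfolding outgoing_def lp_def r by (auto simp: pointwise)
    qed
    show "(incoming v - outgoing v) r = ?y v r"
    proof (cases "t = v \<and> w = v \<and> 1 \<le> d \<and> (v, v, d) \<in> I")
      case True
      thus ?thesis using step[of v d] v unfolding pointwise inc out by (simp add: r)
    next
      case False
      have "?y v r = 0"
      proof (cases "t = v \<and> w = v")
        case True
        hence "d = 0 \<or> (v, v, d) \<notin> I" using False by auto
        thus ?thesis using y_0[OF v] y_M[of v] True by (auto simp: r M_def)
      qed (use y_supp[OF v] r in blast)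
      moreover have "(incoming v - outgoing v) r = 0" unfolding pointwise inc out using False by auto
      ultimately show ?thesis by simp
    qed
  qed
  have turn: "L.lift (Suc v) [Bwd v, Fwd v] = incoming (Suc v) - c (up v) (down v)"
    if "v \<in> {1..<n}" for v
    using L.lift_pair[of "Bwd v" "Fwd v"] that
    by (simp add: arrows_iff incoming_def up_def down_def del: L.lift.simps)
  have bounce: "L.lift v (bounce v) = outgoing v - (if v < n then c (down v) (up v) else c lp lp)"
    if "v \<in> {1..n}" for v
  proof (cases "v < n")
    case True
    thus ?thesis using L.lift_pair[of "Fwd v" "Bwd v"] that
      by (simp add: arrows_iff bounce_def outgoing_def up_def down_def del: L.lift.simps)
  next
    case False
    hence "v = n" using that by auto
    thus ?thesis using L.lift_pair[of Loop Loop]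
      by (simp add: arrows_iff bounce_def outgoing_def lp_def del: L.lift.simps)
  qed
  interpret R: walk_lift_relations n c ?g
  proof
    fix v assume v: "v \<in> {1..<n}"
    have "incoming (Suc v) - outgoing (Suc v) = ?y (Suc v)" using v by (intro solve) auto
    thus "L.lift (Suc v) (bounce (Suc v)) = L.lift (Suc v) [Bwd v, Fwd v]"
      using v unfolding turn[OF v] by (subst bounce) (auto simp: vertex_value_def algebra_simps)
  next
    have "incoming 1 - outgoing 1 = ?y 1" using n_pos by (intro solve) auto
    thus "L.lift 1 (bounce 1) = 0"
      using n_pos by (subst bounce) (auto simp: vertex_value_def incoming_def)
  qed
  show ?thesis
    using R.primitive_linear R.primitive_in_M R.primitive_coboundary by blast
qed

text \<open>
  Subtract the two normalizing coboundaries, which do not change the obstruction.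
\<close>
theorem coboundary_criterion:
  assumes c: "bilinear_map c" "\<And>x y z. hochschild2 c x y z = 0" "\<And>x y. c x y \<in> M"
    and obs: "\<And>j. j \<in> {1..n} \<Longrightarrow> obstruction c j = 0"
  shows "\<exists>f. linear_map f \<and> (\<forall>x. f x \<in> M) \<and> (\<forall>x\<in>M. \<forall>y\<in>M. c x y = coboundary f x y)"
proof -
  obtain h where h: "linear_map h" "\<And>x. h x \<in> M"
      "\<And>j y. j \<in> {1..n} \<Longrightarrow> c (idem j) y = coboundary h (idem j) y"
    using normalize_cocycle_left[OF c] by blast
  define c1 where "c1 = (\<lambda>x y. c x y - coboundary h x y)"
  have c1: "bilinear_map c1" "\<And>x y z. hochschild2 c1 x y z = 0" "\<And>x y. c1 x y \<in> M"
    "\<And>j y. j \<in> {1..n} \<Longrightarrow> c1 (idem j) y = 0"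
    unfolding c1_def using c h
    by (auto simp: hochschild2_diff coboundary_cocycle coboundary_in_M intro!: bilinear_diff coboundary_bilinear)
  obtain k where k: "linear_map k" "\<And>x. k x \<in> M"
      "\<And>j x. j \<in> {1..n} \<Longrightarrow> c1 x (idem j) = coboundary k x (idem j)"
      "\<And>j x. j \<in> {1..n} \<Longrightarrow> coboundary k (idem j) x = 0"
    using normalize_cocycle_right[OF c1] by blast
  define c2 where "c2 = (\<lambda>x y. c1 x y - coboundary k x y)"
  have c2: "bilinear_map c2" "\<And>x y z. hochschild2 c2 x y z = 0" "\<And>x y. c2 x y \<in> M"
    "\<And>j y. j \<in> {1..n} \<Longrightarrow> c2 (idem j) y = 0" "\<And>j x. j \<in> {1..n} \<Longrightarrow> c2 x (idem j) = 0"
    unfolding c2_def using c1 k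
    by (auto simp: hochschild2_diff coboundary_cocycle coboundary_in_M intro!: bilinear_diff coboundary_bilinear)
  have "obstruction c2 j = 0" if "j \<in> {1..n}" for j
    unfolding c2_def c1_def obstruction_diff using obs[OF that] h k by (simp add: obstruction_coboundary)
  then obtain f where f: "linear_map f" "\<And>x. f x \<in> M" "\<And>x y. x \<in> M \<Longrightarrow> y \<in> M \<Longrightarrow> c2 x y = coboundary f x y"
    using coboundary_criterion_normalized[OF c2] by blast
  define F where "F = (\<lambda>x. f x + (k x + h x))"
  have "c x y = coboundary F x y" if "x \<in> M" "y \<in> M" for x y
    using f(3)[OF that] by (simp add: c2_def c1_def F_def coboundary_def star_simps algebra_simps)
  moreover have "linear_map F" unfolding F_def by (intro linear_add f k h)
  moreover have "F x \<in> M" for x using f k h by (simp add: F_def)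
  ultimately show ?thesis by blast
qed

end

section \<open>Path algebras are rings\<close>

text \<open>
  The linear extension of \<open>H\<close> from basis elements to a finitely supported \<open>f\<close>.
\<close>
definition lin :: "('x \<Rightarrow> complex) \<Rightarrow> ('x \<Rightarrow> complex) \<Rightarrow> complex" where
  "lin H f = (\<Sum>x | f x \<noteq> 0. f x * H x)"

lemma lin_superset: "finite S \<Longrightarrow> {x. f x \<noteq> 0} \<subseteq> S \<Longrightarrow> lin H f = (\<Sum>x\<in>S. f x * H x)"
  unfolding lin_def by (rule sum.mono_neutral_left) auto

lemma finite_support_add: "finite {x. f x \<noteq> 0} \<Longrightarrow> finite {x. g x \<noteq> 0} \<Longrightarrow> finite {x. (f + g) x \<noteq> (0::complex)}"
  by (rule finite_subset[of _ "{x. f x \<noteq> 0} \<union> {x. g x \<noteq> 0}"]) (auto simp: pointwise)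

lemma lin_add:
  assumes "finite {x. f x \<noteq> 0}" "finite {x. g x \<noteq> 0}"
  shows "lin H (f + g) = lin H f + lin H g"
proof -
  let ?S = "{x. f x \<noteq> 0} \<union> {x. g x \<noteq> 0}"
  have fin: "finite ?S" using assms by simp
  have "{x. (f + g) x \<noteq> 0} \<subseteq> ?S" by (auto simp: pointwise)
  hence "lin H (f + g) = (\<Sum>x\<in>?S. (f + g) x * H x)" by (rule lin_superset[OF fin])
  also have "\<dots> = (\<Sum>x\<in>?S. f x * H x) + (\<Sum>x\<in>?S. g x * H x)"
    by (simp only: pointwise distrib_right sum.distrib)
  also have "(\<Sum>x\<in>?S. f x * H x) = lin H f" by (rule lin_superset[OF fin, symmetric]) simp
  also have "(\<Sum>x\<in>?S. g x * H x) = lin H g" by (rule lin_superset[OF fin, symmetric]) simp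
  finally show ?thesis .
qed

lemma lin_scl: "finite {x. f x \<noteq> 0} \<Longrightarrow> lin H (scl k f) = k * lin H f"
  using lin_superset[of "{x. f x \<noteq> 0}" "scl k f" H] lin_superset[of "{x. f x \<noteq> 0}" f H]
  by (auto simp: sum_distrib_left mult_ac)

lemma lin_zero [simp]: "lin H 0 = 0" by (simp add: lin_def pointwise)

lemma lin_fun_add: "lin (\<lambda>x. H x + K x) f = lin H f + lin K f"
  by (simp add: lin_def algebra_simps sum.distrib)
lemma lin_fun_scl: "lin (\<lambda>x. k * H x) f = k * lin H f"
  by (simp add: lin_def sum_distrib_left mult_ac)

lemma lin_swap: "lin (\<lambda>x. lin (K x) g) f = lin (\<lambda>y. lin (\<lambda>x. K x y) f) g"
  unfolding lin_def sum_distrib_left by (subst sum.swap) (simp add: mult_ac)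

lemma lin_cong: "(\<And>x. f x \<noteq> 0 \<Longrightarrow> H x = K x) \<Longrightarrow> lin H f = lin K f"
  unfolding lin_def by (rule sum.cong) auto

lemma lin_nonzero:
  assumes "lin H f \<noteq> 0"
  obtains x where "f x \<noteq> 0" "H x \<noteq> 0"
  using assms unfolding lin_def
  by (elim sum.not_neutral_contains_not_neutral) (auto intro: that)

definition delta :: "'x \<Rightarrow> 'x \<Rightarrow> complex" where "delta x = (\<lambda>z. of_bool (z = x))"

lemma delta_support [simp]: "{z. delta x z \<noteq> 0} = {x}" by (auto simp: delta_def)
lemma lin_delta [simp]: "lin H (delta x) = H x"
  by (simp add: lin_superset[of "{x}"] delta_def)

lemma lin_of_delta: "finite {x. f x \<noteq> 0} \<Longrightarrow> lin (\<lambda>x. of_bool (x = z)) f = f z"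
  by (simp add: lin_def of_bool_def if_distrib[of "\<lambda>t. _ * t"] cong: if_cong)

definition join_path :: "('v, 'a) path \<Rightarrow> ('v, 'a) path \<Rightarrow> ('v, 'a) path" where
  "join_path x y = (fst y, fst (snd y) @ fst (snd x), snd (snd x))"

definition composable :: "('v, 'a) path \<Rightarrow> ('v, 'a) path \<Rightarrow> bool" where
  "composable x y \<longleftrightarrow> fst x = snd (snd y)"

context wf_digraph
begin

abbreviation R where "R \<equiv> path_algebra G"

lemma path_algebra_simps [simp]:
  "x \<oplus>\<^bsub>R\<^esub> y = x + y" "\<zero>\<^bsub>R\<^esub> = 0" "c \<odot>\<^bsub>R\<^esub> x = scl c x"
  by (auto simp: path_algebra_def pointwise fun_eq_iff)

lemma carrier_R: "f \<in> carrier R \<longleftrightarrow> finite {x. f x \<noteq> 0} \<and> {x. f x \<noteq> 0} \<subseteq> paths G"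
  by (simp add: path_algebra_def)

lemma carrier_finite: "f \<in> carrier R \<Longrightarrow> finite {x. f x \<noteq> 0}"
  by (simp add: carrier_R)

lemma paths_iff: "(u, p, v) \<in> paths G \<longleftrightarrow> awalk u p v"
  by (simp add: paths_def)

lemma composable_paths:
  assumes "x \<in> paths G" "y \<in> paths G" "composable x y"
  shows "join_path x y \<in> paths G"
  using assms awalk_appendI by (auto simp: paths_def composable_def join_path_def)

text \<open>
  The product is the bilinear extension of the composition of paths. In the definition the sum ranges
  over the finitely many ways to cut a given path in two.
\<close>
lemma mult_path_algebra:
  assumes f: "f \<in> carrier R" and g: "g \<in> carrier R"
  shows "(f \<otimes>\<^bsub>R\<^esub> g) z = lin (\<lambda>x. lin (\<lambda>y. of_bool (composable x y \<and> z = join_path x y)) g) f"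
proof -
  obtain u r w where z: "z = (u, r, w)" by (cases z)
  let ?D = "{(p, v, q). (v, p, w) \<in> paths G \<and> (u, q, v) \<in> paths G \<and> r = q @ p}"
  let ?E = "{x. f x \<noteq> 0} \<times> {y. g y \<noteq> 0}"
  have "?D \<subseteq> (\<lambda>k. (drop k r, awlast u (take k r), take k r)) ` {..length r}"
  proof
    fix t assume "t \<in> ?D"
    then obtain p v q where t: "t = (p, v, q)" "awalk u q v" "r = q @ p" by (auto simp: paths_iff)
    hence "t = (drop (length q) r, awlast u (take (length q) r), take (length q) r)"
      by (auto simp: awalk_def intro: awlast_if_cas[symmetric])
    thus "t \<in> (\<lambda>k. (drop k r, awlast u (take k r), take k r)) ` {..length r}"
      by (rule image_eqI) (simp add: t(3))
  qed
  \<comment> \<open>The cut point of the path determines the middle vertex.\<close>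
  hence fin: "finite ?D" by (rule finite_subset) simp
  have "(f \<otimes>\<^bsub>R\<^esub> g) z = (\<Sum>(p, v, q)\<in>?D. f (v, p, w) * g (u, q, v))"
    by (simp add: path_algebra_def z)
  also have "\<dots> = (\<Sum>(x, y)\<in>?E. f x * g y * of_bool (composable x y \<and> z = join_path x y))"
  proof (rule sum.reindex_bij_witness_not_neutral[where
      S' = "{(p, v, q)\<in>?D. f (v, p, w) * g (u, q, v) = 0}" and
      T' = "{(x, y)\<in>?E. \<not> (composable x y \<and> z = join_path x y)}" and
      j = "\<lambda>(p, v, q). ((v, p, w), (u, q, v))" and i = "\<lambda>(x, y). (fst (snd x), fst x, fst (snd y))"])
    show "finite {(p, v, q)\<in>?D. f (v, p, w) * g (u, q, v) = 0}" using fin by (rule rev_finite_subset) auto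
    have "finite ?E" using f g by (simp add: carrier_R)
    thus "finite {(x, y)\<in>?E. \<not> (composable x y \<and> z = join_path x y)}" by (rule rev_finite_subset) blast
  next
    fix b assume "b \<in> ?E - {(x, y)\<in>?E. \<not> (composable x y \<and> z = join_path x y)}"
    then obtain x y where b: "b = (x, y)" "f x \<noteq> 0" "g y \<noteq> 0" "composable x y" "z = join_path x y" by blast
    have "x \<in> paths G" "y \<in> paths G" using b f g unfolding carrier_R by blast+
    moreover obtain v p w' where x: "x = (v, p, w')" by (cases x)
    moreover obtain u' q v' where y: "y = (u', q, v')" by (cases y)
    moreover have "v' = v" "u' = u" "w' = w" "r = q @ p"
      using b(4,5) by (simp_all add: z x y composable_def join_path_def)
    ultimately show "(case b of (x, y) \<Rightarrow> (fst (snd x), fst x, fst (snd y)))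
        \<in> ?D - {(p, v, q)\<in>?D. f (v, p, w) * g (u, q, v) = 0}"
      and "(\<lambda>(p, v, q). ((v, p, w), (u, q, v))) (case b of (x, y) \<Rightarrow> (fst (snd x), fst x, fst (snd y))) = b"
      using b(1-3) by simp_all
  next
    fix a assume "a \<in> ?D - {(p, v, q)\<in>?D. f (v, p, w) * g (u, q, v) = 0}"
    then obtain p v q where a: "a = (p, v, q)" "r = q @ p" "f (v, p, w) \<noteq> 0" "g (u, q, v) \<noteq> 0" by auto
    show "(case (case a of (p, v, q) \<Rightarrow> ((v, p, w), (u, q, v))) of (x, y) \<Rightarrow> (fst (snd x), fst x, fst (snd y))) = a"
      and "(case a of (p, v, q) \<Rightarrow> ((v, p, w), (u, q, v))) \<in> ?E - {(x, y)\<in>?E. \<not> (composable x y \<and> z = join_path x y)}"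
      using a by (simp_all add: composable_def join_path_def z)
  next
    fix a assume "a \<in> ?D"
    then obtain p v q where a: "a = (p, v, q)" "r = q @ p" by auto
    thus "(case (case a of (p, v, q) \<Rightarrow> ((v, p, w), (u, q, v))) of (x, y) \<Rightarrow> f x * g y * of_bool (composable x y \<and> z = join_path x y))
        = (case a of (p, v, q) \<Rightarrow> f (v, p, w) * g (u, q, v))"
      by (simp add: composable_def join_path_def z)
  next
    fix a assume "a \<in> {(p, v, q)\<in>?D. f (v, p, w) * g (u, q, v) = 0}"
    thus "(case a of (p, v, q) \<Rightarrow> f (v, p, w) * g (u, q, v)) = 0" by (cases a) simp
  next
    fix b assume "b \<in> {(x, y)\<in>?E. \<not> (composable x y \<and> z = join_path x y)}"
    thus "(case b of (x, y) \<Rightarrow> f x * g y * of_bool (composable x y \<and> z = join_path x y)) = 0" by (cases b) simp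
  qed
  also have "\<dots> = (\<Sum>x | f x \<noteq> 0. \<Sum>y | g y \<noteq> 0. f x * g y * of_bool (composable x y \<and> z = join_path x y))"
    by (rule sum.cartesian_product[symmetric])
  finally show ?thesis by (simp add: lin_def sum_distrib_left mult_ac)
qed

lemma mult_support:
  assumes "f \<in> carrier R" "g \<in> carrier R"
  shows "{z. (f \<otimes>\<^bsub>R\<^esub> g) z \<noteq> 0} \<subseteq>
    (\<lambda>(x, y). join_path x y) ` {(x, y) \<in> {x. f x \<noteq> 0} \<times> {y. g y \<noteq> 0}. composable x y}"
proof
  fix z assume "z \<in> {z. (f \<otimes>\<^bsub>R\<^esub> g) z \<noteq> 0}"
  hence "lin (\<lambda>x. lin (\<lambda>y. of_bool (composable x y \<and> z = join_path x y)) g) f \<noteq> 0"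
    by (simp add: mult_path_algebra[OF assms])
  then obtain x where x: "f x \<noteq> 0" "lin (\<lambda>y. of_bool (composable x y \<and> z = join_path x y)) g \<noteq> 0"
    by (rule lin_nonzero)
  from x(2) obtain y where "g y \<noteq> 0" "of_bool (composable x y \<and> z = join_path x y) \<noteq> (0 :: complex)"
    by (rule lin_nonzero)
  thus "z \<in> (\<lambda>(x, y). join_path x y) ` {(x, y) \<in> {x. f x \<noteq> 0} \<times> {y. g y \<noteq> 0}. composable x y}"
    using x by auto
qed

lemma mult_closed:
  assumes "f \<in> carrier R" "g \<in> carrier R"
  shows "f \<otimes>\<^bsub>R\<^esub> g \<in> carrier R"
proof -
  let ?E = "{(x, y) \<in> {x. f x \<noteq> 0} \<times> {y. g y \<noteq> 0}. composable x y}"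
  have "finite ?E" using assms
    by (intro finite_subset[of ?E "{x. f x \<noteq> 0} \<times> {y. g y \<noteq> 0}"]) (auto simp: carrier_R)
  hence "finite {z. (f \<otimes>\<^bsub>R\<^esub> g) z \<noteq> 0}" using mult_support[OF assms] finite_subset by blast
  moreover have "(\<lambda>(x, y). join_path x y) ` ?E \<subseteq> paths G"
  proof (rule image_subsetI)
    fix t assume "t \<in> ?E"
    then obtain x y where t: "t = (x, y)" "f x \<noteq> 0" "g y \<noteq> 0" "composable x y" by auto
    hence "x \<in> paths G" "y \<in> paths G" using assms unfolding carrier_R by blast+
    thus "(\<lambda>(x, y). join_path x y) t \<in> paths G" using t composable_paths by simp
  qed
  ultimately show ?thesis using mult_support[OF assms] unfolding carrier_R by blast
qed

text \<open>
  This reduces identities between products, like associativity below, to identities between paths.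
\<close>
lemma lin_mult:
  assumes f: "f \<in> carrier R" and g: "g \<in> carrier R"
  shows "lin H (f \<otimes>\<^bsub>R\<^esub> g) = lin (\<lambda>x. lin (\<lambda>y. of_bool (composable x y) * H (join_path x y)) g) f"
proof -
  let ?Z = "(\<lambda>(x, y). join_path x y) ` ({x. f x \<noteq> 0} \<times> {y. g y \<noteq> 0})"
  have Z: "finite ?Z" using f g by (simp add: carrier_R)
  have "lin H (f \<otimes>\<^bsub>R\<^esub> g) = (\<Sum>z\<in>?Z. (f \<otimes>\<^bsub>R\<^esub> g) z * H z)"
    using mult_support[OF f g] by (intro lin_superset Z) auto
  also have "\<dots> = (\<Sum>z\<in>?Z. \<Sum>x | f x \<noteq> 0. \<Sum>y | g y \<noteq> 0. f x * (g y * (of_bool (composable x y \<and> z = join_path x y) * H z)))"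
    by (simp add: mult_path_algebra[OF f g] lin_def sum_distrib_left sum_distrib_right mult_ac)
  also have "\<dots> = (\<Sum>x | f x \<noteq> 0. \<Sum>z\<in>?Z. \<Sum>y | g y \<noteq> 0. f x * (g y * (of_bool (composable x y \<and> z = join_path x y) * H z)))"
    by (rule sum.swap)
  also have "\<dots> = (\<Sum>x | f x \<noteq> 0. \<Sum>y | g y \<noteq> 0. \<Sum>z\<in>?Z. f x * (g y * (of_bool (composable x y \<and> z = join_path x y) * H z)))"
    by (rule sum.cong[OF refl], rule sum.swap)
  also have "\<dots> = (\<Sum>x | f x \<noteq> 0. \<Sum>y | g y \<noteq> 0. f x * (g y * (of_bool (composable x y) * H (join_path x y))))"
  proof (intro sum.cong refl)
    fix x y assume xy: "x \<in> {x. f x \<noteq> 0}" "y \<in> {y. g y \<noteq> 0}"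
    hence "join_path x y \<in> ?Z" by auto
    moreover have "(\<Sum>z\<in>?Z. f x * (g y * (of_bool (composable x y \<and> z = join_path x y) * H z))) =
       (\<Sum>z\<in>?Z. if z = join_path x y then f x * (g y * (of_bool (composable x y) * H (join_path x y))) else 0)"
      by (intro sum.cong refl) auto
    ultimately show "(\<Sum>z\<in>?Z. f x * (g y * (of_bool (composable x y \<and> z = join_path x y) * H z))) =
      f x * (g y * (of_bool (composable x y) * H (join_path x y)))" using Z by simp
  qed
  finally show ?thesis by (simp add: lin_def sum_distrib_left)
qed

lemma join_path_assoc: "join_path (join_path x y) z = join_path x (join_path y z)"
  by (simp add: join_path_def)
lemma composable_join: "composable (join_path x y) z \<longleftrightarrow> composable y z" "composable x (join_path y z) \<longleftrightarrow> composable x y"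
  by (simp_all add: join_path_def composable_def)

lemma mult_assoc:
  assumes f: "f \<in> carrier R" and g: "g \<in> carrier R" and h: "h \<in> carrier R"
  shows "f \<otimes>\<^bsub>R\<^esub> g \<otimes>\<^bsub>R\<^esub> h = f \<otimes>\<^bsub>R\<^esub> (g \<otimes>\<^bsub>R\<^esub> h)"
proof (rule ext)
  fix z
  have "(f \<otimes>\<^bsub>R\<^esub> g \<otimes>\<^bsub>R\<^esub> h) z = lin (\<lambda>x. lin (\<lambda>y. lin (\<lambda>t.
      of_bool (composable x y) * of_bool (composable y t \<and> z = join_path x (join_path y t))) h) g) f"
    unfolding mult_path_algebra[OF mult_closed[OF f g] h] lin_mult[OF f g] lin_fun_scl composable_join join_path_assoc ..
  also have "\<dots> = lin (\<lambda>x. lin (\<lambda>y. lin (\<lambda>t.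
      of_bool (composable y t) * of_bool (composable x y \<and> z = join_path x (join_path y t))) h) g) f"
    by (intro lin_cong) auto
  also have "\<dots> = (f \<otimes>\<^bsub>R\<^esub> (g \<otimes>\<^bsub>R\<^esub> h)) z"
    unfolding mult_path_algebra[OF f mult_closed[OF g h]] lin_mult[OF g h] composable_join ..
  finally show "(f \<otimes>\<^bsub>R\<^esub> g \<otimes>\<^bsub>R\<^esub> h) z = (f \<otimes>\<^bsub>R\<^esub> (g \<otimes>\<^bsub>R\<^esub> h)) z" .
qed

lemma add_closed: "f \<in> carrier R \<Longrightarrow> g \<in> carrier R \<Longrightarrow> f + g \<in> carrier R"
proof -
  assume "f \<in> carrier R" "g \<in> carrier R"
  moreover have "{x. (f + g) x \<noteq> 0} \<subseteq> {x. f x \<noteq> 0} \<union> {x. g x \<noteq> 0}" by (auto simp: pointwise)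
  ultimately show ?thesis using finite_support_add[of f g] unfolding carrier_R by blast
qed

lemma scl_closed: "f \<in> carrier R \<Longrightarrow> scl k f \<in> carrier R"
  by (auto simp: carrier_R intro: rev_finite_subset)

lemma uminus_closed: "f \<in> carrier R \<Longrightarrow> - f \<in> carrier R"
  by (simp add: carrier_R pointwise)

lemma diff_closed: "f \<in> carrier R \<Longrightarrow> g \<in> carrier R \<Longrightarrow> f - g \<in> carrier R"
  using add_closed[OF _ uminus_closed, of f g] by simp

lemma zero_closed: "0 \<in> carrier R" by (simp add: carrier_R pointwise)

lemma delta_closed: "x \<in> paths G \<Longrightarrow> delta x \<in> carrier R" by (simp add: carrier_R)

lemma mult_add_left:
  assumes "f \<in> carrier R" "g \<in> carrier R" "h \<in> carrier R"
  shows "(f + g) \<otimes>\<^bsub>R\<^esub> h = f \<otimes>\<^bsub>R\<^esub> h + g \<otimes>\<^bsub>R\<^esub> h"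
  using assms by (auto simp: fun_eq_iff pointwise mult_path_algebra add_closed lin_add carrier_finite)

lemma mult_add_right:
  assumes "f \<in> carrier R" "g \<in> carrier R" "h \<in> carrier R"
  shows "h \<otimes>\<^bsub>R\<^esub> (f + g) = h \<otimes>\<^bsub>R\<^esub> f + h \<otimes>\<^bsub>R\<^esub> g"
  using assms by (auto simp: fun_eq_iff pointwise mult_path_algebra add_closed lin_add lin_fun_add carrier_finite)

lemma mult_scl_left: "f \<in> carrier R \<Longrightarrow> h \<in> carrier R \<Longrightarrow> scl k f \<otimes>\<^bsub>R\<^esub> h = scl k (f \<otimes>\<^bsub>R\<^esub> h)"
  by (auto simp: fun_eq_iff mult_path_algebra scl_closed lin_scl carrier_finite)

lemma trivial_mult:
  assumes "j \<in> verts G" "f \<in> carrier R"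
  shows "(delta (j, [], j) \<otimes>\<^bsub>R\<^esub> f) (u, p, v) = of_bool (v = j) * f (u, p, v)"
proof -
  have d: "delta (j, [], j) \<in> carrier R" using assms by (intro delta_closed) (simp add: paths_iff awalk_Nil_iff)
  have "(delta (j, [], j) \<otimes>\<^bsub>R\<^esub> f) (u, p, v) = lin (\<lambda>y. of_bool (v = j) * of_bool (y = (u, p, v))) f"
    unfolding mult_path_algebra[OF d assms(2)] lin_delta
    by (intro lin_cong) (auto simp: composable_def join_path_def)
  thus ?thesis using assms by (simp only: lin_fun_scl lin_of_delta carrier_finite)
qed

lemma mult_trivial:
  assumes "j \<in> verts G" "f \<in> carrier R"
  shows "(f \<otimes>\<^bsub>R\<^esub> delta (j, [], j)) (u, p, v) = of_bool (u = j) * f (u, p, v)"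
proof -
  have d: "delta (j, [], j) \<in> carrier R" using assms by (intro delta_closed) (simp add: paths_iff awalk_Nil_iff)
  have "(f \<otimes>\<^bsub>R\<^esub> delta (j, [], j)) (u, p, v) = lin (\<lambda>y. of_bool (u = j) * of_bool (y = (u, p, v))) f"
    unfolding mult_path_algebra[OF assms(2) d] lin_delta
    by (intro lin_cong) (auto simp: composable_def join_path_def)
  thus ?thesis using assms by (simp only: lin_fun_scl lin_of_delta carrier_finite)
qed

lemma delta_mult:
  assumes "x \<in> paths G" "y \<in> paths G"
  shows "delta x \<otimes>\<^bsub>R\<^esub> delta y = (if composable x y then delta (join_path x y) else 0)"
  by (rule ext) (simp add: mult_path_algebra delta_closed assms delta_def[of "join_path x y"] pointwise)

lemma one_mult:
  assumes fin: "finite (verts G)" and f: "f \<in> carrier R"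
  shows "\<one>\<^bsub>R\<^esub> \<in> carrier R" "\<one>\<^bsub>R\<^esub> \<otimes>\<^bsub>R\<^esub> f = f" "f \<otimes>\<^bsub>R\<^esub> \<one>\<^bsub>R\<^esub> = f"
proof -
  have sup: "{z. \<one>\<^bsub>R\<^esub> z \<noteq> 0} = (\<lambda>j. (j, [], j)) ` verts G"
    by (auto simp: path_algebra_def split: if_splits)
  show one: "\<one>\<^bsub>R\<^esub> \<in> carrier R"
    unfolding carrier_R sup using fin by (auto simp: paths_iff awalk_Nil_iff)
  have lin_one: "lin H \<one>\<^bsub>R\<^esub> = (\<Sum>j\<in>verts G. H (j, [], j))" for H :: "('a \<times> 'b list \<times> 'a) \<Rightarrow> complex"
    unfolding lin_def sup
    by (subst sum.reindex) (auto simp: inj_on_def path_algebra_def intro!: sum.cong)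
  have path: "u \<in> verts G \<and> v \<in> verts G" if "f (u, p, v) \<noteq> 0" for u p v
    using that f awalk_hd_in_verts awalk_last_in_verts by (fastforce simp: carrier_R paths_def)
  show "\<one>\<^bsub>R\<^esub> \<otimes>\<^bsub>R\<^esub> f = f"
  proof (rule ext)
    fix z :: "'a \<times> 'b list \<times> 'a"
    obtain u p v where z: "z = (u, p, v)" by (cases z)
    have "(\<one>\<^bsub>R\<^esub> \<otimes>\<^bsub>R\<^esub> f) z = (\<Sum>j\<in>verts G. if j = v then f z else 0)"
      unfolding mult_path_algebra[OF one f] lin_one
    proof (intro sum.cong refl)
      fix j assume "j \<in> verts G"
      have "lin (\<lambda>y. of_bool (composable (j, [], j) y \<and> z = join_path (j, [], j) y)) f
          = lin (\<lambda>y. of_bool (j = v) * of_bool (y = z)) f"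
        by (intro lin_cong) (auto simp: composable_def join_path_def z)
      thus "lin (\<lambda>y. of_bool (composable (j, [], j) y \<and> z = join_path (j, [], j) y)) f = (if j = v then f z else 0)"
        using f by (simp only: lin_fun_scl lin_of_delta carrier_finite) simp
    qed
    thus "(\<one>\<^bsub>R\<^esub> \<otimes>\<^bsub>R\<^esub> f) z = f z" using fin path[of u p v] by (auto simp: z)
  qed
  show "f \<otimes>\<^bsub>R\<^esub> \<one>\<^bsub>R\<^esub> = f"
  proof (rule ext)
    fix z :: "'a \<times> 'b list \<times> 'a"
    obtain u p v where z: "z = (u, p, v)" by (cases z)
    have "(f \<otimes>\<^bsub>R\<^esub> \<one>\<^bsub>R\<^esub>) z = lin (\<lambda>y. lin (\<lambda>x. of_bool (composable x y \<and> z = join_path x y)) f) \<one>\<^bsub>R\<^esub>"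
      unfolding mult_path_algebra[OF f one] by (rule lin_swap)
    also have "\<dots> = (\<Sum>j\<in>verts G. if j = u then f z else 0)"
      unfolding lin_one
    proof (intro sum.cong refl)
      fix j assume "j \<in> verts G"
      have "lin (\<lambda>x. of_bool (composable x (j, [], j) \<and> z = join_path x (j, [], j))) f
          = lin (\<lambda>y. of_bool (j = u) * of_bool (y = z)) f"
        by (intro lin_cong) (auto simp: composable_def join_path_def z)
      thus "lin (\<lambda>x. of_bool (composable x (j, [], j) \<and> z = join_path x (j, [], j))) f = (if j = u then f z else 0)"
        using f by (simp only: lin_fun_scl lin_of_delta carrier_finite) simp
    qed
    finally show "(f \<otimes>\<^bsub>R\<^esub> \<one>\<^bsub>R\<^esub>) z = f z" using fin path[of u p v] by (auto simp: z)
  qed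
qed

theorem path_algebra_ring:
  assumes "finite (verts G)"
  shows "ring R"
proof (rule ringI)
  show "abelian_group R"
    by (rule abelian_groupI) (auto simp: add_closed zero_closed algebra_simps intro!: bexI[of _ "- _"] uminus_closed)
  show "monoid R"
    using one_mult[OF assms] zero_closed
    by (intro monoidI) (auto simp: mult_closed mult_assoc)
qed (simp_all add: mult_add_left mult_add_right)

end

section \<open>The preprojective ideal as a kernel\<close>

context type_T
begin

sublocale R: ring "path_algebra (T_quiver_double n)"
  by (rule Q.path_algebra_ring) (simp add: verts_Q)

lemma R_uminus: "f \<in> carrier Q.R \<Longrightarrow> \<ominus>\<^bsub>Q.R\<^esub> f = - f"
  by (rule R.minus_equality) (simp_all add: Q.uminus_closed)

lemma R_minus: "f \<in> carrier Q.R \<Longrightarrow> g \<in> carrier Q.R \<Longrightarrow> f \<ominus>\<^bsub>Q.R\<^esub> g = f - g"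
  by (simp add: a_minus_def R_uminus)

lemma R_sum_closed: "(\<And>i. i \<in> S \<Longrightarrow> F i \<in> carrier Q.R) \<Longrightarrow> sum F S \<in> carrier Q.R"
  by (induction S rule: infinite_finite_induct) (auto simp: Q.zero_closed Q.add_closed)

lemma R_finsum:
  assumes "finite S" "\<And>i. i \<in> S \<Longrightarrow> F i \<in> carrier Q.R"
  shows "finsum Q.R F S = sum F S"
  using assms
proof (induction rule: finite_induct)
  case empty
  show ?case unfolding sum.empty R.finsum_empty by simp
next
  case (insert i S)
  have "finsum Q.R F (insert i S) = F i \<oplus>\<^bsub>Q.R\<^esub> finsum Q.R F S"
    using insert.hyps insert.prems by (intro R.finsum_insert) auto
  thus ?case using insert by simp
qed

lemma paths_walk: "(u, p, v) \<in> paths (T_quiver_double n) \<longleftrightarrow> walk u p v"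
  by (rule Q.paths_iff)

lemma arrow_delta: "arrow (T_quiver_double n) e = delta (src e, [e], tgt e)"
  by (auto simp: arrow_def delta_def)

lemma arrow_mult:
  assumes "e \<in> arrows" "f \<in> arrows" "tgt e = src f"
  shows "arrow (T_quiver_double n) f \<otimes>\<^bsub>Q.R\<^esub> arrow (T_quiver_double n) e = delta (src e, [e, f], tgt f)"
proof -
  have "(src f, [f], tgt f) \<in> paths (T_quiver_double n)" "(src e, [e], tgt e) \<in> paths (T_quiver_double n)"
    using assms by (simp_all add: paths_walk walk_single)
  thus ?thesis unfolding arrow_delta using assms by (simp add: Q.delta_mult composable_def join_path_def)
qed

lemma delta_walk: "walk u p v \<Longrightarrow> delta (u, p, v) \<in> carrier Q.R"
  by (rule Q.delta_closed) (simp add: paths_walk)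

lemma walk_turns:
  "i \<in> {1..<n} \<Longrightarrow> walk (i + 1) [Bwd i, Fwd i] (i + 1)"
  "i \<in> {1..<n} \<Longrightarrow> walk i [Fwd i, Bwd i] i"
  "walk n [Loop, Loop] n"
  using n_pos by (auto simp: walk_Cons walk_Nil arrows_iff)

lemma T_relation_eq:
  "T_relation n = (\<Sum>i\<in>{1..<n}. delta (i + 1, [Bwd i, Fwd i], i + 1) - delta (i, [Fwd i, Bwd i], i))
     - delta (n, [Loop, Loop], n)"
proof -
  let ?a = "arrow (T_quiver_double n)"
  have ac: "?a e \<in> carrier Q.R" if "e \<in> arrows" for e
    unfolding arrow_delta using that by (intro delta_walk) (simp add: walk_single)
  have com: "commutator Q.R (?a (Fwd i)) (?a (Bwd i)) =
      delta (i + 1, [Bwd i, Fwd i], i + 1) - delta (i, [Fwd i, Bwd i], i)" if "i \<in> {1..<n}" for i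
  proof -
    have e: "Fwd i \<in> arrows" "Bwd i \<in> arrows" using that by (simp_all add: arrows_iff)
    show ?thesis using arrow_mult[of "Bwd i" "Fwd i"] arrow_mult[of "Fwd i" "Bwd i"] e
      by (simp add: R_minus delta_walk walk_turns(1)[OF that, simplified] walk_turns(2)[OF that])
  qed
  have cl: "delta (i + 1, [Bwd i, Fwd i], i + 1) - delta (i, [Fwd i, Bwd i], i) \<in> carrier Q.R"
    if "i \<in> {1..<n}" for i
    using walk_turns that by (intro Q.diff_closed delta_walk) auto
  have "finsum Q.R (\<lambda>i. commutator Q.R (?a (Fwd i)) (?a (Bwd i))) {1..<n} =
     (\<Sum>i\<in>{1..<n}. delta (i + 1, [Bwd i, Fwd i], i + 1) - delta (i, [Fwd i, Bwd i], i))"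
  proof -
    have "finsum Q.R (\<lambda>i. commutator Q.R (?a (Fwd i)) (?a (Bwd i))) {1..<n} =
       (\<Sum>i\<in>{1..<n}. commutator Q.R (?a (Fwd i)) (?a (Bwd i)))"
      by (rule R_finsum) (simp_all only: com cl finite_atLeastLessThan)
    also have "\<dots> = (\<Sum>i\<in>{1..<n}. delta (i + 1, [Bwd i, Fwd i], i + 1) - delta (i, [Fwd i, Bwd i], i))"
      by (rule sum.cong[OF refl com])
    finally show ?thesis .
  qed
  moreover have "?a Loop \<otimes>\<^bsub>Q.R\<^esub> ?a Loop = delta (n, [Loop, Loop], n)"
    using arrow_mult[of Loop Loop] by (simp add: arrows_iff)
  moreover have "delta (n, [Loop, Loop], n) \<in> carrier Q.R"
    by (intro delta_walk walk_turns)
  moreover have "(\<Sum>i\<in>{1..<n}. delta (i + 1, [Bwd i, Fwd i], i + 1) - delta (i, [Fwd i, Bwd i], i)) \<in> carrier Q.R"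
    by (intro R_sum_closed cl)
  ultimately show ?thesis
    unfolding T_relation_def Let_def by (simp only: R_minus)
qed

lemma T_relation_closed: "T_relation n \<in> carrier Q.R"
  unfolding T_relation_eq using walk_turns by (intro Q.diff_closed R_sum_closed delta_walk) auto

definition path_value :: "(nat, T_arrow) path \<Rightarrow> walk_type \<Rightarrow> complex" where
  "path_value = (\<lambda>(u, p, v). ev (u, v, length p))"

text \<open>
  The evaluation of the path algebra in the model, which sends a path to its type.
\<close>
definition phi :: "((nat, T_arrow) path \<Rightarrow> complex) \<Rightarrow> walk_type \<Rightarrow> complex" where
  "phi f = (\<lambda>r. lin (\<lambda>x. path_value x r) f)"

lemma phi_sum: "phi f = (\<Sum>x | f x \<noteq> 0. scl (f x) (path_value x))"
  by (rule ext) (simp add: phi_def lin_def sum_fun_apply)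

lemma phi_in_M [simp]: "phi f \<in> M"
  unfolding phi_sum by (auto simp: path_value_def intro!: M_sum M_scl)

lemma phi_add: "f \<in> carrier Q.R \<Longrightarrow> g \<in> carrier Q.R \<Longrightarrow> phi (f + g) = phi f + phi g"
  by (rule ext) (simp add: phi_def lin_add Q.carrier_finite pointwise)

lemma phi_scl: "f \<in> carrier Q.R \<Longrightarrow> phi (scl k f) = scl k (phi f)"
  by (rule ext) (simp add: phi_def lin_scl Q.carrier_finite)

lemma phi_zero: "phi 0 = 0"
  by (rule ext) (simp add: phi_def pointwise)

lemma phi_diff: "f \<in> carrier Q.R \<Longrightarrow> g \<in> carrier Q.R \<Longrightarrow> phi (f - g) = phi f - phi g"
  using phi_add[of "f - g" g] by (simp add: Q.diff_closed)

lemma phi_delta: "phi (delta (u, p, v)) = ev (u, v, length p)"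
  by (rule ext) (simp add: phi_def path_value_def)

lemma phi_sum_closed:
  "(\<And>i. i \<in> S \<Longrightarrow> F i \<in> carrier Q.R) \<Longrightarrow> phi (sum F S) r = (\<Sum>i\<in>S. phi (F i) r)"
  by (induction S rule: infinite_finite_induct) (auto simp: phi_zero phi_add R_sum_closed pointwise)

lemma path_value_mult:
  assumes "x \<in> paths (T_quiver_double n)" "y \<in> paths (T_quiver_double n)"
  shows "path_value x \<star> path_value y = (if composable x y then path_value (join_path x y) else 0)"
proof -
  obtain v p w where x: "x = (v, p, w)" by (cases x)
  obtain u q v' where y: "y = (u, q, v')" by (cases y)
  have "low (v, w, length p)" "low (u, v', length q)"
    using assms by (auto simp: x y paths_walk intro: walk_low)
  thus ?thesis
    by (auto simp: x y path_value_def composable_def join_path_def ev_star_ev ev_star_ev_distinct)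
qed

lemma phi_mult:
  assumes f: "f \<in> carrier Q.R" and g: "g \<in> carrier Q.R"
  shows "phi (f \<otimes>\<^bsub>Q.R\<^esub> g) = phi f \<star> phi g"
proof (rule ext)
  fix r
  have "phi (f \<otimes>\<^bsub>Q.R\<^esub> g) r =
      lin (\<lambda>x. lin (\<lambda>y. of_bool (composable x y) * path_value (join_path x y) r) g) f"
    unfolding phi_def by (rule Q.lin_mult[OF f g])
  also have "\<dots> = lin (\<lambda>x. lin (\<lambda>y. (path_value x \<star> path_value y) r) g) f"
  proof (intro lin_cong)
    fix x y assume "f x \<noteq> 0" "g y \<noteq> 0"
    hence "x \<in> paths (T_quiver_double n)" "y \<in> paths (T_quiver_double n)"
      using f g unfolding Q.carrier_R by blast+
    thus "of_bool (composable x y) * path_value (join_path x y) r = (path_value x \<star> path_value y) r"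
      by (simp add: path_value_mult pointwise)
  qed
  also have "\<dots> = (phi f \<star> phi g) r"
    unfolding phi_sum star_sum_left star_sum_right star_scl lin_def
    by (simp add: sum_fun_apply sum_distrib_left) (subst sum.swap, simp add: mult_ac)
  finally show "phi (f \<otimes>\<^bsub>Q.R\<^esub> g) r = (phi f \<star> phi g) r" .
qed

lemma phi_relation: "phi (T_relation n) = 0"
proof (rule ext)
  fix r
  have "phi (T_relation n) r = (\<Sum>i\<in>{1..<n}. phi (delta (i + 1, [Bwd i, Fwd i], i + 1) - delta (i, [Fwd i, Bwd i], i)) r)
     - phi (delta (n, [Loop, Loop], n)) r"
  proof -
    have cl: "delta (i + 1, [Bwd i, Fwd i], i + 1) - delta (i, [Fwd i, Bwd i], i) \<in> carrier Q.R"
      if "i \<in> {1..<n}" for i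
      using walk_turns(1,2)[OF that] by (intro Q.diff_closed delta_walk)
    have "phi (T_relation n) r = phi (\<Sum>i\<in>{1..<n}. delta (i + 1, [Bwd i, Fwd i], i + 1) - delta (i, [Fwd i, Bwd i], i)) r
        - phi (delta (n, [Loop, Loop], n)) r"
      unfolding T_relation_eq
      by (subst phi_diff) (rule R_sum_closed cl delta_walk walk_turns(3) minus_apply | assumption)+
    thus ?thesis by (simp only: phi_sum_closed[OF cl])
  qed
  also have "\<dots> = ((\<Sum>i\<in>{1..<n}. up i \<star> down i - down i \<star> up i) - lp \<star> lp) r"
    using walk_turns
    by (auto simp: pointwise sum_fun_apply phi_diff delta_walk phi_delta up_star_down down_star_up lp_star_lp numeral_2_eq_2
        intro!: sum.cong)
  finally show "phi (T_relation n) r = 0 r" by (simp only: relation_in_model)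
qed

definition J where "J = Idl\<^bsub>Q.R\<^esub> {T_relation n}"

sublocale J: ideal J "path_algebra (T_quiver_double n)"
  unfolding J_def using T_relation_closed by (intro R.genideal_ideal) simp

lemma J_carrier: "f \<in> J \<Longrightarrow> f \<in> carrier Q.R"
  by (rule J.a_Hcarr)

lemma J_add: "f \<in> J \<Longrightarrow> g \<in> J \<Longrightarrow> f + g \<in> J"
  using J.a_closed[of f g] by simp

lemma J_zero: "0 \<in> J"
  using J.zero_closed by simp

lemma J_uminus: "f \<in> J \<Longrightarrow> - f \<in> J"
  using J.a_inv_closed[of f] by (simp add: R_uminus J_carrier)

lemma J_diff: "f \<in> J \<Longrightarrow> g \<in> J \<Longrightarrow> f - g \<in> J"
  using J_add[OF _ J_uminus, of f g] by simp

lemma J_scl: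
  assumes "f \<in> J"
  shows "scl k f \<in> J"
proof -
  have "scl k \<one>\<^bsub>Q.R\<^esub> \<otimes>\<^bsub>Q.R\<^esub> f \<in> J"
    using assms by (intro J.I_l_closed Q.scl_closed R.one_closed)
  thus ?thesis using assms by (simp add: Q.mult_scl_left J_carrier)
qed

lemma J_sum: "(\<And>i. i \<in> S \<Longrightarrow> F i \<in> J) \<Longrightarrow> sum F S \<in> J"
  by (induction S rule: infinite_finite_induct) (auto simp: J_zero J_add)

lemma J_subset_kernel: "f \<in> J \<Longrightarrow> phi f = 0"
proof -
  have "ideal {f \<in> carrier Q.R. phi f = 0} Q.R"
  proof (rule idealI[OF R.ring_axioms])
    show "subgroup {f \<in> carrier Q.R. phi f = 0} (add_monoid Q.R)"
    proof
      fix f assume "f \<in> {f \<in> carrier Q.R. phi f = 0}"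
      hence f: "f \<in> carrier Q.R" "phi f = 0" by auto
      have "inv\<^bsub>add_monoid Q.R\<^esub> f = - f" using R_uminus[OF f(1)] by (simp add: a_inv_def)
      thus "inv\<^bsub>add_monoid Q.R\<^esub> f \<in> {f \<in> carrier Q.R. phi f = 0}"
        using f Q.uminus_closed phi_scl[OF f(1), of "-1"] by (simp add: scl_minus1)
    qed (auto simp: Q.add_closed phi_add Q.zero_closed phi_zero)
  qed (auto simp: Q.mult_closed phi_mult)
  moreover have "{T_relation n} \<subseteq> {f \<in> carrier Q.R. phi f = 0}"
    using T_relation_closed phi_relation by simp
  ultimately have "J \<subseteq> {f \<in> carrier Q.R. phi f = 0}"
    unfolding J_def by (rule R.genideal_minimal)
  thus "f \<in> J \<Longrightarrow> phi f = 0" by blast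
qed

text \<open>
  Multiplying the relation by a vertex idempotent on both sides isolates its component at that vertex,
  so the ideal contains the relation at each vertex separately.
\<close>
lemma J_sandwich:
  assumes j: "j \<in> {1..n}"
  shows "(\<lambda>(u, p, v). of_bool (u = j \<and> v = j) * T_relation n (u, p, v)) \<in> J"
proof -
  let ?e = "delta (j, [], j)"
  have jv: "j \<in> verts (T_quiver_double n)" using j by (simp add: verts_Q)
  have e: "?e \<in> carrier Q.R" using j by (intro delta_walk) (simp add: walk_Nil)
  have "T_relation n \<in> J" unfolding J_def using T_relation_closed by (intro R.genideal_self') 
  hence "?e \<otimes>\<^bsub>Q.R\<^esub> (T_relation n \<otimes>\<^bsub>Q.R\<^esub> ?e) \<in> J"
    by (intro J.I_l_closed J.I_r_closed e)
  moreover have "?e \<otimes>\<^bsub>Q.R\<^esub> (T_relation n \<otimes>\<^bsub>Q.R\<^esub> ?e) =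
     (\<lambda>(u, p, v). of_bool (u = j \<and> v = j) * T_relation n (u, p, v))"
    using T_relation_closed e
    by (auto simp: fun_eq_iff Q.trivial_mult[OF jv] Q.mult_trivial[OF jv] Q.mult_closed)
  ultimately show ?thesis by simp
qed

lemma T_relation_at:
  assumes j: "j \<in> {1..n}"
  shows "of_bool (u = j \<and> v = j) * T_relation n (u, p, v) =
     of_bool (2 \<le> j) * delta (j, [Bwd (j - 1), Fwd (j - 1)], j) (u, p, v) - delta (j, bounce j, j) (u, p, v)"
proof -
  have "of_bool (u = j \<and> v = j) * T_relation n (u, p, v) =
     of_bool (u = j \<and> v = j) * ((\<Sum>i\<in>{1..<n}. delta (i + 1, [Bwd i, Fwd i], i + 1) (u, p, v))
        - (\<Sum>i\<in>{1..<n}. delta (i, [Fwd i, Bwd i], i) (u, p, v)) - delta (n, [Loop, Loop], n) (u, p, v))"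
    unfolding T_relation_eq pointwise sum_fun_apply sum_subtractf ..
  also have "\<dots> = (\<Sum>i\<in>{1..<n}. if i = j - 1 then delta (j, [Bwd i, Fwd i], j) (u, p, v) else 0)
      - (\<Sum>i\<in>{1..<n}. if i = j then delta (j, [Fwd i, Bwd i], j) (u, p, v) else 0)
      - of_bool (n = j) * delta (n, [Loop, Loop], n) (u, p, v)"
    unfolding right_diff_distrib sum_distrib_left using j
    by (intro arg_cong2[of _ _ _ _ "(-)"] sum.cong refl) (auto simp: delta_def)
  also have "\<dots> = of_bool (2 \<le> j) * delta (j, [Bwd (j - 1), Fwd (j - 1)], j) (u, p, v) - delta (j, bounce j, j) (u, p, v)"
    using j by (cases "j = n"; cases "2 \<le> j") (auto simp: bounce_def)
  finally show ?thesis .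
qed

lemma J_bounce: "v \<in> {1..<n} \<Longrightarrow> delta (Suc v, bounce (Suc v), Suc v) - delta (Suc v, [Bwd v, Fwd v], Suc v) \<in> J"
proof -
  assume v: "v \<in> {1..<n}"
  hence j: "Suc v \<in> {1..n}" by auto
  have "- (\<lambda>(u, p, w). of_bool (u = Suc v \<and> w = Suc v) * T_relation n (u, p, w)) \<in> J"
    by (intro J_uminus J_sandwich j)
  also have "- (\<lambda>(u, p, w). of_bool (u = Suc v \<and> w = Suc v) * T_relation n (u, p, w)) =
     delta (Suc v, bounce (Suc v), Suc v) - delta (Suc v, [Bwd v, Fwd v], Suc v)"
    unfolding T_relation_at[OF j] using v by (auto simp: fun_eq_iff pointwise)
  finally show ?thesis .
qed

lemma J_bounce_1: "delta (1, bounce 1, 1) \<in> J"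
proof -
  have j: "1 \<in> {1..n}" using n_pos by auto
  have "- (\<lambda>(u, p, w). of_bool (u = 1 \<and> w = 1) * T_relation n (u, p, w)) \<in> J"
    by (intro J_uminus J_sandwich j)
  also have "- (\<lambda>(u, p, w). of_bool (u = 1 \<and> w = 1) * T_relation n (u, p, w)) = delta (1, bounce 1, 1)"
    unfolding T_relation_at[OF j] by (auto simp: fun_eq_iff pointwise)
  finally show ?thesis .
qed

lemma delta_context:
  assumes "walk u r w" "walk w p x" "walk x s v"
  shows "delta (u, r @ p @ s, v) = delta (x, s, v) \<otimes>\<^bsub>Q.R\<^esub> (delta (w, p, x) \<otimes>\<^bsub>Q.R\<^esub> delta (u, r, w))"
proof -
  have "walk u (r @ p) x" using assms by (auto simp: walk_append)
  thus ?thesis using assms by (simp add: Q.delta_mult paths_walk composable_def join_path_def)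
qed

lemma walk_eq_mod_J: "walk_eq p q \<Longrightarrow> walk u p v \<Longrightarrow> delta (u, p, v) - delta (u, q, v) \<in> J"
proof (induction arbitrary: u v rule: walk_eq.induct)
  case (walk_eq_refl p)
  thus ?case by (simp add: J_zero)
next
  case (walk_eq_sym p q)
  hence "walk u p v" using walk_eq_preserves by metis
  from J_uminus[OF walk_eq_sym.IH[OF this]] show ?case by simp
next
  case (walk_eq_trans p q r)
  hence "walk u q v" using walk_eq_preserves by metis
  from J_add[OF walk_eq_trans.IH(1)[OF walk_eq_trans.prems] walk_eq_trans.IH(2)[OF this]] show ?case by simp
next
  case (walk_eq_context p q r s)
  then obtain w x where w: "walk u r w" "walk w p x" "walk x s v" by (auto simp: walk_append)
  have q: "walk w q x" using walk_eq_preserves[OF walk_eq_context.hyps] w by auto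
  note cl = delta_walk[OF w(1)] delta_walk[OF w(2)] delta_walk[OF w(3)] delta_walk[OF q]
  have "delta (x, s, v) \<otimes>\<^bsub>Q.R\<^esub> ((delta (w, p, x) - delta (w, q, x)) \<otimes>\<^bsub>Q.R\<^esub> delta (u, r, w)) \<in> J"
    by (intro J.I_l_closed J.I_r_closed walk_eq_context.IH w cl)
  also have "delta (x, s, v) \<otimes>\<^bsub>Q.R\<^esub> ((delta (w, p, x) - delta (w, q, x)) \<otimes>\<^bsub>Q.R\<^esub> delta (u, r, w)) =
     delta (u, r @ p @ s, v) - delta (u, r @ q @ s, v)"
  proof -
    have "(delta (w, p, x) - delta (w, q, x)) \<otimes>\<^bsub>Q.R\<^esub> delta (u, r, w) =
       delta (w, p, x) \<otimes>\<^bsub>Q.R\<^esub> delta (u, r, w) - delta (w, q, x) \<otimes>\<^bsub>Q.R\<^esub> delta (u, r, w)"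
      using Q.mult_add_left[of "delta (w, p, x) - delta (w, q, x)" "delta (w, q, x)" "delta (u, r, w)"] cl
      by (simp add: Q.diff_closed)
    moreover have "delta (x, s, v) \<otimes>\<^bsub>Q.R\<^esub> (f - g) = delta (x, s, v) \<otimes>\<^bsub>Q.R\<^esub> f - delta (x, s, v) \<otimes>\<^bsub>Q.R\<^esub> g"
      if "f \<in> carrier Q.R" "g \<in> carrier Q.R" for f g
      using Q.mult_add_right[of "f - g" g "delta (x, s, v)"] that cl by (simp add: Q.diff_closed)
    ultimately show ?thesis
      unfolding delta_context[OF w] delta_context[OF w(1) q w(3)] by (simp add: Q.mult_closed cl)
  qed
  finally show ?case .
next
  case (walk_eq_bounce w)
  hence "u = Suc w" "v = Suc w" by (auto simp: walk_bounce)
  thus ?case using J_bounce[OF walk_eq_bounce.hyps] by simp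
qed

lemma walk_null_mod_J: "walk_null p \<Longrightarrow> walk u p v \<Longrightarrow> delta (u, p, v) \<in> J"
proof (induction arbitrary: u v rule: walk_null.induct)
  case walk_null_bounce
  hence "u = 1" "v = 1" using n_pos by (auto simp: walk_bounce)
  thus ?case using J_bounce_1 by simp
next
  case (walk_null_context p r s)
  then obtain w x where w: "walk u r w" "walk w p x" "walk x s v" by (auto simp: walk_append)
  show ?case unfolding delta_context[OF w]
    by (intro J.I_l_closed J.I_r_closed walk_null_context.IH w delta_walk)
next
  case (walk_null_eq p q)
  hence p: "walk u p v" using walk_eq_preserves by metis
  from J_diff[OF walk_null_eq.IH[OF p] walk_eq_mod_J[OF walk_null_eq.hyps(2) p]] show ?case by simp
qed

text \<open>
  A linear section of \<open>phi\<close> with values in combinations of normal forms.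
\<close>
definition rep :: "(walk_type \<Rightarrow> complex) \<Rightarrow> (nat, T_arrow) path \<Rightarrow> complex" where
  "rep y = (\<Sum>a\<in>I. scl (y a) (delta (fst a, normal_form a, fst (snd a))))"

lemma rep_linear: "linear_map rep"
  unfolding linear_map_def rep_def
  by (auto simp: fun_eq_iff sum_fun_apply pointwise algebra_simps sum.distrib sum_distrib_left)

lemma rep_closed: "rep y \<in> carrier Q.R"
  unfolding rep_def
  by (intro R_sum_closed Q.scl_closed) (auto intro: delta_walk[OF walk_normal_form(1)])

lemma rep_ev: "rep (ev (u, v, d)) = (if (u, v, d) \<in> I then delta (u, normal_form (u, v, d), v) else 0)"
proof (cases "(u, v, d) \<in> I")
  case True
  have "rep (ev (u, v, d)) = (\<Sum>a\<in>I. if a = (u, v, d) then delta (u, normal_form (u, v, d), v) else 0)"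
    unfolding rep_def using True by (intro sum.cong refl) (auto simp: ev_def)
  thus ?thesis using True by (simp add: finite_I)
next
  case False
  thus ?thesis using linear_map_zero[OF rep_linear] by (simp add: ev_eq_0)
qed

lemma phi_rep: "y \<in> M \<Longrightarrow> phi (rep y) = y"
proof (rule ext)
  fix r assume y: "y \<in> M"
  have cl: "delta (fst a, normal_form a, fst (snd a)) \<in> carrier Q.R" if "a \<in> I" for a
    using walk_normal_form that by (cases a) (auto intro: delta_walk)
  have "phi (rep y) r = (\<Sum>a\<in>I. phi (scl (y a) (delta (fst a, normal_form a, fst (snd a)))) r)"
    unfolding rep_def by (intro phi_sum_closed Q.scl_closed cl)
  also have "\<dots> = (\<Sum>a\<in>I. scl (y a) (ev a) r)"
  proof (intro sum.cong refl)
    fix a assume a: "a \<in> I"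
    obtain u v d where "a = (u, v, d)" by (cases a)
    thus "phi (scl (y a) (delta (fst a, normal_form a, fst (snd a)))) r = scl (y a) (ev a) r"
      using cl[OF a] walk_normal_form[of u v d] a by (simp add: phi_scl phi_delta)
  qed
  also have "\<dots> = y r"
    using arg_cong[OF M_expansion[OF y], of "\<lambda>x. x r"] by (simp only: sum_fun_apply)
  finally show "phi (rep y) r = y r" .
qed

lemma path_mod_J: "x \<in> paths (T_quiver_double n) \<Longrightarrow> delta x - rep (path_value x) \<in> J"
proof -
  assume x: "x \<in> paths (T_quiver_double n)"
  obtain u p v where u: "x = (u, p, v)" by (cases x)
  hence p: "walk u p v" using x by (simp add: paths_walk)
  show ?thesis
    using walk_classification[OF p] walk_eq_mod_J[OF _ p] walk_null_mod_J[OF _ p]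
    by (cases "(u, v, length p) \<in> I") (simp_all add: u path_value_def rep_ev)
qed

text \<open>
  By the classification of walks every path is congruent, modulo the ideal, to the normal form of its
  type or to zero.
\<close>
lemma rep_phi_mod_J:
  assumes f: "f \<in> carrier Q.R"
  shows "f - rep (phi f) \<in> J"
proof -
  let ?S = "{x. f x \<noteq> 0}"
  have fin: "finite ?S" using f by (rule Q.carrier_finite)
  have "f = (\<Sum>x\<in>?S. scl (f x) (delta x))"
  proof (rule ext)
    fix z
    have "(\<Sum>x\<in>?S. scl (f x) (delta x)) z = (\<Sum>x\<in>?S. if x = z then f z else 0)"
      unfolding sum_fun_apply by (intro sum.cong refl) (auto simp: delta_def)
    thus "f z = (\<Sum>x\<in>?S. scl (f x) (delta x)) z" using fin by simp
  qed
  moreover have "rep (phi f) = (\<Sum>x\<in>?S. scl (f x) (rep (path_value x)))"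
    unfolding phi_sum by (simp add: linear_map_sum[OF rep_linear] linear_map_scl[OF rep_linear])
  ultimately have "f - rep (phi f) = (\<Sum>x\<in>?S. scl (f x) (delta x)) - (\<Sum>x\<in>?S. scl (f x) (rep (path_value x)))"
    by (rule arg_cong2)
  also have "\<dots> = (\<Sum>x\<in>?S. scl (f x) (delta x - rep (path_value x)))"
    by (simp only: scl_diff sum_subtractf)
  also have "\<dots> \<in> J"
  proof (intro J_sum J_scl path_mod_J)
    fix x assume "x \<in> ?S"
    thus "x \<in> paths (T_quiver_double n)" using f unfolding Q.carrier_R by blast
  qed
  finally show ?thesis .
qed

text \<open>
  The relation holds in the model, so the ideal lies in the kernel; and modulo the ideal an element is
  determined by its value in the model.
\<close>
theorem J_eq_kernel: "f \<in> J \<longleftrightarrow> f \<in> carrier Q.R \<and> phi f = 0"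
  using J_subset_kernel J_carrier rep_phi_mod_J[of f] linear_map_zero[OF rep_linear] by auto

end

section \<open>Dimensions of quotients by coordinates\<close>

text \<open>
  The group axioms are inherited from the target.
\<close>
lemma abelian_group_by_embedding:
  fixes G (structure) and e :: "'v \<Rightarrow> 'w::ab_group_add"
  assumes inj: "inj_on e (carrier G)"
    and add: "\<And>x y. x \<in> carrier G \<Longrightarrow> y \<in> carrier G \<Longrightarrow> x \<oplus> y \<in> carrier G \<and> e (x \<oplus> y) = e x + e y"
    and zero: "\<zero> \<in> carrier G" "e \<zero> = 0"
    and neg: "\<And>x. x \<in> carrier G \<Longrightarrow> \<exists>y\<in>carrier G. e y = - e x"
  shows "abelian_group G"
proof (rule abelian_groupI)
  fix x assume x: "x \<in> carrier G"
  then obtain y where y: "y \<in> carrier G" "e y = - e x" using neg by blast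
  hence "e (y \<oplus> x) = e \<zero>" using add x zero by simp
  hence "y \<oplus> x = \<zero>" using inj_onD[OF inj] add x y zero by blast
  thus "\<exists>y\<in>carrier G. y \<oplus> x = \<zero>" using y by blast
next
  fix x y z assume "x \<in> carrier G" "y \<in> carrier G" "z \<in> carrier G"
  thus "x \<oplus> y \<oplus> z = x \<oplus> (y \<oplus> z)"
    using add by (intro inj_onD[OF inj]) (auto simp: add.assoc)
next
  fix x y assume "x \<in> carrier G" "y \<in> carrier G"
  thus "x \<oplus> y = y \<oplus> x"
    using add by (intro inj_onD[OF inj]) (auto simp: add.commute)
next
  fix x assume "x \<in> carrier G"
  thus "\<zero> \<oplus> x = x" using add zero by (intro inj_onD[OF inj]) auto
qed (use add zero in auto)

text \<open>
  A bijection with the functions on \<open>S\<close> that respects the operations; the vector space axioms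
  are inherited from the functions.
\<close>
theorem dimension_by_coordinates:
  fixes V :: "(complex, 'v, 'm) module_scheme" and T :: "'v \<Rightarrow> 'i \<Rightarrow> complex"
  assumes S: "finite S"
    and bij: "bij_betw T (carrier V) {g. \<forall>i. i \<notin> S \<longrightarrow> g i = 0}"
    and add: "\<And>x y. x \<in> carrier V \<Longrightarrow> y \<in> carrier V \<Longrightarrow> x \<oplus>\<^bsub>V\<^esub> y \<in> carrier V \<and> T (x \<oplus>\<^bsub>V\<^esub> y) = T x + T y"
    and smult: "\<And>c x. x \<in> carrier V \<Longrightarrow> c \<odot>\<^bsub>V\<^esub> x \<in> carrier V \<and> T (c \<odot>\<^bsub>V\<^esub> x) = scl c (T x)"
    and zero: "\<zero>\<^bsub>V\<^esub> \<in> carrier V" "T \<zero>\<^bsub>V\<^esub> = 0"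
  shows "vectorspace.fin_dim CC V \<and> vectorspace.dim CC V = card S"
proof -
  have inj: "inj_on T (carrier V)" using bij by (simp add: bij_betw_def)
  have "abelian_group V"
  proof (rule abelian_group_by_embedding[OF inj add zero])
    fix x assume "x \<in> carrier V"
    thus "\<exists>y\<in>carrier V. T y = - T x"
      using smult[of x "-1"] by (intro bexI[of _ "-1 \<odot>\<^bsub>V\<^esub> x"]) (simp_all add: scl_minus1)
  qed
  moreover have "cring CC" by (rule fieldE(1)[OF class_field]) 
  moreover have "(a + b) \<odot>\<^bsub>V\<^esub> x = a \<odot>\<^bsub>V\<^esub> x \<oplus>\<^bsub>V\<^esub> b \<odot>\<^bsub>V\<^esub> x" if "x \<in> carrier V" for a b x
    using that smult add
    by (intro inj_onD[OF inj]) (simp_all add: fun_eq_iff pointwise algebra_simps)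
  moreover have "a \<odot>\<^bsub>V\<^esub> (x \<oplus>\<^bsub>V\<^esub> y) = a \<odot>\<^bsub>V\<^esub> x \<oplus>\<^bsub>V\<^esub> a \<odot>\<^bsub>V\<^esub> y" if "x \<in> carrier V" "y \<in> carrier V" for a x y
    using that smult add by (intro inj_onD[OF inj]) (simp_all add: scl_add)
  moreover have "(a * b) \<odot>\<^bsub>V\<^esub> x = a \<odot>\<^bsub>V\<^esub> (b \<odot>\<^bsub>V\<^esub> x)" if "x \<in> carrier V" for a b x
    using that smult by (intro inj_onD[OF inj]) (simp_all add: scl_scl)
  moreover have "1 \<odot>\<^bsub>V\<^esub> x = x" if "x \<in> carrier V" for x
    using that smult by (intro inj_onD[OF inj]) simp_all
  ultimately have "module CC V"
    using smult by (intro moduleI) simp_all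
  then interpret vectorspace CC V
    using class_field by (simp add: vectorspace_def)
  define b where "b i = inv_into (carrier V) T (\<lambda>j. of_bool (j = i))" for i
  have b: "b i \<in> carrier V" "T (b i) = (\<lambda>j. of_bool (j = i))" if "i \<in> S" for i
  proof -
    have "(\<lambda>j. of_bool (j = i)) \<in> T ` carrier V"
      using that unfolding bij_betw_imp_surj_on[OF bij] by auto
    from inv_into_into[OF this] f_inv_into_f[OF this]
    show "b i \<in> carrier V" "T (b i) = (\<lambda>j. of_bool (j = i))"
      unfolding b_def .
  qed
  have inj_b: "inj_on b S"
  proof (rule inj_onI)
    fix i j assume ij: "i \<in> S" "j \<in> S" "b i = b j"
    have "T (b i) i = T (b j) i" by (simp only: ij(3))
    thus "i = j" unfolding b(2)[OF ij(1)] b(2)[OF ij(2)] by (simp add: of_bool_def split: if_splits)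
  qed
  let ?B = "b ` S"
  have B: "finite ?B" "?B \<subseteq> carrier V" using S b by auto
  have T_sum: "T (finsum V F X) = (\<Sum>v\<in>X. T (F v)) \<and> finsum V F X \<in> carrier V"
    if "finite X" "F \<in> X \<rightarrow> carrier V" for F and X :: "'v set"
    using that
  proof (induction rule: finite_induct)
    case empty
    show ?case unfolding sum.empty finsum_empty using zero by simp
  next
    case (insert v X)
    have "finsum V F (insert v X) = F v \<oplus>\<^bsub>V\<^esub> finsum V F X"
      using insert by (intro finsum_insert) auto
    thus ?case using insert add[of "F v" "finsum V F X"] by (auto simp: Pi_iff)
  qed
  have comb: "T (lincomb a ?B) i = of_bool (i \<in> S) * a (b i)" "lincomb a ?B \<in> carrier V" for a i
  proof -
    have "(\<lambda>v. a v \<odot>\<^bsub>V\<^esub> v) \<in> ?B \<rightarrow> carrier V" using B smult by auto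
    note T_sum[OF B(1) this]
    hence *: "T (lincomb a ?B) = (\<Sum>v\<in>?B. T (a v \<odot>\<^bsub>V\<^esub> v))" "lincomb a ?B \<in> carrier V"
      by (simp_all add: lincomb_def)
    have "T (lincomb a ?B) i = (\<Sum>j\<in>S. T (a (b j) \<odot>\<^bsub>V\<^esub> b j) i)"
      unfolding *(1) sum_fun_apply by (simp add: sum.reindex[OF inj_b])
    also have "\<dots> = (\<Sum>j\<in>S. if j = i then a (b i) else 0)"
      using smult b by (intro sum.cong refl) auto
    finally show "T (lincomb a ?B) i = of_bool (i \<in> S) * a (b i)" using S by simp
    show "lincomb a ?B \<in> carrier V" by (rule *(2))
  qed
  have gen: "span ?B = carrier V"
  proof
    show "span ?B \<subseteq> carrier V" unfolding finite_span[OF B] using comb(2) by auto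
    show "carrier V \<subseteq> span ?B"
    proof
      fix x assume x: "x \<in> carrier V"
      define a where "a v = T x (inv_into S b v)" for v
      have "T (lincomb a ?B) = T x"
      proof (rule ext)
        fix i
        have "i \<notin> S \<Longrightarrow> T x i = 0" using bij x by (auto simp: bij_betw_def)
        thus "T (lincomb a ?B) i = T x i" using inj_b by (cases "i \<in> S") (simp_all add: comb a_def)
      qed
      hence "lincomb a ?B = x" by (intro inj_onD[OF inj] comb x)
      thus "x \<in> span ?B" unfolding finite_span[OF B] by auto
    qed
  qed
  have "lin_indpt ?B"
  proof (rule finite_lin_indpt2[OF B])
    fix a assume "lincomb a ?B = \<zero>\<^bsub>V\<^esub>"
    hence "T (lincomb a ?B) = 0" using zero by simp
    hence "of_bool (i \<in> S) * a (b i) = 0" for i using comb(1)[of a i] by (simp add: pointwise)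
    thus "\<forall>v\<in>?B. a v = \<zero>\<^bsub>CC\<^esub>" by auto
  qed
  hence "basis ?B" using gen B by (simp add: basis_def)
  hence "dim = card ?B" by (rule dim_basis[OF B(1)])
  moreover have fin_dim unfolding fin_dim_def using B gen by blast
  ultimately show ?thesis using card_image[OF inj_b] by simp
qed

lemma kernel_coset:
  fixes G (structure) and E :: "'v \<Rightarrow> 'w::ab_group_add"
  assumes G: "abelian_group G"
    and E: "\<And>x y. x \<in> carrier G \<Longrightarrow> y \<in> carrier G \<Longrightarrow> E (x \<oplus> y) = E x + E y"
    and x: "x \<in> carrier G"
  shows "{h \<in> carrier G. E h = 0} +> x = {y \<in> carrier G. E y = E x}"
proof -
  interpret abelian_group G by (rule G)
  have "y \<in> {h \<in> carrier G. E h = 0} +> x" if y: "y \<in> carrier G" "E y = E x" for y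
  proof -
    have yx: "(y \<ominus> x) \<oplus> x = y" using x y by (simp add: a_minus_def a_assoc l_neg)
    have c: "y \<ominus> x \<in> carrier G" using x y by simp
    have "E (y \<ominus> x) + E x = E y" using E[OF c x] yx by simp
    hence "y \<ominus> x \<in> {h \<in> carrier G. E h = 0}" using c y by simp
    moreover have "y = (y \<ominus> x) \<oplus> x" using yx by simp
    ultimately show ?thesis unfolding a_r_coset_def' by blast
  qed
  moreover have "y \<in> carrier G \<and> E y = E x" if m: "y \<in> {h \<in> carrier G. E h = 0} +> x" for y
  proof -
    obtain h where "y = h \<oplus> x" "h \<in> carrier G" "E h = 0"
      using m unfolding a_r_coset_def' by blast
    thus ?thesis using E x by simp
  qed
  ultimately show ?thesis by blast
qed

lemma fibre_set_add:
  fixes G (structure) and E :: "'v \<Rightarrow> 'w::ab_group_add"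
  assumes G: "abelian_group G"
    and E: "\<And>x y. x \<in> carrier G \<Longrightarrow> y \<in> carrier G \<Longrightarrow> E (x \<oplus> y) = E x + E y"
    and x: "x \<in> carrier G" "y \<in> carrier G"
  shows "set_add G {z \<in> carrier G. E z = E x} {z \<in> carrier G. E z = E y} = {z \<in> carrier G. E z = E (x \<oplus> y)}"
proof -
  interpret abelian_group G by (rule G)
  have "z \<in> set_add G {z \<in> carrier G. E z = E x} {z \<in> carrier G. E z = E y}"
    if z: "z \<in> carrier G" "E z = E (x \<oplus> y)" for z
  proof -
    have zy: "(z \<ominus> y) \<oplus> y = z" using x z by (simp add: a_minus_def a_assoc l_neg)
    have c: "z \<ominus> y \<in> carrier G" using x z by simp
    have "E (z \<ominus> y) + E y = E z" using E[OF c x(2)] zy by simp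
    also have "\<dots> = E x + E y" using E[OF x] z by simp
    finally have "z \<ominus> y \<in> {z \<in> carrier G. E z = E x}" using c by simp
    moreover have "y \<in> {z \<in> carrier G. E z = E y}" using x by simp
    moreover have "z = (z \<ominus> y) \<oplus> y" using zy by simp
    ultimately show ?thesis unfolding set_add_def' by blast
  qed
  moreover have "z \<in> carrier G \<and> E z = E (x \<oplus> y)"
    if m: "z \<in> set_add G {z \<in> carrier G. E z = E x} {z \<in> carrier G. E z = E y}" for z
  proof -
    obtain a b where "z = a \<oplus> b" "a \<in> carrier G" "E a = E x" "b \<in> carrier G" "E b = E y"
      using m unfolding set_add_def' by blast
    thus ?thesis using E x by simp
  qed
  ultimately show ?thesis by blast
qed

text \<open>
  The quotient \<open>Mo/N\<close> enters through \<open>E\<close>, which separates cosets on all of \<open>Mo\<close>, and the subspace \<open>V\<close> is the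
  image of \<open>W\<close>, on which \<open>L\<close> gives finitely many coordinates. Two maps are used because a coset reaches
  outside \<open>W\<close>, where \<open>L\<close> is not controlled.
\<close>
theorem quotient_dimension:
  fixes Mo :: "(complex, 'v, 'm) graded_module_scheme" and E :: "'v \<Rightarrow> 'w::ab_group_add"
    and L :: "'v \<Rightarrow> 'i \<Rightarrow> complex" and V :: "(complex, 'v set, 'l) module_scheme"
  assumes Mo: "abelian_group Mo"
    and E: "\<And>x y. x \<in> carrier Mo \<Longrightarrow> y \<in> carrier Mo \<Longrightarrow> E (x \<oplus>\<^bsub>Mo\<^esub> y) = E x + E y"
    and N: "N = {x \<in> carrier Mo. E x = 0}"
    and Mo_smult: "\<And>c x. x \<in> carrier Mo \<Longrightarrow> c \<odot>\<^bsub>Mo\<^esub> x \<in> carrier Mo"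
    and E_smult: "\<And>c x y. x \<in> carrier Mo \<Longrightarrow> y \<in> carrier Mo \<Longrightarrow> E x = E y \<Longrightarrow> E (c \<odot>\<^bsub>Mo\<^esub> x) = E (c \<odot>\<^bsub>Mo\<^esub> y)"
    and V: "carrier V = (\<lambda>x. N +>\<^bsub>Mo\<^esub> x) ` W" "add V = add (quotient_module Mo N)"
      "smult V = smult (quotient_module Mo N)" "\<zero>\<^bsub>V\<^esub> = N"
    and W: "W \<subseteq> carrier Mo" "\<zero>\<^bsub>Mo\<^esub> \<in> W"
    and W_add: "\<And>x y. x \<in> W \<Longrightarrow> y \<in> W \<Longrightarrow> x \<oplus>\<^bsub>Mo\<^esub> y \<in> W \<and> L (x \<oplus>\<^bsub>Mo\<^esub> y) = L x + L y"
    and W_smult: "\<And>c x. x \<in> W \<Longrightarrow> c \<odot>\<^bsub>Mo\<^esub> x \<in> W \<and> L (c \<odot>\<^bsub>Mo\<^esub> x) = scl c (L x)"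
    and LE: "\<And>x y. x \<in> W \<Longrightarrow> y \<in> W \<Longrightarrow> L x = L y \<longleftrightarrow> E x = E y"
    and S: "finite S" and image: "L ` W = {g. \<forall>i. i \<notin> S \<longrightarrow> g i = 0}"
  shows "vectorspace.fin_dim CC V \<and> vectorspace.dim CC V = card S"
proof -
  interpret Mo: abelian_group Mo by (rule Mo)
  define fibre where "fibre x = {y \<in> carrier Mo. E y = E x}" for x
  have coset: "N +>\<^bsub>Mo\<^esub> x = fibre x" if "x \<in> carrier Mo" for x
    unfolding N fibre_def by (rule kernel_coset[OF Mo E that])
  have fibre_eq: "fibre x = fibre y \<longleftrightarrow> E x = E y" if "x \<in> carrier Mo" "y \<in> carrier Mo" for x y
    using that unfolding fibre_def by auto
  have W': "x \<in> carrier Mo" if "x \<in> W" for x using that W by auto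
  have VW: "carrier V = fibre ` W" unfolding V(1) using coset W' by auto
  define T where "T X = L (inv_into W fibre X)" for X
  have T: "T (fibre x) = L x" if "x \<in> W" for x
  proof -
    have "inv_into W fibre (fibre x) \<in> W" "fibre (inv_into W fibre (fibre x)) = fibre x"
      using that by (auto intro!: inv_into_into f_inv_into_f[where f = fibre])
    thus ?thesis unfolding T_def using that fibre_eq LE W' by blast
  qed
  have add: "fibre x \<oplus>\<^bsub>V\<^esub> fibre y = fibre (x \<oplus>\<^bsub>Mo\<^esub> y)" if "x \<in> W" "y \<in> W" for x y
    unfolding V(2) quotient_module_def fibre_def using fibre_set_add[OF Mo E W' W'] that by simp
  have smult: "c \<odot>\<^bsub>V\<^esub> fibre x = fibre (c \<odot>\<^bsub>Mo\<^esub> x)" if x: "x \<in> W" for c x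
  proof -
    have "N +>\<^bsub>Mo\<^esub> (c \<odot>\<^bsub>Mo\<^esub> y) = fibre (c \<odot>\<^bsub>Mo\<^esub> x)" if "y \<in> fibre x" for y
    proof -
      have y: "y \<in> carrier Mo" "E y = E x" using that by (auto simp: fibre_def)
      have "N +>\<^bsub>Mo\<^esub> (c \<odot>\<^bsub>Mo\<^esub> y) = fibre (c \<odot>\<^bsub>Mo\<^esub> y)" by (intro coset Mo_smult y)
      also have "\<dots> = fibre (c \<odot>\<^bsub>Mo\<^esub> x)"
        using fibre_eq[OF Mo_smult Mo_smult] E_smult[OF y(1) W'[OF x] y(2)] y W'[OF x] by simp
      finally show ?thesis .
    qed
    moreover have "x \<in> fibre x" using W'[OF x] by (simp add: fibre_def)
    ultimately show ?thesis unfolding V(3) quotient_module_def by auto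
  qed
  have L0: "L \<zero>\<^bsub>Mo\<^esub> = 0" using W_add[OF W(2) W(2)] W' W(2) by simp
  have zero: "\<zero>\<^bsub>V\<^esub> = fibre \<zero>\<^bsub>Mo\<^esub>"
  proof -
    have "E \<zero>\<^bsub>Mo\<^esub> = 0" using E[of "\<zero>\<^bsub>Mo\<^esub>" "\<zero>\<^bsub>Mo\<^esub>"] by simp
    thus ?thesis unfolding V(4) N fibre_def by simp
  qed
  show ?thesis
  proof (rule dimension_by_coordinates[OF S])
    show "bij_betw T (carrier V) {g. \<forall>i. i \<notin> S \<longrightarrow> g i = 0}"
    proof (rule bij_betw_imageI)
      show "inj_on T (carrier V)"
      proof (rule inj_onI)
        fix X Y assume "X \<in> carrier V" "Y \<in> carrier V" and eq: "T X = T Y"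
        then obtain x y where xy: "x \<in> W" "y \<in> W" "X = fibre x" "Y = fibre y" unfolding VW by blast
        thus "X = Y" using eq T LE fibre_eq W' by simp
      qed
      have "T ` carrier V = L ` W" unfolding VW image_image using T by (rule image_cong[OF refl])
      thus "T ` carrier V = {g. \<forall>i. i \<notin> S \<longrightarrow> g i = 0}" using image by simp
    qed
  next
    fix X Y assume "X \<in> carrier V" "Y \<in> carrier V"
    then obtain x y where xy: "x \<in> W" "y \<in> W" "X = fibre x" "Y = fibre y" unfolding VW by blast
    thus "X \<oplus>\<^bsub>V\<^esub> Y \<in> carrier V \<and> T (X \<oplus>\<^bsub>V\<^esub> Y) = T X + T Y"
      using W_add[OF xy(1,2)] T add by (auto simp: VW)
  next
    fix c X assume "X \<in> carrier V"
    then obtain x where x: "x \<in> W" "X = fibre x" unfolding VW by blast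
    thus "c \<odot>\<^bsub>V\<^esub> X \<in> carrier V \<and> T (c \<odot>\<^bsub>V\<^esub> X) = scl c (T X)"
      using W_smult[OF x(1)] T smult by (auto simp: VW)
  next
    show "\<zero>\<^bsub>V\<^esub> \<in> carrier V" "T \<zero>\<^bsub>V\<^esub> = 0" unfolding zero using W L0 T by (auto simp: VW)
  qed
qed

section \<open>Hochschild cochains in coordinates\<close>

text \<open>
  A graded algebra with an isomorphism \<open>co\<close> onto the model. All cohomology is computed from these
  data, so the cosets of which the preprojective algebra consists do not appear any more.
\<close>
locale T_coordinates = type_T +
  fixes A :: "(complex, 'v) graded_module" and co :: "'v \<Rightarrow> walk_type \<Rightarrow> complex"
  assumes co_bij: "bij_betw co (carrier A) M"
    and co_mult: "X \<in> carrier A \<Longrightarrow> Y \<in> carrier A \<Longrightarrow> X \<otimes>\<^bsub>A\<^esub> Y \<in> carrier A \<and> co (X \<otimes>\<^bsub>A\<^esub> Y) = co X \<star> co Y"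
    and co_add: "X \<in> carrier A \<Longrightarrow> Y \<in> carrier A \<Longrightarrow> X \<oplus>\<^bsub>A\<^esub> Y \<in> carrier A \<and> co (X \<oplus>\<^bsub>A\<^esub> Y) = co X + co Y"
    and co_smult: "X \<in> carrier A \<Longrightarrow> c \<odot>\<^bsub>A\<^esub> X \<in> carrier A \<and> co (c \<odot>\<^bsub>A\<^esub> X) = scl c (co X)"
    and co_zero: "\<zero>\<^bsub>A\<^esub> \<in> carrier A" "co \<zero>\<^bsub>A\<^esub> = 0"
    and co_gr: "X \<in> gr A d \<longleftrightarrow> X \<in> carrier A \<and> (\<forall>u v e. co X (u, v, e) \<noteq> 0 \<longrightarrow> int e = d)"
begin

lemma co_inj: "X \<in> carrier A \<Longrightarrow> Y \<in> carrier A \<Longrightarrow> co X = co Y \<Longrightarrow> X = Y"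
  using co_bij by (auto simp: bij_betw_def dest: inj_onD)

lemma co_in_M: "X \<in> carrier A \<Longrightarrow> co X \<in> M"
  using co_bij by (auto simp: bij_betw_def)

definition elt :: "(walk_type \<Rightarrow> complex) \<Rightarrow> 'v" where
  "elt x = inv_into (carrier A) co (restr x)"

lemma elt_closed [simp]: "elt x \<in> carrier A" and co_elt [simp]: "co (elt x) = restr x"
proof -
  have "restr x \<in> co ` carrier A" using co_bij by (simp add: bij_betw_def)
  from inv_into_into[OF this] f_inv_into_f[OF this]
  show "elt x \<in> carrier A" "co (elt x) = restr x" unfolding elt_def .
qed

lemma elt_co: "X \<in> carrier A \<Longrightarrow> elt (co X) = X"
  by (rule co_inj) (simp_all add: restr_id co_in_M)

lemma restr_add: "restr (x + y) = restr x + restr y"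
  by (rule ext) (simp add: restr_def pointwise algebra_simps)
lemma restr_scl: "restr (scl k x) = scl k (restr x)"
  by (rule ext) (simp add: restr_def)

lemma elt_star: "elt (x \<star> y) = elt x \<otimes>\<^bsub>A\<^esub> elt y"
  by (rule co_inj) (simp_all add: co_mult restr_id)
lemma elt_add: "elt (x + y) = elt x \<oplus>\<^bsub>A\<^esub> elt y"
  by (rule co_inj) (simp_all add: co_add restr_add)
lemma elt_scl: "elt (scl k x) = k \<odot>\<^bsub>A\<^esub> elt x"
  by (rule co_inj) (simp_all add: co_smult restr_scl)

lemma A_group: "abelian_group A"
proof (rule abelian_group_by_embedding[of co])
  show "inj_on co (carrier A)" using co_bij by (simp add: bij_betw_def)
  fix X assume "X \<in> carrier A"
  thus "\<exists>Y\<in>carrier A. co Y = - co X"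
    using co_smult[of X "-1"] by (intro bexI[of _ "-1 \<odot>\<^bsub>A\<^esub> X"]) (simp_all add: scl_minus1)
qed (use co_add co_zero in auto)

lemma co_finsum:
  assumes "finite S" "\<And>i. i \<in> S \<Longrightarrow> F i \<in> carrier A"
  shows "finsum A F S \<in> carrier A \<and> co (finsum A F S) = (\<Sum>i\<in>S. co (F i))"
proof -
  interpret abelian_group A by (rule A_group)
  show ?thesis using assms
  proof (induction rule: finite_induct)
    case empty
    show ?case unfolding finsum_empty sum.empty using co_zero by simp
  next
    case (insert i S)
    have "finsum A F (insert i S) = F i \<oplus>\<^bsub>A\<^esub> finsum A F S"
      using insert.hyps insert.prems by (intro finsum_insert) auto
    thus ?case using insert co_add[of "F i" "finsum A F S"] by auto
  qed
qed

lemma args_0: "xs \<in> arguments A 0 \<longleftrightarrow> xs = []"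
  by (auto simp: arguments_def)
lemma args_1: "xs \<in> arguments A (Suc 0) \<longleftrightarrow> (\<exists>X\<in>carrier A. xs = [X])"
  by (auto simp: arguments_def length_Suc_conv)
lemma args_2: "xs \<in> arguments A 2 \<longleftrightarrow> (\<exists>X\<in>carrier A. \<exists>Y\<in>carrier A. xs = [X, Y])"
  by (auto simp: arguments_def length_Suc_conv numeral_2_eq_2)
lemma args_3: "xs \<in> arguments A (Suc 2) \<longleftrightarrow> (\<exists>X\<in>carrier A. \<exists>Y\<in>carrier A. \<exists>Z\<in>carrier A. xs = [X, Y, Z])"
  by (auto simp: arguments_def length_Suc_conv numeral_2_eq_2)

lemma multilinear_closed: "f \<in> multilinear_maps A k \<Longrightarrow> xs \<in> arguments A k \<Longrightarrow> f xs \<in> carrier A"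
  by (auto simp: multilinear_maps_def)

lemma args_update: "xs \<in> arguments A k \<Longrightarrow> x \<in> carrier A \<Longrightarrow> xs[i := x] \<in> arguments A k"
  using set_update_subset_insert[of xs i x] by (auto simp: arguments_def)

lemma multilinear_iff:
  "f \<in> multilinear_maps A k \<longleftrightarrow> f \<in> arguments A k \<rightarrow>\<^sub>E carrier A \<and>
    (\<forall>xs\<in>arguments A k. \<forall>i<k. \<forall>x\<in>carrier A.
      (\<forall>y\<in>carrier A. co (f (xs[i := x \<oplus>\<^bsub>A\<^esub> y])) = co (f (xs[i := x])) + co (f (xs[i := y]))) \<and>
      (\<forall>c. co (f (xs[i := c \<odot>\<^bsub>A\<^esub> x])) = scl c (co (f (xs[i := x])))))" (is "?l \<longleftrightarrow> ?e \<and> ?r")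
proof
  assume f: ?l
  have e: ?e using f by (simp add: multilinear_maps_def)
  have c: "f xs \<in> carrier A" if "xs \<in> arguments A k" for xs using e that by auto
  show "?e \<and> ?r"
  proof (intro conjI e ballI allI impI)
    fix xs i x y assume h: "xs \<in> arguments A k" "i < k" "x \<in> carrier A" "y \<in> carrier A"
    hence "f (xs[i := x \<oplus>\<^bsub>A\<^esub> y]) = f (xs[i := x]) \<oplus>\<^bsub>A\<^esub> f (xs[i := y])"
      using f by (simp add: multilinear_maps_def module_hom_def)
    thus "co (f (xs[i := x \<oplus>\<^bsub>A\<^esub> y])) = co (f (xs[i := x])) + co (f (xs[i := y]))"
      using co_add c args_update h by simp
  next
    fix xs i x a assume h: "xs \<in> arguments A k" "i < k" "x \<in> carrier A"
    hence "f (xs[i := a \<odot>\<^bsub>A\<^esub> x]) = a \<odot>\<^bsub>A\<^esub> f (xs[i := x])"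
      using f by (simp add: multilinear_maps_def module_hom_def)
    thus "co (f (xs[i := a \<odot>\<^bsub>A\<^esub> x])) = scl a (co (f (xs[i := x])))"
      using co_smult c args_update h by simp
  qed
next
  assume er: "?e \<and> ?r"
  have c: "f xs \<in> carrier A" if "xs \<in> arguments A k" for xs using er that by auto
  show ?l unfolding multilinear_maps_def module_hom_def
  proof (intro CollectI conjI ballI allI impI)
    fix xs i assume h: "xs \<in> arguments A k" "i < k"
    show "(\<lambda>x. f (xs[i := x])) \<in> carrier A \<rightarrow> carrier A"
      using c args_update h by auto
    fix x y assume "x \<in> carrier A \<and> y \<in> carrier A"
    thus "f (xs[i := x \<oplus>\<^bsub>A\<^esub> y]) = f (xs[i := x]) \<oplus>\<^bsub>A\<^esub> f (xs[i := y])"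
      using er h c args_update co_add by (intro co_inj) simp_all
  next
    fix xs i a x assume h: "xs \<in> arguments A k" "i < k" "a \<in> carrier CC \<and> x \<in> carrier A"
    thus "f (xs[i := a \<odot>\<^bsub>A\<^esub> x]) = a \<odot>\<^bsub>A\<^esub> f (xs[i := x])"
      using er c args_update co_smult by (intro co_inj) simp_all
  qed (use er in blast)
qed

lemma hochschild_args:
  assumes "xs \<in> arguments A (Suc k)"
  shows "hd xs \<in> carrier A" "last xs \<in> carrier A" "tl xs \<in> arguments A k" "butlast xs \<in> arguments A k"
    "\<And>i. i < k \<Longrightarrow> take i xs @ [xs ! i \<otimes>\<^bsub>A\<^esub> xs ! Suc i] @ drop (i + 2) xs \<in> arguments A k"
proof -
  have l: "length xs = Suc k" "set xs \<subseteq> carrier A" using assms by (auto simp: arguments_def)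
  hence ne: "xs \<noteq> []" by auto
  show "hd xs \<in> carrier A" "last xs \<in> carrier A" using l ne by auto
  show "tl xs \<in> arguments A k" "butlast xs \<in> arguments A k"
    using l ne list.set_sel(2)[of xs] in_set_butlastD[of _ xs] by (auto simp: arguments_def)
  fix i assume i: "i < k"
  have "xs ! i \<in> carrier A" "xs ! Suc i \<in> carrier A" using l i by (auto intro: nth_mem)
  thus "take i xs @ [xs ! i \<otimes>\<^bsub>A\<^esub> xs ! Suc i] @ drop (i + 2) xs \<in> arguments A k"
    using l i set_take_subset[of i xs] set_drop_subset[of "i + 2" xs] co_mult by (auto simp: arguments_def)
qed

lemma co_hochschild:
  assumes f: "f \<in> multilinear_maps A k" and xs: "xs \<in> arguments A (Suc k)"
  shows "hochschild_diff A k f xs \<in> carrier A \<and> co (hochschild_diff A k f xs) =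
     co (hd xs) \<star> co (f (tl xs))
     + (\<Sum>i\<in>{..<k}. scl ((-1) ^ Suc i) (co (f (take i xs @ [xs ! i \<otimes>\<^bsub>A\<^esub> xs ! Suc i] @ drop (i + 2) xs))))
     + scl ((-1) ^ Suc k) (co (f (butlast xs)) \<star> co (last xs))"
proof -
  note a = hochschild_args[OF xs]
  note c = multilinear_closed[OF f]
  let ?F = "\<lambda>i. (-1) ^ Suc i \<odot>\<^bsub>A\<^esub> f (take i xs @ [xs ! i \<otimes>\<^bsub>A\<^esub> xs ! Suc i] @ drop (i + 2) xs)"
  have F: "?F i \<in> carrier A \<and> co (?F i) = scl ((-1) ^ Suc i) (co (f (take i xs @ [xs ! i \<otimes>\<^bsub>A\<^esub> xs ! Suc i] @ drop (i + 2) xs)))"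
    if "i \<in> {..<k}" for i using that by (intro co_smult c a(5)) simp
  have 1: "hd xs \<otimes>\<^bsub>A\<^esub> f (tl xs) \<in> carrier A \<and> co (hd xs \<otimes>\<^bsub>A\<^esub> f (tl xs)) = co (hd xs) \<star> co (f (tl xs))"
    by (intro co_mult a c)
  have 2: "finsum A ?F {..<k} \<in> carrier A \<and> co (finsum A ?F {..<k}) = (\<Sum>i\<in>{..<k}. co (?F i))"
    using F by (intro co_finsum) auto
  have 3: "f (butlast xs) \<otimes>\<^bsub>A\<^esub> last xs \<in> carrier A \<and> co (f (butlast xs) \<otimes>\<^bsub>A\<^esub> last xs) = co (f (butlast xs)) \<star> co (last xs)"
    by (intro co_mult a c)
  have 4: "(-1) ^ Suc k \<odot>\<^bsub>A\<^esub> (f (butlast xs) \<otimes>\<^bsub>A\<^esub> last xs) \<in> carrier A \<and>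
     co ((-1) ^ Suc k \<odot>\<^bsub>A\<^esub> (f (butlast xs) \<otimes>\<^bsub>A\<^esub> last xs)) = scl ((-1) ^ Suc k) (co (f (butlast xs)) \<star> co (last xs))"
    using co_smult 3 by simp
  have "hochschild_diff A k f xs = hd xs \<otimes>\<^bsub>A\<^esub> f (tl xs) \<oplus>\<^bsub>A\<^esub> finsum A ?F {..<k}
     \<oplus>\<^bsub>A\<^esub> (-1) ^ Suc k \<odot>\<^bsub>A\<^esub> (f (butlast xs) \<otimes>\<^bsub>A\<^esub> last xs)"
    using xs by (simp add: hochschild_diff_def)
  moreover have "(\<Sum>i\<in>{..<k}. co (?F i)) = (\<Sum>i\<in>{..<k}. scl ((-1) ^ Suc i) (co (f (take i xs @ [xs ! i \<otimes>\<^bsub>A\<^esub> xs ! Suc i] @ drop (i + 2) xs))))"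
    using F by (intro sum.cong refl) blast
  ultimately show ?thesis
    using co_add[OF conjunct1[OF 1] conjunct1[OF 2]] co_add[OF _ conjunct1[OF 4]] 1 2 4 by simp
qed

lemma cocycle_iff:
  "f \<in> cocycles A k \<longleftrightarrow> f \<in> multilinear_maps A k \<and>
     (\<forall>xs\<in>arguments A (Suc k). co (hochschild_diff A k f xs) = 0)"
proof -
  have "hochschild_diff A k f = \<zero>\<^bsub>cochains A (Suc k)\<^esub> \<longleftrightarrow> (\<forall>xs\<in>arguments A (Suc k). co (hochschild_diff A k f xs) = 0)"
    if f: "f \<in> multilinear_maps A k"
  proof
    assume "hochschild_diff A k f = \<zero>\<^bsub>cochains A (Suc k)\<^esub>"
    thus "\<forall>xs\<in>arguments A (Suc k). co (hochschild_diff A k f xs) = 0"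
      by (simp add: cochains_def co_zero)
  next
    assume *: "\<forall>xs\<in>arguments A (Suc k). co (hochschild_diff A k f xs) = 0"
    show "hochschild_diff A k f = \<zero>\<^bsub>cochains A (Suc k)\<^esub>"
    proof (rule ext)
      fix xs
      show "hochschild_diff A k f xs = \<zero>\<^bsub>cochains A (Suc k)\<^esub> xs"
      proof (cases "xs \<in> arguments A (Suc k)")
        case True
        thus ?thesis using * co_hochschild[OF f True] co_zero
          by (intro co_inj) (simp_all add: cochains_def)
      next
        case False
        thus ?thesis by (simp add: cochains_def hochschild_diff_def)
      qed
    qed
  qed
  thus ?thesis by (auto simp: cocycles_def cochains_def)
qed

definition plus_cochain where
  "plus_cochain k f g = (\<lambda>xs\<in>arguments A k. f xs \<oplus>\<^bsub>A\<^esub> g xs)"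
definition scale_cochain where
  "scale_cochain k c f = (\<lambda>xs\<in>arguments A k. c \<odot>\<^bsub>A\<^esub> f xs)"
definition zero_cochain where
  "zero_cochain k = (\<lambda>xs\<in>arguments A k. \<zero>\<^bsub>A\<^esub>)"

definition cocycle_space where
  "cocycle_space k = (cochains A k)\<lparr>carrier := cocycles A k, gr := (\<lambda>d. cocycles A k \<inter> homogeneous_maps A k d)\<rparr>"

lemma cocycle_space_simps [simp]:
  "carrier (cocycle_space k) = cocycles A k" "\<zero>\<^bsub>cocycle_space k\<^esub> = zero_cochain k"
  "f \<oplus>\<^bsub>cocycle_space k\<^esub> g = plus_cochain k f g" "c \<odot>\<^bsub>cocycle_space k\<^esub> f = scale_cochain k c f"
  "gr (cocycle_space k) d = cocycles A k \<inter> homogeneous_maps A k d"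
  by (simp_all add: cocycle_space_def cochains_def zero_cochain_def plus_cochain_def scale_cochain_def)

lemma HH_eq: "HH k A = quotient_module (cocycle_space k) (coboundaries A k)"
  by (simp add: HH_def cocycle_space_def)

lemma co_cochain:
  "xs \<in> arguments A k \<Longrightarrow> f \<in> multilinear_maps A k \<Longrightarrow> g \<in> multilinear_maps A k \<Longrightarrow>
     co (plus_cochain k f g xs) = co (f xs) + co (g xs)"
  "xs \<in> arguments A k \<Longrightarrow> f \<in> multilinear_maps A k \<Longrightarrow> co (scale_cochain k c f xs) = scl c (co (f xs))"
  "xs \<in> arguments A k \<Longrightarrow> co (zero_cochain k xs) = 0"
  using co_add co_smult multilinear_closed
  by (simp_all add: plus_cochain_def scale_cochain_def zero_cochain_def co_zero)

lemma cochain_multilinear: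
  assumes f: "f \<in> multilinear_maps A k"
  shows "g \<in> multilinear_maps A k \<Longrightarrow> plus_cochain k f g \<in> multilinear_maps A k"
    and "scale_cochain k c f \<in> multilinear_maps A k"
proof -
  have fm: "co (f (xs[i := x \<oplus>\<^bsub>A\<^esub> y])) = co (f (xs[i := x])) + co (f (xs[i := y]))"
    "co (f (xs[i := c \<odot>\<^bsub>A\<^esub> x])) = scl c (co (f (xs[i := x])))"
    if "f \<in> multilinear_maps A k" "xs \<in> arguments A k" "i < k" "x \<in> carrier A" "y \<in> carrier A" for f xs i x y c
    using that unfolding multilinear_iff by blast+
  show "plus_cochain k f g \<in> multilinear_maps A k" if g: "g \<in> multilinear_maps A k"
    unfolding multilinear_iff
  proof (intro conjI ballI allI impI)
    show "plus_cochain k f g \<in> arguments A k \<rightarrow>\<^sub>E carrier A"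
      unfolding plus_cochain_def using multilinear_closed f g co_add by auto
  qed (use f g co_add co_smult fm in \<open>simp_all add: co_cochain args_update scl_add\<close>)
  show "scale_cochain k c f \<in> multilinear_maps A k"
    unfolding multilinear_iff
  proof (intro conjI ballI allI impI)
    show "scale_cochain k c f \<in> arguments A k \<rightarrow>\<^sub>E carrier A"
      unfolding scale_cochain_def using multilinear_closed f co_smult by auto
  qed (use f co_add co_smult fm in \<open>simp_all add: co_cochain args_update scl_add scl_scl mult.commute\<close>)
qed

lemma zero_multilinear: "zero_cochain k \<in> multilinear_maps A k"
  unfolding multilinear_iff
proof (intro conjI ballI allI impI)
  show "zero_cochain k \<in> arguments A k \<rightarrow>\<^sub>E carrier A"
    unfolding zero_cochain_def using co_zero by auto
qed (use co_add co_smult in \<open>simp_all add: co_cochain args_update\<close>)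

lemma hochschild_linear:
  assumes f: "f \<in> multilinear_maps A k" and xs: "xs \<in> arguments A (Suc k)"
  shows "g \<in> multilinear_maps A k \<Longrightarrow> co (hochschild_diff A k (plus_cochain k f g) xs) =
      co (hochschild_diff A k f xs) + co (hochschild_diff A k g xs)"
    and "co (hochschild_diff A k (scale_cochain k c f) xs) = scl c (co (hochschild_diff A k f xs))"
proof -
  note a = hochschild_args[OF xs]
  have s: "scl a (scl b x) = scl b (scl a x)" for a b and x :: "walk_type \<Rightarrow> complex"
    by (simp add: scl_scl mult.commute)
  show "co (hochschild_diff A k (plus_cochain k f g) xs) =
      co (hochschild_diff A k f xs) + co (hochschild_diff A k g xs)" if g: "g \<in> multilinear_maps A k"
  proof -
    have "(\<Sum>i\<in>{..<k}. scl ((-1) ^ Suc i) (co (plus_cochain k f g (take i xs @ [xs ! i \<otimes>\<^bsub>A\<^esub> xs ! Suc i] @ drop (i + 2) xs)))) =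
      (\<Sum>i\<in>{..<k}. scl ((-1) ^ Suc i) (co (f (take i xs @ [xs ! i \<otimes>\<^bsub>A\<^esub> xs ! Suc i] @ drop (i + 2) xs)))) +
      (\<Sum>i\<in>{..<k}. scl ((-1) ^ Suc i) (co (g (take i xs @ [xs ! i \<otimes>\<^bsub>A\<^esub> xs ! Suc i] @ drop (i + 2) xs))))"
      unfolding sum.distrib[symmetric] using a(5) f g
      by (intro sum.cong refl) (simp only: co_cochain scl_add lessThan_iff)
    thus ?thesis
      unfolding co_hochschild[OF cochain_multilinear(1)[OF f g] xs, THEN conjunct2]
        co_hochschild[OF f xs, THEN conjunct2] co_hochschild[OF g xs, THEN conjunct2]
      using a f g by (simp add: co_cochain star_simps scl_add algebra_simps)
  qed
  have "(\<Sum>i\<in>{..<k}. scl ((-1) ^ Suc i) (co (scale_cochain k c f (take i xs @ [xs ! i \<otimes>\<^bsub>A\<^esub> xs ! Suc i] @ drop (i + 2) xs)))) =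
      scl c (\<Sum>i\<in>{..<k}. scl ((-1) ^ Suc i) (co (f (take i xs @ [xs ! i \<otimes>\<^bsub>A\<^esub> xs ! Suc i] @ drop (i + 2) xs))))"
    unfolding scl_sum using a(5) f
    by (intro sum.cong refl) (simp only: co_cochain s[of c] lessThan_iff)
  thus "co (hochschild_diff A k (scale_cochain k c f) xs) = scl c (co (hochschild_diff A k f xs))"
    unfolding co_hochschild[OF cochain_multilinear(2)[OF f] xs, THEN conjunct2]
      co_hochschild[OF f xs, THEN conjunct2]
    using a f by (simp add: co_cochain star_scl scl_add s[of c])
qed

lemma cocycle_closed:
  assumes "f \<in> cocycles A k"
  shows "g \<in> cocycles A k \<Longrightarrow> plus_cochain k f g \<in> cocycles A k" "scale_cochain k c f \<in> cocycles A k"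
  using assms by (simp_all add: cocycle_iff cochain_multilinear hochschild_linear)

lemma zero_cocycle: "zero_cochain k \<in> cocycles A k"
proof -
  have "zero_cochain k = scale_cochain k 0 (zero_cochain k)"
  proof (rule ext)
    fix xs
    show "zero_cochain k xs = scale_cochain k 0 (zero_cochain k) xs"
      using co_smult[OF co_zero(1), of 0] co_zero
      by (auto simp: zero_cochain_def scale_cochain_def intro!: co_inj)
  qed
  hence "co (hochschild_diff A k (zero_cochain k) xs) = 0" if "xs \<in> arguments A (Suc k)" for xs
    using hochschild_linear(2)[OF zero_multilinear that, of 0] by simp
  thus ?thesis by (simp add: cocycle_iff zero_multilinear)
qed

lemma cocycle_space_group: "abelian_group (cocycle_space k)"
proof (rule abelian_group_by_embedding[of "\<lambda>f xs. if xs \<in> arguments A k then co (f xs) else 0"])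
  show "inj_on (\<lambda>f xs. if xs \<in> arguments A k then co (f xs) else 0) (carrier (cocycle_space k))"
  proof (rule inj_onI)
    fix f g assume fg: "f \<in> carrier (cocycle_space k)" "g \<in> carrier (cocycle_space k)"
      and eq: "(\<lambda>xs. if xs \<in> arguments A k then co (f xs) else 0) = (\<lambda>xs. if xs \<in> arguments A k then co (g xs) else 0)"
    have m: "f \<in> multilinear_maps A k" "g \<in> multilinear_maps A k" using fg by (simp_all add: cocycle_iff)
    show "f = g"
    proof (rule PiE_ext)
      show "f \<in> arguments A k \<rightarrow>\<^sub>E carrier A" "g \<in> arguments A k \<rightarrow>\<^sub>E carrier A"
        using m by (simp_all add: multilinear_maps_def)
      fix xs assume xs: "xs \<in> arguments A k"
      thus "f xs = g xs" using fun_cong[OF eq, of xs] m by (intro co_inj) (simp_all add: multilinear_closed)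
    qed
  qed
next
  fix f g assume fg: "f \<in> carrier (cocycle_space k)" "g \<in> carrier (cocycle_space k)"
  hence m: "f \<in> multilinear_maps A k" "g \<in> multilinear_maps A k" by (simp_all add: cocycle_iff)
  show "f \<oplus>\<^bsub>cocycle_space k\<^esub> g \<in> carrier (cocycle_space k) \<and>
    (\<lambda>xs. if xs \<in> arguments A k then co ((f \<oplus>\<^bsub>cocycle_space k\<^esub> g) xs) else 0) =
    (\<lambda>xs. if xs \<in> arguments A k then co (f xs) else 0) + (\<lambda>xs. if xs \<in> arguments A k then co (g xs) else 0)"
    using cocycle_closed(1)[of f k g] fg by (simp add: fun_eq_iff pointwise co_cochain(1)[OF _ m])
next
  fix f assume f: "f \<in> carrier (cocycle_space k)"
  show "\<exists>g\<in>carrier (cocycle_space k). (\<lambda>xs. if xs \<in> arguments A k then co (g xs) else 0) =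
      - (\<lambda>xs. if xs \<in> arguments A k then co (f xs) else 0)"
  proof
    have m: "f \<in> multilinear_maps A k" using f by (simp add: cocycle_iff)
    show "(\<lambda>xs. if xs \<in> arguments A k then co (scale_cochain k (-1) f xs) else 0) =
      - (\<lambda>xs. if xs \<in> arguments A k then co (f xs) else 0)"
      by (simp add: fun_eq_iff pointwise co_cochain(2)[OF _ m])
    show "scale_cochain k (-1) f \<in> carrier (cocycle_space k)" using f cocycle_closed(2) by simp
  qed
qed (auto simp: zero_cocycle fun_eq_iff pointwise co_cochain)

end

section \<open>Second cohomology\<close>

context T_coordinates
begin

text \<open>
  A 2-cochain as a bilinear map of the model.
\<close>
definition coords2 :: "('v list \<Rightarrow> 'v) \<Rightarrow> (walk_type \<Rightarrow> complex) \<Rightarrow> (walk_type \<Rightarrow> complex) \<Rightarrow> walk_type \<Rightarrow> complex" where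
  "coords2 f x y = co (f [elt x, elt y])"

lemma restr_star [simp]: "restr (x \<star> y) = x \<star> y"
  by (rule restr_id) simp

lemma coords2_in_M: "f \<in> multilinear_maps A 2 \<Longrightarrow> coords2 f x y \<in> M"
  unfolding coords2_def by (intro co_in_M multilinear_closed) (auto simp: args_2)

lemma coords2_bilinear:
  assumes f: "f \<in> multilinear_maps A 2"
  shows "bilinear_map (coords2 f)"
proof -
  have a: "[elt x, elt y] \<in> arguments A 2" for x y by (simp add: args_2)
  have f1: "co (f ([elt x, elt y][i := X \<oplus>\<^bsub>A\<^esub> Y])) = co (f ([elt x, elt y][i := X])) + co (f ([elt x, elt y][i := Y]))"
    if "i < 2" "X \<in> carrier A" "Y \<in> carrier A" for i x y X Y
    using f a that unfolding multilinear_iff by blast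
  have f2: "co (f ([elt x, elt y][i := c \<odot>\<^bsub>A\<^esub> X])) = scl c (co (f ([elt x, elt y][i := X])))"
    if "i < 2" "X \<in> carrier A" for i x y X c
    using f a that unfolding multilinear_iff by blast
  show ?thesis
    unfolding bilinear_map_def linear_map_def coords2_def elt_add elt_scl
    using f1[of 0] f1[of 1] f2[of 0] f2[of 1] by simp
qed

lemma co_hochschild_2:
  assumes f: "f \<in> multilinear_maps A 2"
  shows "co (hochschild_diff A 2 f [elt x, elt y, elt z]) = hochschild2 (coords2 f) x y z"
proof -
  have "[elt x, elt y, elt z] \<in> arguments A (Suc 2)" unfolding args_3 by simp
  from co_hochschild[OF f this] show ?thesis
    by (simp add: hochschild2_def coords2_def elt_star numeral_2_eq_2 scl_minus1 lessThan_Suc)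
qed

lemma co_hochschild_1:
  assumes f: "f \<in> multilinear_maps A (Suc 0)"
  shows "co (hochschild_diff A (Suc 0) f [elt x, elt y]) = coboundary (\<lambda>x. co (f [elt x])) x y"
proof -
  have "[elt x, elt y] \<in> arguments A (Suc (Suc 0))" using args_2 by (simp add: numeral_2_eq_2)
  from co_hochschild[OF f this] show ?thesis
    by (simp add: coboundary_def elt_star scl_minus1 lessThan_Suc)
qed

lemma co_hochschild_0:
  assumes f: "f \<in> multilinear_maps A 0"
  shows "co (hochschild_diff A 0 f [elt x]) = x \<star> co (f []) - co (f []) \<star> x"
proof -
  have "[elt x] \<in> arguments A (Suc 0)" by (simp add: args_1)
  from co_hochschild[OF f this] show ?thesis by (simp add: scl_minus1)
qed

lemma cocycle_2_iff:
  "f \<in> cocycles A 2 \<longleftrightarrow> f \<in> multilinear_maps A 2 \<and> (\<forall>x y z. hochschild2 (coords2 f) x y z = 0)"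
proof -
  have "(\<forall>xs\<in>arguments A (Suc 2). co (hochschild_diff A 2 f xs) = 0) \<longleftrightarrow>
      (\<forall>x y z. co (hochschild_diff A 2 f [elt x, elt y, elt z]) = 0)"
    unfolding args_3 Ball_def
    by (metis elt_co elt_closed)
  thus ?thesis unfolding cocycle_iff using co_hochschild_2[of f] by auto
qed

lemma cocycle_0_iff:
  "f \<in> cocycles A 0 \<longleftrightarrow> f \<in> multilinear_maps A 0 \<and> (\<forall>y. co (f []) \<star> y = y \<star> co (f []))"
proof -
  have "(\<forall>xs\<in>arguments A (Suc 0). co (hochschild_diff A 0 f xs) = 0) \<longleftrightarrow>
      (\<forall>x. co (hochschild_diff A 0 f [elt x]) = 0)"
    unfolding args_1 Ball_def
    by (metis elt_co elt_closed)
  thus ?thesis unfolding cocycle_iff using co_hochschild_0[of f] by auto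
qed

definition cochain_of1 :: "((walk_type \<Rightarrow> complex) \<Rightarrow> walk_type \<Rightarrow> complex) \<Rightarrow> 'v list \<Rightarrow> 'v" where
  "cochain_of1 b = (\<lambda>xs\<in>arguments A (Suc 0). elt (b (co (hd xs))))"

definition cochain_of2 :: "((walk_type \<Rightarrow> complex) \<Rightarrow> (walk_type \<Rightarrow> complex) \<Rightarrow> walk_type \<Rightarrow> complex) \<Rightarrow> 'v list \<Rightarrow> 'v" where
  "cochain_of2 b = (\<lambda>xs\<in>arguments A 2. elt (b (co (xs ! 0)) (co (xs ! 1))))"

lemma cochain_of1_multilinear:
  assumes b: "linear_map b" "\<And>x. b x \<in> M"
  shows "cochain_of1 b \<in> multilinear_maps A (Suc 0)"
  unfolding multilinear_iff
proof (intro conjI ballI allI impI)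
  show "cochain_of1 b \<in> arguments A (Suc 0) \<rightarrow>\<^sub>E carrier A" by (auto simp: cochain_of1_def)
qed (use b co_add co_smult in \<open>auto simp: cochain_of1_def args_1 linear_map_def restr_id\<close>)

lemma pair_arguments: "[X, Y] \<in> arguments A 2 \<longleftrightarrow> X \<in> carrier A \<and> Y \<in> carrier A"
  by (simp add: args_2)

lemma cochain_of2_multilinear:
  assumes b: "bilinear_map b" "\<And>x y. b x y \<in> M"
  shows "cochain_of2 b \<in> multilinear_maps A 2"
  unfolding multilinear_iff
proof (intro conjI ballI allI impI)
  show "cochain_of2 b \<in> arguments A 2 \<rightarrow>\<^sub>E carrier A" by (auto simp: cochain_of2_def)
next
  fix xs and i :: nat and X Y assume xs: "xs \<in> arguments A 2" "i < 2" "X \<in> carrier A" "Y \<in> carrier A"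
  obtain U V where u: "xs = [U, V]" "U \<in> carrier A" "V \<in> carrier A" using xs(1) by (auto simp: args_2)
  have "i = 0 \<or> i = 1" using xs(2) by auto
  thus "co (cochain_of2 b (xs[i := X \<oplus>\<^bsub>A\<^esub> Y])) = co (cochain_of2 b (xs[i := X])) + co (cochain_of2 b (xs[i := Y]))"
    using linear_map_add[OF bilinear_map_left[OF b(1)]] linear_map_add[OF bilinear_map_right[OF b(1)]]
      xs co_add[OF xs(3,4)] u b(2) by (auto simp: cochain_of2_def pair_arguments restr_id)
next
  fix xs and i :: nat and X c assume xs: "xs \<in> arguments A 2" "i < 2" "X \<in> carrier A"
  obtain U V where u: "xs = [U, V]" "U \<in> carrier A" "V \<in> carrier A" using xs(1) by (auto simp: args_2)
  have "i = 0 \<or> i = 1" using xs(2) by auto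
  thus "co (cochain_of2 b (xs[i := c \<odot>\<^bsub>A\<^esub> X])) = scl c (co (cochain_of2 b (xs[i := X])))"
    using linear_map_scl[OF bilinear_map_left[OF b(1)]] linear_map_scl[OF bilinear_map_right[OF b(1)]]
      xs co_smult[OF xs(3)] u b(2) by (auto simp: cochain_of2_def pair_arguments restr_id)
qed

lemma coords2_cochain_of2: "(\<And>x y. b x y \<in> M) \<Longrightarrow> coords2 (cochain_of2 b) x y = b (restr x) (restr y)"
  by (simp add: coords2_def cochain_of2_def args_2 restr_id)

lemma cochain_of2_cocycle:
  assumes b: "bilinear_map b" "\<And>x y. b x y \<in> M" "\<And>x y z. hochschild2 b x y z = 0"
  shows "cochain_of2 b \<in> cocycles A 2"
proof -
  have "hochschild2 (coords2 (cochain_of2 b)) x y z = hochschild2 b (restr x) (restr y) (restr z)" for x y z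
    by (simp add: hochschild2_def coords2_cochain_of2 b(2))
  thus ?thesis using b by (simp add: cocycle_2_iff cochain_of2_multilinear)
qed

lemma obstruction_cochain_of2: "(\<And>x y. b x y \<in> M) \<Longrightarrow> obstruction (coords2 (cochain_of2 b)) j = obstruction b j"
  by (simp add: obstruction_def relator_def coords2_cochain_of2 up_def down_def lp_def restr_id)

definition obstructions :: "('v list \<Rightarrow> 'v) \<Rightarrow> nat \<Rightarrow> complex" where
  "obstructions f = (\<lambda>j. if j \<in> {1..n} then obstruction (coords2 f) j else 0)"

lemma obstructions_add:
  assumes "f \<in> multilinear_maps A 2" "g \<in> multilinear_maps A 2"
  shows "obstructions (plus_cochain 2 f g) = obstructions f + obstructions g"
proof -
  have "coords2 (plus_cochain 2 f g) x y = coords2 f x y + coords2 g x y" for x y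
    using co_cochain(1)[of "[elt x, elt y]" 2 f g] assms by (simp add: coords2_def args_2)
  thus ?thesis
    by (simp add: fun_eq_iff obstructions_def obstruction_def relator_def pointwise sum_fun_apply
        sum.distrib sum_subtractf algebra_simps)
qed

lemma obstructions_scale:
  assumes "f \<in> multilinear_maps A 2"
  shows "obstructions (scale_cochain 2 c f) = scl c (obstructions f)"
proof -
  have "coords2 (scale_cochain 2 c f) x y = scl c (coords2 f x y)" for x y
    using co_cochain(2)[of "[elt x, elt y]" 2 f c] assms by (simp add: coords2_def args_2)
  thus ?thesis
    by (simp add: fun_eq_iff obstructions_def obstruction_def relator_def pointwise sum_fun_apply
        sum_distrib_left algebra_simps)
qed

text \<open>
  One inclusion is \<open>obstruction_coboundary\<close>, the other is \<open>coboundary_criterion\<close>; the rest transports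
  between the algebra and the model.
\<close>
lemma coboundaries_2: "coboundaries A 2 = {f \<in> cocycles A 2. obstructions f = 0}"
proof -
  have cob: "coboundaries A 2 = hochschild_diff A (Suc 0) ` multilinear_maps A (Suc 0)"
    by (simp add: numeral_2_eq_2 cochains_def)
  have "f \<in> cocycles A 2 \<and> obstructions f = 0" if "f \<in> coboundaries A 2" for f
  proof -
    obtain g where g: "g \<in> multilinear_maps A (Suc 0)" "f = hochschild_diff A (Suc 0) g"
      using \<open>f \<in> coboundaries A 2\<close> unfolding cob by blast
    let ?g = "\<lambda>x. co (g [elt x])"
    have lin: "linear_map ?g"
    proof -
      have a: "[elt x] \<in> arguments A (Suc 0)" for x by (simp add: args_1)
      have "co (g ([elt x][0 := X \<oplus>\<^bsub>A\<^esub> Y])) = co (g ([elt x][0 := X])) + co (g ([elt x][0 := Y]))"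
        if "X \<in> carrier A" "Y \<in> carrier A" for x X Y
        using g(1) a that unfolding multilinear_iff by blast
      moreover have "co (g ([elt x][0 := c \<odot>\<^bsub>A\<^esub> X])) = scl c (co (g ([elt x][0 := X])))"
        if "X \<in> carrier A" for x X c
        using g(1) a that unfolding multilinear_iff by blast
      ultimately show ?thesis unfolding linear_map_def elt_add elt_scl by simp
    qed
    have in_M: "?g x \<in> M" for x
      using g(1) by (intro co_in_M multilinear_closed) (auto simp: args_1)
    have co_f: "coords2 f x y = coboundary ?g x y" for x y
      unfolding coords2_def g(2) by (rule co_hochschild_1[OF g(1)])
    have "f = cochain_of2 (coboundary ?g)"
    proof (rule ext)
      fix xs
      show "f xs = cochain_of2 (coboundary ?g) xs"
      proof (cases "xs \<in> arguments A 2")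
        case True
        then obtain X Y where X: "xs = [X, Y]" "X \<in> carrier A" "Y \<in> carrier A" by (auto simp: args_2)
        have "f xs \<in> carrier A"
          using co_hochschild[OF g(1), of xs] True g(2) by (simp add: numeral_2_eq_2)
        moreover have "co (f xs) = coboundary ?g (co X) (co Y)"
          using co_f[of "co X" "co Y"] X by (simp add: coords2_def elt_co)
        ultimately show ?thesis
          using True X coboundary_in_M[OF in_M] by (intro co_inj) (simp_all add: cochain_of2_def restr_id)
      next
        case False
        thus ?thesis unfolding g(2) by (simp add: hochschild_diff_def cochain_of2_def numeral_2_eq_2)
      qed
    qed
    hence "f \<in> cocycles A 2"
      using cochain_of2_cocycle[OF coboundary_bilinear[OF lin] coboundary_in_M[OF in_M] coboundary_cocycle[OF lin]] by simp
    moreover have "obstruction (coords2 f) j = 0" for j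
      using obstruction_coboundary[OF lin, of j] by (simp add: obstruction_def relator_def co_f)
    ultimately show ?thesis by (simp add: obstructions_def fun_eq_iff pointwise)
  qed
  moreover have "f \<in> coboundaries A 2" if f: "f \<in> cocycles A 2" "obstructions f = 0" for f
  proof -
    have m: "f \<in> multilinear_maps A 2" and c: "\<And>x y z. hochschild2 (coords2 f) x y z = 0"
      using f(1) by (simp_all add: cocycle_2_iff)
    have "obstruction (coords2 f) j = 0" if "j \<in> {1..n}" for j
      using fun_cong[OF f(2), of j] that by (simp add: obstructions_def pointwise)
    then obtain F where F: "linear_map F" "\<And>x. F x \<in> M"
        "\<And>x y. x \<in> M \<Longrightarrow> y \<in> M \<Longrightarrow> coords2 f x y = coboundary F x y"
      using coboundary_criterion[OF coords2_bilinear[OF m] c coords2_in_M[OF m]] by blast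
    let ?g = "cochain_of1 F"
    have g: "?g \<in> multilinear_maps A (Suc 0)" by (rule cochain_of1_multilinear[OF F(1,2)])
    have cg: "co (?g [elt x]) = F (restr x)" for x
      by (simp add: cochain_of1_def args_1 restr_id F)
    have "f = hochschild_diff A (Suc 0) ?g"
    proof (rule ext)
      fix xs
      show "f xs = hochschild_diff A (Suc 0) ?g xs"
      proof (cases "xs \<in> arguments A 2")
        case True
        then obtain X Y where X: "xs = [X, Y]" "X \<in> carrier A" "Y \<in> carrier A" by (auto simp: args_2)
        have "co (hochschild_diff A (Suc 0) ?g [elt (co X), elt (co Y)]) = coboundary F (co X) (co Y)"
          using co_in_M[OF X(2)] co_in_M[OF X(3)]
          unfolding co_hochschild_1[OF g] coboundary_def cg by (simp add: restr_id)
        also have "\<dots> = coords2 f (co X) (co Y)" using F(3) X co_in_M by simp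
        finally show ?thesis
          using co_hochschild[OF g, of xs] True multilinear_closed[OF m True] X
          by (intro co_inj) (simp_all add: coords2_def elt_co numeral_2_eq_2)
      next
        case False
        moreover have "f \<in> extensional (arguments A 2)" using m by (auto simp: multilinear_maps_def PiE_def)
        ultimately show ?thesis by (simp add: hochschild_diff_def extensional_def numeral_2_eq_2)
      qed
    qed
    thus ?thesis unfolding cob using g by blast
  qed
  ultimately show ?thesis by blast
qed

text \<open>
  The obstruction of \<open>deformation j\<close> is 2 at \<open>j\<close>, so the coefficients are halved.
\<close>
definition deformation_with :: "(nat \<Rightarrow> complex) \<Rightarrow> (walk_type \<Rightarrow> complex) \<Rightarrow> (walk_type \<Rightarrow> complex) \<Rightarrow> walk_type \<Rightarrow> complex" where
  "deformation_with g x y = (\<Sum>j\<in>{1..n}. scl (g j / 2) (deformation j x y))"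

lemma deformation_with_in_M [simp]: "deformation_with g x y \<in> M"
  unfolding deformation_with_def by (intro M_sum M_scl deformation_in_M)

lemma deformation_with_bilinear: "bilinear_map (deformation_with g)"
proof -
  have "linear_map (\<lambda>x. scl k (f x))" if "linear_map f" for k and f :: "(walk_type \<Rightarrow> complex) \<Rightarrow> walk_type \<Rightarrow> complex"
    using that by (simp add: linear_map_def scl_add scl_scl mult.commute)
  thus ?thesis
    unfolding bilinear_map_def deformation_with_def
    using deformation_bilinear by (auto intro!: linear_sum simp: bilinear_map_def)
qed

lemma deformation_with_cocycle: "hochschild2 (deformation_with g) x y z = 0"
proof -
  have "hochschild2 (deformation_with g) x y z = (\<Sum>j\<in>{1..n}. scl (g j / 2) (hochschild2 (deformation j) x y z))"
    unfolding hochschild2_def deformation_with_def star_sum_left star_sum_right star_scl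
    by (simp only: scl_add scl_diff sum.distrib sum_subtractf)
  thus ?thesis by (simp add: deformation_cocycle)
qed

lemma obstruction_deformation_with:
  assumes k: "k \<in> {1..n}"
  shows "obstruction (deformation_with g) k = g k"
proof -
  let ?d = "\<lambda>j x y. deformation j x y (k, k, 0)"
  have "obstruction (deformation_with g) k =
     (\<Sum>i\<in>{1..<n}. \<Sum>j\<in>{1..n}. g j / 2 * ?d j (up i) (down i)) - (\<Sum>i\<in>{1..<n}. \<Sum>j\<in>{1..n}. g j / 2 * ?d j (down i) (up i))
      - (\<Sum>j\<in>{1..n}. g j / 2 * ?d j lp lp)"
    unfolding obstruction_def relator_def deformation_with_def pointwise sum_fun_apply sum_subtractf scl_apply ..
  also have "\<dots> = (\<Sum>j\<in>{1..n}. \<Sum>i\<in>{1..<n}. g j / 2 * ?d j (up i) (down i)) - (\<Sum>j\<in>{1..n}. \<Sum>i\<in>{1..<n}. g j / 2 * ?d j (down i) (up i))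
      - (\<Sum>j\<in>{1..n}. g j / 2 * ?d j lp lp)"
    by (simp only: sum.swap[of _ "{1..n}" "{1..<n}"])
  also have "\<dots> = (\<Sum>j\<in>{1..n}. g j / 2 * obstruction (deformation j) k)"
    unfolding obstruction_def relator_def pointwise sum_fun_apply sum_subtractf right_diff_distrib sum_distrib_left ..
  also have "\<dots> = (\<Sum>j\<in>{1..n}. if j = k then g k else 0)"
    using k by (intro sum.cong refl) (simp add: obstruction_deformation)
  finally show ?thesis using k by simp
qed

text \<open>
  The deformation takes two steps off the composite, so it is homogeneous of degree \<open>-2\<close>.
\<close>
lemma deformation_degree:
  assumes "deformation_with g x y (u, v, d) \<noteq> 0"
  shows "\<exists>a b. x a \<noteq> 0 \<and> y b \<noteq> 0 \<and> snd (snd b) + snd (snd a) = d + 2"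
proof -
  have "(\<Sum>j\<in>{1..n}. g j / 2 * deformation j x y (u, v, d)) \<noteq> 0"
    using assms unfolding deformation_with_def sum_fun_apply scl_apply .
  then obtain j where "g j / 2 * deformation j x y (u, v, d) \<noteq> 0"
    by (rule sum.not_neutral_contains_not_neutral)
  hence "(\<Sum>a\<in>I. \<Sum>b\<in>I. x a * y b * deform_const j a b (u, v, d)) \<noteq> 0"
    unfolding deformation_def structure_product_def by simp
  then obtain a where "(\<Sum>b\<in>I. x a * y b * deform_const j a b (u, v, d)) \<noteq> 0"
    by (rule sum.not_neutral_contains_not_neutral)
  then obtain b where ab: "x a * y b * deform_const j a b (u, v, d) \<noteq> 0"
    by (rule sum.not_neutral_contains_not_neutral)
  hence "deform_const j a b (u, v, d) \<noteq> 0" by simp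
  hence "join_type a b = (u, v, d + 2)"
    by (simp add: deform_const_def split: if_splits)
  thus ?thesis using ab by (intro exI[of _ a] exI[of _ b]) (simp add: join_type_def)
qed

definition deformation_cochain where
  "deformation_cochain g = cochain_of2 (deformation_with g)"

lemma deformation_cochain_cocycle: "deformation_cochain g \<in> cocycles A 2"
  unfolding deformation_cochain_def
  by (intro cochain_of2_cocycle deformation_with_bilinear deformation_with_in_M deformation_with_cocycle)

lemma obstructions_deformation_cochain:
  "(\<And>i. i \<notin> {1..n} \<Longrightarrow> g i = 0) \<Longrightarrow> obstructions (deformation_cochain g) = g"
  by (auto simp: fun_eq_iff obstructions_def deformation_cochain_def obstruction_cochain_of2 obstruction_deformation_with)

lemma deformation_cochain_homogeneous: "deformation_cochain g \<in> homogeneous_maps A 2 (-2)"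
  unfolding homogeneous_maps_def
proof (intro CollectI conjI allI impI)
  show "deformation_cochain g \<in> multilinear_maps A 2"
    using deformation_cochain_cocycle by (simp add: cocycle_2_iff)
  fix ds xs assume h: "list_all2 (\<lambda>x e. x \<in> gr A e) xs ds \<and> xs \<in> arguments A 2"
  then obtain X Y where X: "xs = [X, Y]" "X \<in> carrier A" "Y \<in> carrier A" by (auto simp: args_2)
  with h obtain d e where d: "ds = [d, e]" "X \<in> gr A d" "Y \<in> gr A e"
    by (auto simp: list_all2_Cons1)
  have val: "co (deformation_cochain g xs) = deformation_with g (co X) (co Y)"
    using X by (simp add: deformation_cochain_def cochain_of2_def args_2 restr_id)
  show "deformation_cochain g xs \<in> gr A (sum_list ds + - 2)"
    unfolding co_gr val
  proof (intro conjI allI impI)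
    show "deformation_cochain g xs \<in> carrier A"
      using X by (simp add: deformation_cochain_def cochain_of2_def args_2)
    fix u v f assume "deformation_with g (co X) (co Y) (u, v, f) \<noteq> 0"
    then obtain a b where ab: "co X a \<noteq> 0" "co Y b \<noteq> 0" "snd (snd b) + snd (snd a) = f + 2"
      using deformation_degree by blast
    have "int (snd (snd a)) = d" "int (snd (snd b)) = e"
      using ab(1,2) d(2,3) unfolding co_gr by (metis prod.collapse)+
    thus "int f = sum_list ds + - 2" using ab(3) by (simp add: d(1))
  qed
qed

text \<open>
  The arguments in the relator have total degree 2 and the idempotents have degree 0, so only the part of
  degree \<open>-2\<close> is seen.
\<close>
lemma obstructions_homogeneous:
  assumes f: "f \<in> homogeneous_maps A 2 d" and d: "d \<noteq> -2"
  shows "obstructions f = 0"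
proof -
  have 0: "coords2 f (ev (u, v, 1)) (ev (u', v', 1)) (j, j, 0) = 0" for u v u' v' j
  proof -
    have "elt (ev (u, v, 1)) \<in> gr A 1" for u v
      unfolding co_gr by (auto simp: restr_id) (auto simp: ev_def)
    hence "list_all2 (\<lambda>x e. x \<in> gr A e) [elt (ev (u, v, 1)), elt (ev (u', v', 1))] [1, 1]"
      by simp
    moreover have "[elt (ev (u, v, 1)), elt (ev (u', v', 1))] \<in> arguments A 2"
      by (simp add: args_2)
    ultimately have "f [elt (ev (u, v, 1)), elt (ev (u', v', 1))] \<in> gr A (sum_list [1, 1] + d)"
      using f unfolding homogeneous_maps_def by blast
    moreover have "int 0 \<noteq> sum_list [1, 1] + d" using d by simp
    ultimately show ?thesis unfolding co_gr coords2_def by metis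
  qed
  show ?thesis
    by (auto simp: fun_eq_iff obstructions_def obstruction_def relator_def pointwise sum_fun_apply up_def down_def lp_def
        0[simplified] intro!: sum.neutral)
qed

lemma coset_eq_2:
  assumes "f \<in> cocycles A 2"
  shows "coboundaries A 2 +>\<^bsub>cocycle_space 2\<^esub> f = {g \<in> cocycles A 2. obstructions g = obstructions f}"
  using kernel_coset[OF cocycle_space_group[of 2], of obstructions f] assms obstructions_add
  unfolding coboundaries_2 by (simp add: cocycle_2_iff)

text \<open>
  The obstructions identify the cohomology with functions on the vertices. A class is represented by
  \<open>deformation_cochain\<close> of its obstructions, which is homogeneous, so the component of degree \<open>-2\<close> is
  everything; the other components have zero obstructions.
\<close>
theorem HH2_dimension:
  fixes K
  assumes K: "K = gshift 2 (HH 2 A)"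
  shows "vectorspace.fin_dim CC K \<and> vectorspace.dim CC K = n \<and> concentrated_in_degree 0 K"
proof -
  have K_simps: "carrier K = (\<lambda>f. coboundaries A 2 +>\<^bsub>cocycle_space 2\<^esub> f) ` cocycles A 2"
    "add K = add (quotient_module (cocycle_space 2) (coboundaries A 2))"
    "smult K = smult (quotient_module (cocycle_space 2) (coboundaries A 2))"
    "\<zero>\<^bsub>K\<^esub> = coboundaries A 2"
    "gr K d = (\<lambda>f. coboundaries A 2 +>\<^bsub>cocycle_space 2\<^esub> f) ` (cocycles A 2 \<inter> homogeneous_maps A 2 (d - 2))" for d
    by (auto simp: K gshift_def HH_eq quotient_module_def A_RCOSETS_def')
  have m: "f \<in> multilinear_maps A 2" if "f \<in> cocycles A 2" for f using that by (simp add: cocycle_2_iff)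
  have "vectorspace.fin_dim CC K \<and> vectorspace.dim CC K = card {1..n}"
  proof (rule quotient_dimension[where Mo = "cocycle_space 2" and E = obstructions and L = obstructions
        and W = "cocycles A 2" and N = "coboundaries A 2"])
    show "obstructions ` cocycles A 2 = {g. \<forall>i. i \<notin> {1..n} \<longrightarrow> g i = 0}"
    proof
      show "obstructions ` cocycles A 2 \<subseteq> {g. \<forall>i. i \<notin> {1..n} \<longrightarrow> g i = 0}"
        by (auto simp: obstructions_def)
      show "{g. \<forall>i. i \<notin> {1..n} \<longrightarrow> g i = 0} \<subseteq> obstructions ` cocycles A 2"
      proof
        fix g :: "nat \<Rightarrow> complex" assume "g \<in> {g. \<forall>i. i \<notin> {1..n} \<longrightarrow> g i = 0}"
        hence "g = obstructions (deformation_cochain g)" by (intro obstructions_deformation_cochain[symmetric]) blast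
        thus "g \<in> obstructions ` cocycles A 2" using deformation_cochain_cocycle by blast
      qed
    qed
  qed (simp_all add: K_simps cocycle_space_group coboundaries_2 cocycle_closed zero_cocycle
        obstructions_add obstructions_scale m)
  moreover have "concentrated_in_degree 0 K"
    unfolding concentrated_in_degree_def K_simps
  proof (intro conjI allI impI)
    show "(\<lambda>f. coboundaries A 2 +>\<^bsub>cocycle_space 2\<^esub> f) ` (cocycles A 2 \<inter> homogeneous_maps A 2 (0 - 2))
       = (\<lambda>f. coboundaries A 2 +>\<^bsub>cocycle_space 2\<^esub> f) ` cocycles A 2"
    proof
      show "(\<lambda>f. coboundaries A 2 +>\<^bsub>cocycle_space 2\<^esub> f) ` cocycles A 2 \<subseteq>
        (\<lambda>f. coboundaries A 2 +>\<^bsub>cocycle_space 2\<^esub> f) ` (cocycles A 2 \<inter> homogeneous_maps A 2 (0 - 2))"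
      proof (rule image_subsetI)
        fix f assume f: "f \<in> cocycles A 2"
        let ?g = "deformation_cochain (obstructions f)"
        have "obstructions ?g = obstructions f"
          by (rule obstructions_deformation_cochain) (auto simp: obstructions_def)
        hence "coboundaries A 2 +>\<^bsub>cocycle_space 2\<^esub> f = coboundaries A 2 +>\<^bsub>cocycle_space 2\<^esub> ?g"
          using f by (simp add: coset_eq_2 deformation_cochain_cocycle)
        thus "coboundaries A 2 +>\<^bsub>cocycle_space 2\<^esub> f \<in>
          (\<lambda>f. coboundaries A 2 +>\<^bsub>cocycle_space 2\<^esub> f) ` (cocycles A 2 \<inter> homogeneous_maps A 2 (0 - 2))"
          using deformation_cochain_cocycle deformation_cochain_homogeneous by simp
      qed
    qed auto
  next
    fix d :: int assume d: "d \<noteq> 0"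
    have "coboundaries A 2 +>\<^bsub>cocycle_space 2\<^esub> f = coboundaries A 2"
      if "f \<in> cocycles A 2 \<inter> homogeneous_maps A 2 (d - 2)" for f
      using that d obstructions_homogeneous[of f "d - 2"] coset_eq_2[of f] by (simp add: coboundaries_2)
    moreover have "zero_cochain 2 \<in> cocycles A 2 \<inter> homogeneous_maps A 2 (d - 2)"
      using zero_cocycle[of 2] zero_multilinear[of 2] co_zero
      by (auto simp: homogeneous_maps_def co_gr zero_cochain_def pointwise)
    ultimately show "(\<lambda>f. coboundaries A 2 +>\<^bsub>cocycle_space 2\<^esub> f) ` (cocycles A 2 \<inter> homogeneous_maps A 2 (d - 2)) = {coboundaries A 2}"
      by blast
  qed
  ultimately show ?thesis by simp
qed

end

section \<open>Zeroth cohomology\<close>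

context T_coordinates
begin

lemma homogeneous_0_iff: "f \<in> homogeneous_maps A 0 d \<longleftrightarrow> f \<in> multilinear_maps A 0 \<and> f [] \<in> gr A d"
  by (auto simp: homogeneous_maps_def args_0)

lemma multilinear_0_iff: "f \<in> multilinear_maps A 0 \<longleftrightarrow> f \<in> {[]} \<rightarrow>\<^sub>E carrier A"
proof -
  have "arguments A 0 = {[]}" by (auto simp: args_0)
  thus ?thesis by (simp add: multilinear_maps_def)
qed

text \<open>
  The cocycles that represent the component of degree \<open>d\<close> after the restriction to degrees below \<open>h - 2\<close>.
\<close>
definition centre_component :: "int \<Rightarrow> ('v list \<Rightarrow> 'v) set" where
  "centre_component d = (if d < 2 * int n - 1 then cocycles A 0 \<inter> homogeneous_maps A 0 d else {zero_cochain 0})"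

definition central_degree :: "int \<Rightarrow> bool" where
  "central_degree d \<longleftrightarrow> 0 \<le> d \<and> even d \<and> d < 2 * int n - 1"

text \<open>
  The index type is a singleton because each component is at most one-dimensional; the coordinate is the
  coefficient of the closed walk at \<open>n\<close>, where all even degrees below \<open>h - 2\<close> are admissible.
\<close>
definition centre_coordinate :: "int \<Rightarrow> ('v list \<Rightarrow> 'v) \<Rightarrow> unit \<Rightarrow> complex" where
  "centre_coordinate d f = (\<lambda>_. if central_degree d then co (f []) (n, n, nat d) else 0)"

lemma zero_cochain_0: "co (zero_cochain 0 []) = 0"
  by (simp add: co_cochain args_0)

lemma centre_component_value:
  assumes f: "f \<in> centre_component d"
  shows "co (f []) = scl (centre_coordinate d f ()) (central_element (nat d))"
proof (cases "d < 2 * int n - 1")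
  case True
  have f': "f \<in> cocycles A 0" "f [] \<in> gr A d"
    using f True by (auto simp: centre_component_def homogeneous_0_iff)
  have M: "co (f []) \<in> M" using f'(2) by (intro co_in_M) (simp add: co_gr)
  have central: "co (f []) \<star> y = y \<star> co (f [])" for y
    using f'(1) by (simp add: cocycle_0_iff)
  have deg: "int e = d" if "co (f []) (u, v, e) \<noteq> 0" for u v e
    using f'(2) that by (simp add: co_gr)
  hence deg': "e = nat d" if "co (f []) (u, v, e) \<noteq> 0" for u v e
    using that by fastforce
  consider "d < 0" | "0 \<le> d" "even (nat d)" | "0 \<le> d" "odd (nat d)" by linarith
  thus ?thesis
  proof cases
    case 1
    have "co (f []) r = 0" for r
      using deg 1 by (cases r) force
    thus ?thesis using 1 by (auto simp: centre_coordinate_def central_degree_def fun_eq_iff pointwise)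
  next
    case 2
    hence "central_degree d" using True by (auto simp: central_degree_def even_nat_iff)
    thus ?thesis using central_even[OF M central 2(2) deg'] by (simp add: centre_coordinate_def)
  next
    case 3
    have "nat d < 2 * n - 1" using True 3 by linarith
    hence "co (f []) = 0" by (rule central_odd[OF M central 3(2)]) (rule deg')
    thus ?thesis by (simp add: centre_coordinate_def pointwise)
  qed
next
  case False
  hence "f = zero_cochain 0" using f by (simp add: centre_component_def)
  thus ?thesis using False by (simp add: zero_cochain_0 centre_coordinate_def central_degree_def)
qed

definition centre_cochain :: "complex \<Rightarrow> nat \<Rightarrow> 'v list \<Rightarrow> 'v" where
  "centre_cochain c D = (\<lambda>xs\<in>arguments A 0. elt (scl c (central_element D)))"

lemma centre_cochain_component:
  assumes "central_degree d"
  shows "centre_cochain c (nat d) \<in> centre_component d"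
    and "centre_coordinate d (centre_cochain c (nat d)) = (\<lambda>_. c)"
proof -
  have d: "0 \<le> d" "even (nat d)" "d < 2 * int n - 1" "nat d < 2 * n - 1"
    using assms by (auto simp: central_degree_def even_nat_iff)
  have co: "co (centre_cochain c (nat d) []) = scl c (central_element (nat d))"
    by (simp add: centre_cochain_def args_0 restr_id M_scl)
  have m: "centre_cochain c (nat d) \<in> multilinear_maps A 0"
    by (auto simp: multilinear_0_iff centre_cochain_def args_0 PiE_def extensional_def)
  have "scl c (central_element (nat d)) \<star> y = y \<star> scl c (central_element (nat d))" for y
    using central_element_central[OF d(2), of "restr y"] by (simp add: star_scl)
  moreover have "centre_cochain c (nat d) [] \<in> gr A d"
    unfolding co_gr co using d(1)
    by (auto simp: centre_cochain_def args_0 central_element_apply)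
  ultimately show "centre_cochain c (nat d) \<in> centre_component d"
    using m d by (simp add: centre_component_def cocycle_0_iff homogeneous_0_iff co)
  show "centre_coordinate d (centre_cochain c (nat d)) = (\<lambda>_. c)"
    using assms by (simp add: centre_coordinate_def co central_element_top[OF d(2,4)])
qed

lemma centre_component_closed:
  assumes f: "f \<in> centre_component d"
  shows "g \<in> centre_component d \<Longrightarrow> plus_cochain 0 f g \<in> centre_component d"
    and "scale_cochain 0 c f \<in> centre_component d"
proof -
  have zero_plus: "\<zero>\<^bsub>A\<^esub> \<oplus>\<^bsub>A\<^esub> \<zero>\<^bsub>A\<^esub> = \<zero>\<^bsub>A\<^esub>"
    using co_add[OF co_zero(1) co_zero(1)] co_zero by (intro co_inj) simp_all
  have zero_scale: "c \<odot>\<^bsub>A\<^esub> \<zero>\<^bsub>A\<^esub> = \<zero>\<^bsub>A\<^esub>"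
    using co_smult[OF co_zero(1), of c] co_zero by (intro co_inj) simp_all
  have z: "plus_cochain 0 (zero_cochain 0) (zero_cochain 0) = zero_cochain 0"
      "scale_cochain 0 c (zero_cochain 0) = zero_cochain 0"
    using zero_plus zero_scale by (auto simp: fun_eq_iff plus_cochain_def scale_cochain_def zero_cochain_def)
  show "plus_cochain 0 f g \<in> centre_component d" if "g \<in> centre_component d"
  proof (cases "d < 2 * int n - 1")
    case True
    hence fg: "f \<in> cocycles A 0" "g \<in> cocycles A 0" "f [] \<in> gr A d" "g [] \<in> gr A d"
      using f that by (auto simp: centre_component_def homogeneous_0_iff)
    have m: "f \<in> multilinear_maps A 0" "g \<in> multilinear_maps A 0" using fg by (simp_all add: cocycle_iff)
    have p: "plus_cochain 0 f g [] = f [] \<oplus>\<^bsub>A\<^esub> g []" by (simp add: plus_cochain_def args_0)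
    have "plus_cochain 0 f g [] \<in> gr A d"
      unfolding p co_gr
    proof (intro conjI allI impI)
      have c: "f [] \<in> carrier A" "g [] \<in> carrier A" using fg by (simp_all add: co_gr)
      show "f [] \<oplus>\<^bsub>A\<^esub> g [] \<in> carrier A" using co_add[OF c] by simp
      fix u v e assume "co (f [] \<oplus>\<^bsub>A\<^esub> g []) (u, v, e) \<noteq> 0"
      hence "co (f []) (u, v, e) \<noteq> 0 \<or> co (g []) (u, v, e) \<noteq> 0"
        using co_add[OF c] by (auto simp: pointwise)
      thus "int e = d" using fg(3,4) unfolding co_gr by blast
    qed
    thus ?thesis
      using True fg cocycle_closed(1)[OF fg(1,2)] cochain_multilinear(1)[OF m]
      by (simp add: centre_component_def homogeneous_0_iff)
  qed (use f that z in \<open>simp add: centre_component_def\<close>)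
  show "scale_cochain 0 c f \<in> centre_component d"
  proof (cases "d < 2 * int n - 1")
    case True
    hence ff: "f \<in> cocycles A 0" "f [] \<in> gr A d"
      using f by (auto simp: centre_component_def homogeneous_0_iff)
    have m: "f \<in> multilinear_maps A 0" using ff by (simp_all add: cocycle_iff)
    have p: "scale_cochain 0 c f [] = c \<odot>\<^bsub>A\<^esub> f []" by (simp add: scale_cochain_def args_0)
    have "scale_cochain 0 c f [] \<in> gr A d"
      unfolding p using ff(2) co_smult[of "f []" c] unfolding co_gr by auto
    thus ?thesis
      using True ff cocycle_closed(2)[OF ff(1)] cochain_multilinear(2)[OF m]
      by (simp add: centre_component_def homogeneous_0_iff)
  qed (use f z in \<open>simp add: centre_component_def\<close>)
qed

lemma centre_component_cocycle: "f \<in> centre_component d \<Longrightarrow> f \<in> cocycles A 0"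
  by (auto simp: centre_component_def zero_cocycle split: if_splits)

lemma zero_centre_component: "zero_cochain 0 \<in> centre_component d"
  using zero_cocycle[of 0] zero_multilinear[of 0] co_zero
  by (auto simp: centre_component_def homogeneous_0_iff co_gr zero_cochain_def args_0 pointwise)

text \<open>
  The zero cochain is the only coboundary, and a 0-cochain is determined by its only value.
\<close>
lemma coboundaries_0: "coboundaries A 0 = {f \<in> cocycles A 0. co (f []) = 0}"
proof -
  have *: "f = zero_cochain 0" if "f \<in> cocycles A 0" "co (f []) = 0" for f
  proof (rule ext)
    fix xs
    have m: "f \<in> multilinear_maps A 0" using that(1) by (simp add: cocycle_iff)
    show "f xs = zero_cochain 0 xs"
    proof (cases "xs = []")
      case True
      thus ?thesis
        using that(2) multilinear_closed[OF m, of "[]"] co_zero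
        by (intro co_inj) (simp_all add: args_0 zero_cochain_def)
    next
      case False
      thus ?thesis using m by (auto simp: multilinear_0_iff zero_cochain_def args_0 PiE_def extensional_def)
    qed
  qed
  have "coboundaries A 0 = {zero_cochain 0}"
    by (simp add: cochains_def zero_cochain_def)
  also have "\<dots> = {f \<in> cocycles A 0. co (f []) = 0}"
  proof (intro equalityI subsetI)
    fix f assume "f \<in> {zero_cochain 0}"
    thus "f \<in> {f \<in> cocycles A 0. co (f []) = 0}"
      using zero_cocycle[of 0] zero_cochain_0 by simp
  next
    fix f assume "f \<in> {f \<in> cocycles A 0. co (f []) = 0}"
    thus "f \<in> {zero_cochain 0}" using *[of f] by blast
  qed
  finally show ?thesis .
qed

text \<open>
  A shift changes the component only through its index; it is included because dimensions are attached
  to the record that carries the shifted grading.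
\<close>
theorem HH0_component:
  fixes U d m
  defines "U \<equiv> gshift m (grestrict {d. d < 2 * int n - 1} (HH 0 A))"
  shows "vectorspace.fin_dim CC (gcomp U d)"
    and "vectorspace.dim CC (gcomp U d) = of_bool (central_degree (d - m))"
    and "\<not> central_degree (d - m) \<Longrightarrow> gr U d = {\<zero>\<^bsub>U\<^esub>}"
proof -
  let ?N = "coboundaries A 0"
  have mm: "f \<in> multilinear_maps A 0" if "f \<in> cocycles A 0" for f using that by (simp add: cocycle_iff)
  have co0: "co (plus_cochain 0 f g []) = co (f []) + co (g [])" "co (scale_cochain 0 c f []) = scl c (co (f []))"
    if "f \<in> cocycles A 0" "g \<in> cocycles A 0" for f g c
    using that by (simp_all add: co_cochain args_0 mm)
  have coset: "?N +>\<^bsub>cocycle_space 0\<^esub> f = {g \<in> cocycles A 0. co (g []) = co (f [])}" if "f \<in> cocycles A 0" for f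
    using kernel_coset[OF cocycle_space_group[of 0], of "\<lambda>f. co (f [])" f] that co0
    unfolding coboundaries_0 by simp
  have N0: "?N +>\<^bsub>cocycle_space 0\<^esub> zero_cochain 0 = ?N"
    using coset[OF zero_cocycle] by (simp add: coboundaries_0 zero_cochain_0 del: coboundaries.simps)
  have U_simps: "gr U d = (\<lambda>f. ?N +>\<^bsub>cocycle_space 0\<^esub> f) ` centre_component (d - m)"
    "add U = add (quotient_module (cocycle_space 0) ?N)"
    "smult U = smult (quotient_module (cocycle_space 0) ?N)"
    "\<zero>\<^bsub>U\<^esub> = ?N"
    using N0 by (auto simp: U_def gshift_def grestrict_def HH_eq quotient_module_def centre_component_def)
  note W = centre_component_cocycle[of _ "d - m"]
  have "vectorspace.fin_dim CC (gcomp U d) \<and> vectorspace.dim CC (gcomp U d) = card (if central_degree (d - m) then {()} else {})"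
  proof (rule quotient_dimension[where Mo = "cocycle_space 0" and E = "\<lambda>f. co (f [])" and L = "centre_coordinate (d - m)"
        and W = "centre_component (d - m)" and N = ?N])
    show "centre_coordinate (d - m) ` centre_component (d - m) = {g. \<forall>i. i \<notin> (if central_degree (d - m) then {()} else {}) \<longrightarrow> g i = 0}"
    proof (cases "central_degree (d - m)")
      case True
      have "g \<in> centre_coordinate (d - m) ` centre_component (d - m)" for g
        using centre_cochain_component[OF True, of "g ()"] by (intro image_eqI[of _ _ "centre_cochain (g ()) (nat (d - m))"]) (auto simp: fun_eq_iff)
      thus ?thesis using True by auto
    next
      case False
      thus ?thesis using zero_centre_component[of "d - m"] by (auto simp: centre_coordinate_def fun_eq_iff image_iff)
    qed
    show "(centre_coordinate (d - m) f = centre_coordinate (d - m) g) = (co (f []) = co (g []))"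
      if "f \<in> centre_component (d - m)" "g \<in> centre_component (d - m)" for f g
    proof
      assume "centre_coordinate (d - m) f = centre_coordinate (d - m) g"
      hence "centre_coordinate (d - m) f () = centre_coordinate (d - m) g ()" by (rule fun_cong)
      thus "co (f []) = co (g [])"
        unfolding centre_component_value[OF that(1)] centre_component_value[OF that(2)] by (rule arg_cong)
    next
      assume "co (f []) = co (g [])"
      thus "centre_coordinate (d - m) f = centre_coordinate (d - m) g"
        by (simp only: centre_coordinate_def)
    qed
    show "f \<oplus>\<^bsub>cocycle_space 0\<^esub> g \<in> centre_component (d - m) \<and>
        centre_coordinate (d - m) (f \<oplus>\<^bsub>cocycle_space 0\<^esub> g) = centre_coordinate (d - m) f + centre_coordinate (d - m) g"
      if "f \<in> centre_component (d - m)" "g \<in> centre_component (d - m)" for f g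
      using that centre_component_closed(1)[OF that] co0(1)[OF W W, OF that]
      by (simp add: centre_coordinate_def fun_eq_iff pointwise)
    show "c \<odot>\<^bsub>cocycle_space 0\<^esub> f \<in> centre_component (d - m) \<and>
        centre_coordinate (d - m) (c \<odot>\<^bsub>cocycle_space 0\<^esub> f) = scl c (centre_coordinate (d - m) f)"
      if "f \<in> centre_component (d - m)" for f c
      using that centre_component_closed(2)[OF that] co0(2)[OF W W, OF that that]
      by (simp add: centre_coordinate_def fun_eq_iff)
  qed (use W in \<open>auto simp: U_simps cocycle_space_group coboundaries_0 co0 cocycle_closed zero_centre_component
        simp del: coboundaries.simps\<close>)
  thus "vectorspace.fin_dim CC (gcomp U d)"
    "vectorspace.dim CC (gcomp U d) = of_bool (central_degree (d - m))" by simp_all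
  show "gr U d = {\<zero>\<^bsub>U\<^esub>}" if "\<not> central_degree (d - m)"
  proof -
    have "?N +>\<^bsub>cocycle_space 0\<^esub> f = ?N" if f: "f \<in> centre_component (d - m)" for f
    proof -
      have "co (f []) = 0"
        using centre_component_value[OF f] \<open>\<not> central_degree (d - m)\<close> by (simp add: centre_coordinate_def)
      thus ?thesis using coset[OF W[OF f]] by (simp add: coboundaries_0 del: coboundaries.simps)
    qed
    thus ?thesis unfolding U_simps using zero_centre_component[of "d - m"] by blast
  qed
qed

end

section \<open>The preprojective algebra in coordinates\<close>

context type_T
begin

lemma preprojective_T_eq: "preprojective_T n = quotient_module Q.R J"
  by (simp add: preprojective_T_def J_def Let_def)

lemma J_kernel: "J = {f \<in> carrier Q.R. phi f = 0}"
  using J_eq_kernel by blast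

lemma coset_fibre:
  assumes f: "f \<in> carrier Q.R"
  shows "J +>\<^bsub>Q.R\<^esub> f = {g \<in> carrier Q.R. phi g = phi f}"
  unfolding J_kernel using kernel_coset[OF R.is_abelian_group _ f, of phi] phi_add by simp

text \<open>
  Any element of the class may be chosen, since the ideal is the kernel of \<open>phi\<close>.
\<close>
definition class_value :: "((nat, T_arrow) path \<Rightarrow> complex) set \<Rightarrow> walk_type \<Rightarrow> complex" where
  "class_value X = phi (SOME f. f \<in> X)"

lemma class_value_coset:
  assumes f: "f \<in> carrier Q.R"
  shows "class_value (J +>\<^bsub>Q.R\<^esub> f) = phi f"
proof -
  have "f \<in> J +>\<^bsub>Q.R\<^esub> f" using f by (simp add: coset_fibre)
  from someI[of "\<lambda>g. g \<in> J +>\<^bsub>Q.R\<^esub> f", OF this] show ?thesis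
    unfolding class_value_def by (simp add: coset_fibre[OF f])
qed

lemma coset_scl:
  assumes f: "f \<in> carrier Q.R"
  shows "(\<Union>x\<in>J +>\<^bsub>Q.R\<^esub> f. J +>\<^bsub>Q.R\<^esub> (scl c x)) = J +>\<^bsub>Q.R\<^esub> (scl c f)"
proof -
  have "J +>\<^bsub>Q.R\<^esub> (scl c x) = J +>\<^bsub>Q.R\<^esub> (scl c f)" if "x \<in> J +>\<^bsub>Q.R\<^esub> f" for x
    using that f by (simp add: coset_fibre Q.scl_closed phi_scl)
  moreover have "f \<in> J +>\<^bsub>Q.R\<^esub> f" using f by (simp add: coset_fibre)
  ultimately show ?thesis by blast
qed

lemma quotient_simps:
  "carrier (quotient_module Q.R J) = (\<lambda>f. J +>\<^bsub>Q.R\<^esub> f) ` carrier Q.R"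
  "gr (quotient_module Q.R J) d = (\<lambda>f. J +>\<^bsub>Q.R\<^esub> f) ` gr Q.R d"
  "\<zero>\<^bsub>quotient_module Q.R J\<^esub> = J"
  "f \<in> carrier Q.R \<Longrightarrow> g \<in> carrier Q.R \<Longrightarrow>
    (J +>\<^bsub>Q.R\<^esub> f) \<otimes>\<^bsub>quotient_module Q.R J\<^esub> (J +>\<^bsub>Q.R\<^esub> g) = J +>\<^bsub>Q.R\<^esub> (f \<otimes>\<^bsub>Q.R\<^esub> g)"
  "f \<in> carrier Q.R \<Longrightarrow> g \<in> carrier Q.R \<Longrightarrow>
    (J +>\<^bsub>Q.R\<^esub> f) \<oplus>\<^bsub>quotient_module Q.R J\<^esub> (J +>\<^bsub>Q.R\<^esub> g) = J +>\<^bsub>Q.R\<^esub> (f + g)"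
  "f \<in> carrier Q.R \<Longrightarrow> c \<odot>\<^bsub>quotient_module Q.R J\<^esub> (J +>\<^bsub>Q.R\<^esub> f) = J +>\<^bsub>Q.R\<^esub> (scl c f)"
  using J.a_rcos_sum[of f g]
  by (auto simp: quotient_module_def A_RCOSETS_def' J.rcoset_mult_add coset_scl)

lemma gr_R: "f \<in> gr Q.R d \<longleftrightarrow> f \<in> carrier Q.R \<and> (\<forall>u p v. f (u, p, v) \<noteq> 0 \<longrightarrow> int (length p) = d)"
  by (auto simp: path_algebra_def)

lemma phi_homogeneous:
  assumes "f \<in> gr Q.R d" "phi f (u, v, e) \<noteq> 0"
  shows "int e = d"
proof -
  obtain x where x: "f x \<noteq> 0" "path_value x (u, v, e) \<noteq> 0"
    using assms(2) unfolding phi_def by (rule lin_nonzero)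
  obtain u' p v' where "x = (u', p, v')" by (cases x)
  thus ?thesis using x assms(1) unfolding gr_R by (auto simp: path_value_def ev_def)
qed

lemma rep_homogeneous:
  assumes "\<And>u v e. y (u, v, e) \<noteq> 0 \<Longrightarrow> int e = d"
  shows "rep y \<in> gr Q.R d"
  unfolding gr_R
proof (intro conjI allI impI rep_closed)
  fix u p v assume "rep y (u, p, v) \<noteq> 0"
  hence "(\<Sum>a\<in>I. scl (y a) (delta (fst a, normal_form a, fst (snd a))) (u, p, v)) \<noteq> 0"
    unfolding rep_def sum_fun_apply .
  then obtain a where a: "a \<in> I" "scl (y a) (delta (fst a, normal_form a, fst (snd a))) (u, p, v) \<noteq> 0"
    by (rule sum.not_neutral_contains_not_neutral)
  obtain u' v' e where e: "a = (u', v', e)" by (cases a)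
  have "y a \<noteq> 0" "p = normal_form a" using a(2) by (auto simp: delta_def)
  thus "int (length p) = d" using a(1) walk_normal_form(2) assms by (simp add: e)
qed

text \<open>
  The section \<open>rep\<close> gives surjectivity, and it takes homogeneous functions to homogeneous elements because
  normal forms have the length prescribed by their type.
\<close>
theorem preprojective_coordinates: "T_coordinates n (preprojective_T n) class_value"
  unfolding preprojective_T_eq
proof (unfold_locales)
  let ?A = "quotient_module Q.R J"
  show "bij_betw class_value (carrier ?A) M"
  proof (rule bij_betw_imageI)
    show "inj_on class_value (carrier ?A)"
    proof (rule inj_onI)
      fix X Y assume "X \<in> carrier ?A" "Y \<in> carrier ?A" and eq: "class_value X = class_value Y"
      then obtain f g where "f \<in> carrier Q.R" "X = J +>\<^bsub>Q.R\<^esub> f" "g \<in> carrier Q.R" "Y = J +>\<^bsub>Q.R\<^esub> g"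
        unfolding quotient_simps(1) by blast
      thus "X = Y" using eq class_value_coset[of f] class_value_coset[of g] by (simp add: coset_fibre)
    qed
    show "class_value ` carrier ?A = M"
    proof
      show "class_value ` carrier ?A \<subseteq> M" by (auto simp: quotient_simps(1) class_value_coset)
      show "M \<subseteq> class_value ` carrier ?A"
      proof
        fix y assume "y \<in> M"
        hence "y = class_value (J +>\<^bsub>Q.R\<^esub> rep y)" by (simp add: class_value_coset rep_closed phi_rep)
        thus "y \<in> class_value ` carrier ?A" unfolding quotient_simps(1) using rep_closed by blast
      qed
    qed
  qed
  fix X assume "X \<in> carrier ?A"
  then obtain f where f: "f \<in> carrier Q.R" "X = J +>\<^bsub>Q.R\<^esub> f" by (auto simp: quotient_simps(1))
  show "c \<odot>\<^bsub>?A\<^esub> X \<in> carrier ?A \<and> class_value (c \<odot>\<^bsub>?A\<^esub> X) = scl c (class_value X)" for c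
    unfolding f(2) quotient_simps(6)[OF f(1)] quotient_simps(1)
    using f(1) by (simp add: class_value_coset Q.scl_closed phi_scl)
  fix Y assume "Y \<in> carrier ?A"
  then obtain g where g: "g \<in> carrier Q.R" "Y = J +>\<^bsub>Q.R\<^esub> g" by (auto simp: quotient_simps(1))
  show "X \<oplus>\<^bsub>?A\<^esub> Y \<in> carrier ?A \<and> class_value (X \<oplus>\<^bsub>?A\<^esub> Y) = class_value X + class_value Y"
    unfolding f(2) g(2) quotient_simps(5)[OF f(1) g(1)] quotient_simps(1)
    using f(1) g(1) by (simp add: class_value_coset Q.add_closed phi_add)
  show "X \<otimes>\<^bsub>?A\<^esub> Y \<in> carrier ?A \<and> class_value (X \<otimes>\<^bsub>?A\<^esub> Y) = class_value X \<star> class_value Y"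
    unfolding f(2) g(2) quotient_simps(4)[OF f(1) g(1)] quotient_simps(1)
    using f(1) g(1) by (simp add: class_value_coset Q.mult_closed phi_mult)
next
  let ?A = "quotient_module Q.R J"
  have 0: "J +>\<^bsub>Q.R\<^esub> 0 = J" using coset_fibre[OF Q.zero_closed] unfolding phi_zero J_kernel[symmetric] .
  have "J \<in> (\<lambda>f. J +>\<^bsub>Q.R\<^esub> f) ` carrier Q.R"
    using Q.zero_closed 0 by (metis (no_types, lifting) imageI)
  thus "\<zero>\<^bsub>?A\<^esub> \<in> carrier ?A" unfolding quotient_simps(1,3) .
  show "class_value \<zero>\<^bsub>?A\<^esub> = 0"
    using class_value_coset[OF Q.zero_closed] unfolding quotient_simps(3) 0 phi_zero .
  fix X d
  show "X \<in> gr ?A d \<longleftrightarrow> X \<in> carrier ?A \<and> (\<forall>u v e. class_value X (u, v, e) \<noteq> 0 \<longrightarrow> int e = d)"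
  proof
    assume "X \<in> gr ?A d"
    then obtain f where f: "f \<in> gr Q.R d" "X = J +>\<^bsub>Q.R\<^esub> f" by (auto simp: quotient_simps(2))
    hence "f \<in> carrier Q.R" by (simp add: gr_R)
    thus "X \<in> carrier ?A \<and> (\<forall>u v e. class_value X (u, v, e) \<noteq> 0 \<longrightarrow> int e = d)"
      using f phi_homogeneous by (auto simp: quotient_simps(1) class_value_coset)
  next
    assume X: "X \<in> carrier ?A \<and> (\<forall>u v e. class_value X (u, v, e) \<noteq> 0 \<longrightarrow> int e = d)"
    then obtain f where f: "f \<in> carrier Q.R" "X = J +>\<^bsub>Q.R\<^esub> f" by (auto simp: quotient_simps(1))
    have "rep (phi f) \<in> gr Q.R d"
      using X f by (intro rep_homogeneous) (auto simp: class_value_coset)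
    moreover have "X = J +>\<^bsub>Q.R\<^esub> rep (phi f)"
      using f by (simp add: coset_fibre rep_closed phi_rep)
    ultimately show "X \<in> gr ?A d" unfolding quotient_simps(2) by blast
  qed
qed

end

section \<open>Hilbert series\<close>

lemma sum_of_bool_even:
  fixes d :: int
  assumes "finite S"
  shows "(\<Sum>i\<in>S. of_bool (d = int (2 * i))) = (of_bool (0 \<le> d \<and> even d \<and> nat (d div 2) \<in> S) :: int)"
proof -
  have "(\<Sum>i\<in>S. of_bool (d = int (2 * i)) :: int) = (\<Sum>i\<in>S. if i = nat (d div 2) then of_bool (0 \<le> d \<and> even d) else (0::int))"
  proof (intro sum.cong refl)
    fix i
    have "d = int (2 * i) \<longleftrightarrow> i = nat (d div 2) \<and> 0 \<le> d \<and> even d" by (auto elim!: evenE)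
    thus "of_bool (d = int (2 * i)) = (if i = nat (d div 2) then of_bool (0 \<le> d \<and> even d) else (0::int))" by simp
  qed
  also have "\<dots> = of_bool (0 \<le> d \<and> even d \<and> nat (d div 2) \<in> S)"
    using assms by simp
  finally show ?thesis .
qed

lemma (in T_coordinates) of_bool_central_degree:
  "int (of_bool (central_degree (d - 2))) = (\<Sum>i=1..n. of_bool (d = int (2 * i)))"
  "int (of_bool (central_degree (d - 0))) = (\<Sum>i=0..n - 1. of_bool (d = int (2 * i)))"
  unfolding sum_of_bool_even[OF finite_atLeastAtMost] of_nat_of_bool central_degree_def atLeastAtMost_iff
  using n_pos by (auto elim!: evenE intro!: arg_cong[of _ _ of_bool])

text \<open>
  The coefficients vanish in negative degrees, so \<open>Abs_fls\<close> has them as its coefficients.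
\<close>
lemma Abs_fls_eq_sum_even:
  fixes P :: "int \<Rightarrow> nat"
  assumes "\<And>d. int (P d) = (\<Sum>i\<in>S. of_bool (d = int (2 * i)))"
  shows "Abs_fls (\<lambda>d. int (P d)) = (\<Sum>i\<in>S. (fls_X :: int fls) ^ (2 * i))"
proof (rule fls_eqI)
  fix d :: int
  have "int (P d) = 0" if "d < 0" for d
    using that unfolding assms by (intro sum.neutral) auto
  hence "fls_nth (Abs_fls (\<lambda>d. int (P d))) d = int (P d)"
    by (intro nth_Abs_fls_lower_bound[of 0]) auto
  thus "fls_nth (Abs_fls (\<lambda>d. int (P d))) d = fls_nth (\<Sum>i\<in>S. (fls_X :: int fls) ^ (2 * i)) d"
    by (simp add: assms fls_nth_sum fls_X_power_nth of_bool_def)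
qed

theorem theorem4p0p11:
  fixes n h :: nat
    and A :: "(complex, ((nat, T_arrow) path \<Rightarrow> complex) set) graded_module"
  assumes "n \<ge> 1" and "h = 2 * n + 1"
    and "A = preprojective_T n"
    and "U = gshift 2 (grestrict {d. d < int h - 2} (HH 0 A))"
    and "K = gshift 2 (HH 2 A)"
  shows "(has_hilbert_series U
      \<and> hilbert_series U = (\<Sum>i=1..n. fls_X ^ (2 * i))
      \<and> hilbert_series (gshift (- 2) U) = (\<Sum>i=0..n - 1. fls_X ^ (2 * i)))
    \<and> (vectorspace.fin_dim CC K \<and> vectorspace.dim CC K = n \<and> concentrated_in_degree 0 K)"
proof -
  interpret type_T n using assms(1) by unfold_locales
  interpret T_coordinates n A class_value unfolding assms(3) by (rule preprojective_coordinates)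
  have U: "U = gshift 2 (grestrict {d. d < 2 * int n - 1} (HH 0 A))"
    unfolding assms(4) using assms(2) by simp
  have U': "gshift (- 2) U = gshift 0 (grestrict {d. d < 2 * int n - 1} (HH 0 A))"
    by (simp add: U gshift_def)
  show ?thesis
  proof (intro conjI)
    have "gr U d = {\<zero>\<^bsub>U\<^esub>}" if "d < 0" for d
      unfolding U using that by (intro HH0_component(3)) (simp add: central_degree_def)
    thus "has_hilbert_series U"
      unfolding has_hilbert_series_def using HH0_component(1)[where m = 2] unfolding U by blast
    show "hilbert_series U = (\<Sum>i=1..n. fls_X ^ (2 * i))"
      unfolding hilbert_series_def U HH0_component(2)
      by (rule Abs_fls_eq_sum_even) (rule of_bool_central_degree(1))
    show "hilbert_series (gshift (- 2) U) = (\<Sum>i=0..n - 1. fls_X ^ (2 * i))"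
      unfolding hilbert_series_def U' HH0_component(2)
      by (rule Abs_fls_eq_sum_even) (rule of_bool_central_degree(2))
  qed (use HH2_dimension[OF assms(5)] in blast)+
qed

end
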